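(* Let $G$ be a Lie group, let $K$ be a simplicial complex, let $\{v_\sigma\}$ be a set of compatible transition functions on $K^s$ with values in $G$, and let $F\to|K|$ be the associated principal $G$-bundle. Then: 1) There is a natural prismatic map $P_\cdot\mathrm{St}(K^s)\to P_\cdot BG$ determined by $\{v_\sigma\}$. 2) The induced map on geometric realizations (followed by the evaluation map $ev:\|\,|P_\cdot BG|\,\|\to BG$) gives a classifying map for the bundle $F$ pulled back to $|\mathrm{St}(K)|\subseteq|K|\times|K|$; here $\|\,|P_\cdot\mathrm{St}(K^s)|\,\|$ is related to $|\mathrm{St}(K)|$ by the homotopy equivalence $\lambda$ of the context and $|\mathrm{St}(K)|$ maps to $|K|$ by projection.
   Context: Simplices. $\Delta^p$ is the standard $p$-simplex with barycentric coordinates, $\varepsilon^i:\Delta^{p-1}\to\Delta^p$ and $\eta^i:\Delta^{p+1}\to\Delta^p$ the standard coface and codegeneracy maps, $\Delta^{q_0\dots q_p}=\Delta^{q_0}\times\dots\times\Delta^{q_p}$. Throughout $q=q_0+\dots+q_p$. Simplicial complexes. $K$ has linearly ordered vertices $a_1,\dots,a_N$. $K^s$ is the associated simplicial set: $K^s_n$ is the set of sequences $(a_{i_0},\dots,a_{i_n})$ with $i_0\le\dots\le i_n$ (repetitions allowed) whose underlying set is a simplex of $K$; $|K^s|=|K|$. $\mathrm{St}(K)\subseteq K\times K$ is the subcomplex of pairs $(\sigma,\tau)$ such that $\sigma\cup\tau$ is contained in some simplex $\sigma'$ of $K$, i.e. of all faces of $\sigma'\times\sigma'$, $\sigma'\in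 K$. For a simplicial set $S$, $\mathrm{St}(S)$ is the simplicial subset of $\delta(S\times S)$ ($\delta(S\times S)_n=S_n\times S_n$) generated by all simplices of the form $(s_{\nu_r}\circ\dots\circ s_{\nu_1}\circ d_{\nu_1}\circ\dots\circ d_{\nu_r}\sigma',\ s_{\mu_l}\circ\dots\circ s_{\mu_1}\circ d_{\mu_1}\circ\dots\circ d_{\mu_l}\sigma')$, where $\sigma'\in S_n$, $n=l+r$, $0\le\nu_1<\dots<\nu_r<n$, $0\le\mu_1<\dots<\mu_l\le n$, $\mu_i\ne\nu_j$ for all $i,j$ (and the composites are defined). One identifies $|\mathrm{St}(K^s)|=|\mathrm{St}(K)|$. Prismatic sets. A prismatic set $P$ is a sequence, $p\ge0$, of $(p+1)$-multi-simplicial sets $P_{p,q_0,\dots,q_p}$, with operators $d^i_j$ (lowering $q_i$ by one) and $s^i_j$ (raising $q_i$ by one), $0\le j\le q_i$, satisfying the simplicial identities for fixed $i$ and commuting for different $i$, together with face operators $d_k:P_{p,q_0,\dots,q_p}\to P_{p-1,q_0,\dots,\hat q_k,\dots,q_p}$ satisfying $d_id_j=d_{j-1}d_i$ for $i<j$ and commuting with the $d^i_j,s^i_j$ (where operators in the deleted $k$-th direction become the identity after applying $d_k$). A prismatic map is a family of maps commuting with all these operators. Realization: $|P_{p}|=\bigsqcup\Delta^{q_0\dots q_p}\times P_{p,q_0,\dots,q_p}/\!\sim$ using the $d^i_j,s^i_j$; then $\|\,|P_\cdot|\,\|=\bigsqcup_p\Delta^p\times|P_p|/\!\sim$ with $(\varepsilon^kt,s,x)\sim(t,\pi_ks,d_kx)$,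 where $\pi_k$ deletes the $k$-th factor of $\Delta^{q_0\dots q_p}$. $P_\cdot\mathrm{St}(S)$ is the prismatic set with $$P_p\mathrm{St}(S)_{q_0,\dots,q_p}=\{(\sigma,\tau,\bar\sigma)\mid(\sigma,\tau)\in\mathrm{St}(S)_{q+p},\ \bar\sigma\in S_p,\ \sigma=\mu_{q_0,\dots,q_p}(\bar\sigma)\},$$ where $\mu_{q_0,\dots,q_p}:S_p\to S_{q+p}$ is the iterated degeneracy operator repeating the $i$-th vertex $q_i+1$ times for $i=0,\dots,p$. With $Q_i=q_0+\dots+q_{i-1}+i$, the operators $d^i_j,s^i_j$ act as $d_{Q_i+j},s_{Q_i+j}$ on $(\sigma,\tau)$ and trivially on $\bar\sigma$, and $d_i$ acts as $d_{Q_i}\circ\dots\circ d_{Q_i+q_i}$ on $(\sigma,\tau)$ and as $d_i$ on $\bar\sigma$. The map $\lambda:\|\,|P_\cdot\mathrm{St}(S)|\,\|\to|\mathrm{St}(S)|$, $\lambda(t,s^0,\dots,s^p,(\sigma,\tau,\bar\sigma))=((t_0s^0,\dots,t_ps^p),(\sigma,\tau))$, is a homotopy equivalence. Compatible transition functions on a simplicial set $S$: continuous maps $v_\sigma:\Delta^{p-1}\to G$, one for each $\sigma\in S_p$, $p\ge1$, such that for $\sigma\in S_p$, $p\geq 2$: $v_\sigma\circ\varepsilon^i=v_{d_i\sigma}$ for $i<p-1$ and $v_\sigma\circ\varepsilon^{p-1}=v_{d_{p-1}\sigma}\cdot(v_{d_p\sigma})^{-1}$; and for $\sigma\in S_p$: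 $v_{s_j\sigma}=v_\sigma\circ\eta^j$ for $0\le j\le p-1$ and $v_{s_p\sigma}=1$. The associated principal $G$-bundle $F\to|S|$ is obtained from $\bigsqcup_{p}\bigsqcup_{\sigma\in S_p}\Delta^p\times\{\sigma\}\times G$ by $(t,d_i\sigma,g)\sim(\varepsilon^it,\sigma,v_{\sigma,d_i\sigma}(t)g)$ with $v_{\sigma,d_i\sigma}=1$ for $i<p$, $v_{\sigma,d_p\sigma}=v_\sigma$, and $(t,s_i\sigma,g)\sim(\eta^it,\sigma,g)$. Prismatic classifying space. $EG$ is the geometric realization of the simplicial space $EG_p=G^{p+1}$, with $G$ acting diagonally on the right, $BG=EG/G$. $P_pEG_{q_0,\dots,q_p}$ is the set of continuous maps $a=(a_0,\dots,a_p):\Delta^p\times\Delta^{q_0\dots q_p}\to G^{p+1}$ of the form $a(t,s^0,\dots,s^p)=(a_0(t,s^0),a_1(t,s^0,s^1),\dots,a_p(t,s^0,\dots,s^p))$ such that for all $i$ and all $j\ne i$, $a_j(\varepsilon^it,s)$ is independent of $s^i$. The operators $d^i_j,s^i_j$ are precomposition with coface and codegeneracy maps in the factor $\Delta^{q_i}$; $d_k$ restricts $a$ along $\varepsilon^k\times\mathrm{id}$ and drops $a_k$. $S_pG=\mathrm{Map}(\Delta^p,G)$ acts by $(a\cdot g)_j(t,s)=a_j(t,s)g(t)$, and $P_pBG_{q_0,\dots,q_p}=P_pEG_{q_0,\dots,q_p}/S_pG$. The evaluation map $ev:\|\,|P_\cdot BG|\,\|\to BG$ sends $(t,s,[a])$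 to the class of $(t,a(t,s))$. A classifying map for a principal $G$-bundle is a map to $BG$ under which $EG\to BG$ pulls back to a bundle isomorphic to the given one. *)

theory Defs
  imports "HOL-Analysis.Analysis" "HOL-Homology.Homology"
begin

section \<open>Quotient spaces\<close>

text \<open>
  \<open>qclass X r x\<close> is the class of \<open>x\<close> under the equivalence relation on \<open>topspace X\<close> generated by
  \<open>r\<close>, and \<open>quot_space X r\<close> is the set of these classes with the quotient topology.
  \<open>qlift f\<close> is the map induced on classes by a map \<open>f\<close> that is constant on classes.
\<close>

definition qclass :: "'x topology \<Rightarrow> ('x \<Rightarrow> 'x \<Rightarrow> bool) \<Rightarrow> 'x \<Rightarrow> 'x set" where
  "qclass X r x = {y \<in> topspace X.
      equivclp (\<lambda>a b. a \<in> topspace X \<and> b \<in> topspace X \<and> r a b) x y}"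

definition quot_space :: "'x topology \<Rightarrow> ('x \<Rightarrow> 'x \<Rightarrow> bool) \<Rightarrow> 'x set topology" where
  "quot_space X r = topology (\<lambda>U. U \<subseteq> qclass X r ` topspace X \<and>
      openin X {x \<in> topspace X. qclass X r x \<in> U})"

definition qlift :: "('x \<Rightarrow> 'y) \<Rightarrow> 'x set \<Rightarrow> 'y" where
  "qlift f C = the_elem (f ` C)"

lemma openin_quot_space:
  "openin (quot_space X r) U \<longleftrightarrow>
     U \<subseteq> qclass X r ` topspace X \<and> openin X {x \<in> topspace X. qclass X r x \<in> U}"
proof -
  let ?L = "\<lambda>U. U \<subseteq> qclass X r ` topspace X \<and> openin X {x \<in> topspace X. qclass X r x \<in> U}"
  have "istopology ?L"
    unfolding istopology_def
  proof (intro conjI allI impI)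
    fix S T assume S: "?L S" and T: "?L T"
    have eq: "{x \<in> topspace X. qclass X r x \<in> S \<inter> T}
        = {x \<in> topspace X. qclass X r x \<in> S} \<inter> {x \<in> topspace X. qclass X r x \<in> T}" by blast
    show "S \<inter> T \<subseteq> qclass X r ` topspace X" using S by blast
    show "openin X {x \<in> topspace X. qclass X r x \<in> S \<inter> T}"
      unfolding eq using S T by (intro openin_Int) auto
  next
    fix \<K> assume K: "\<forall>U\<in>\<K>. ?L U"
    have eq: "{x \<in> topspace X. qclass X r x \<in> \<Union>\<K>}
        = (\<Union>U\<in>\<K>. {x \<in> topspace X. qclass X r x \<in> U})" by blast
    show "\<Union>\<K> \<subseteq> qclass X r ` topspace X" using K by blast
    show "openin X {x \<in> topspace X. qclass X r x \<in> \<Union>\<K>}"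
      unfolding eq using K by (intro openin_Union) auto
  qed
  then show ?thesis by (simp add: quot_space_def)
qed

lemma topspace_quot_space: "topspace (quot_space X r) = qclass X r ` topspace X"
proof -
  have "{x \<in> topspace X. qclass X r x \<in> qclass X r ` topspace X} = topspace X" by blast
  then have "openin (quot_space X r) (qclass X r ` topspace X)"
    by (simp add: openin_quot_space)
  then show ?thesis
    by (meson openin_quot_space openin_subset openin_topspace subset_antisym)
qed

lemma quotient_map_qclass: "quotient_map X (quot_space X r) (qclass X r)"
  unfolding quotient_map_def topspace_quot_space by (auto simp: openin_quot_space)


section \<open>Lie groups\<close>

text \<open>
  Smoothness on an open subset of \<open>\<real>\<^sup>n\<close> (\<open>Euclidean_space n\<close>, i.e. sequences vanishing from
  index \<open>n\<close> on; \<open>n = 0\<close> is allowed, as for countable discrete groups): all iterated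
  partial derivatives exist and are continuous.
\<close>

definition partial_deriv :: "nat \<Rightarrow> ((nat \<Rightarrow> real) \<Rightarrow> real) \<Rightarrow> (nat \<Rightarrow> real) \<Rightarrow> real" where
  "partial_deriv i f x = deriv (\<lambda>u. f (x(i := u))) (x i)"

primrec C_k_on :: "nat \<Rightarrow> nat \<Rightarrow> (nat \<Rightarrow> real) set \<Rightarrow> ((nat \<Rightarrow> real) \<Rightarrow> real) \<Rightarrow> bool" where
  "C_k_on 0 n U f \<longleftrightarrow> continuous_map (subtopology (Euclidean_space n) U) euclideanreal f"
| "C_k_on (Suc k) n U f \<longleftrightarrow>
     continuous_map (subtopology (Euclidean_space n) U) euclideanreal f \<and>
     (\<forall>i<n. (\<forall>x\<in>U. (\<lambda>u. f (x(i := u))) differentiable at (x i)) \<and>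
            C_k_on k n U (partial_deriv i f))"

definition smooth_on ::
    "nat \<Rightarrow> nat \<Rightarrow> (nat \<Rightarrow> real) set \<Rightarrow> ((nat \<Rightarrow> real) \<Rightarrow> nat \<Rightarrow> real) \<Rightarrow> bool" where
  "smooth_on n m U f \<longleftrightarrow> openin (Euclidean_space n) U \<and> (\<forall>j<m. \<forall>k. C_k_on k n U (\<lambda>x. f x j))"

text \<open>A chart is a pair of its domain and its coordinate map; an atlas need not be maximal.\<close>

definition smooth_atlas ::
    "'g topology \<Rightarrow> nat \<Rightarrow> ('g set \<times> ('g \<Rightarrow> nat \<Rightarrow> real)) set \<Rightarrow> bool" where
  "smooth_atlas T n \<A> \<longleftrightarrow>
     (\<Union>(U, \<phi>)\<in>\<A>. U) = topspace T \<and>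
     (\<forall>(U, \<phi>)\<in>\<A>. openin T U \<and> openin (Euclidean_space n) (\<phi> ` U) \<and>
        homeomorphic_map (subtopology T U) (subtopology (Euclidean_space n) (\<phi> ` U)) \<phi>) \<and>
     (\<forall>(U, \<phi>)\<in>\<A>. \<forall>(V, \<psi>)\<in>\<A>. smooth_on n n (\<phi> ` (U \<inter> V)) (\<lambda>x. \<psi> (inv_into U \<phi> x)))"

text \<open>The two halves of a vector in \<open>\<real>\<^sup>n \<times> \<real>\<^sup>n = \<real>\<^sup>2\<^sup>n\<close>.\<close>

definition fst_half :: "nat \<Rightarrow> (nat \<Rightarrow> real) \<Rightarrow> nat \<Rightarrow> real" where
  "fst_half n z = (\<lambda>i. if i < n then z i else 0)"

definition snd_half :: "nat \<Rightarrow> (nat \<Rightarrow> real) \<Rightarrow> nat \<Rightarrow> real" where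
  "snd_half n z = (\<lambda>i. if i < n then z (n + i) else 0)"

definition lie_group ::
    "('g, 'm) monoid_scheme \<Rightarrow> 'g topology \<Rightarrow> nat \<Rightarrow> ('g set \<times> ('g \<Rightarrow> nat \<Rightarrow> real)) set \<Rightarrow> bool"
  where
  "lie_group G T n \<A> \<longleftrightarrow>
     group G \<and> topspace T = carrier G \<and> Hausdorff_space T \<and> second_countable T \<and>
     smooth_atlas T n \<A> \<and>
     continuous_map (prod_topology T T) T (\<lambda>(x, y). x \<otimes>\<^bsub>G\<^esub> y) \<and>
     continuous_map T T (\<lambda>x. inv\<^bsub>G\<^esub> x) \<and>
     (\<forall>(U, \<phi>)\<in>\<A>. \<forall>(V, \<psi>)\<in>\<A>. \<forall>(W, \<theta>)\<in>\<A>.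
        let m = (\<lambda>z. inv_into U \<phi> (fst_half n z) \<otimes>\<^bsub>G\<^esub> inv_into V \<psi> (snd_half n z))
        in smooth_on (2 * n) n
             {z \<in> topspace (Euclidean_space (2 * n)).
                fst_half n z \<in> \<phi> ` U \<and> snd_half n z \<in> \<psi> ` V \<and> m z \<in> W}
             (\<lambda>z. \<theta> (m z))) \<and>
     (\<forall>(U, \<phi>)\<in>\<A>. \<forall>(V, \<psi>)\<in>\<A>.
        smooth_on n n {x \<in> \<phi> ` U. inv\<^bsub>G\<^esub> (inv_into U \<phi> x) \<in> V}
          (\<lambda>x. \<psi> (inv\<^bsub>G\<^esub> (inv_into U \<phi> x))))"


section \<open>Bundles with a right \<open>G\<close>-action\<close>

record ('e, 'x, 'g) g_bundle =
  tot_space :: "'e topology"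
  proj :: "'e \<Rightarrow> 'x"
  act :: "'e \<Rightarrow> 'g \<Rightarrow> 'e"

definition pullback_bundle ::
    "'y topology \<Rightarrow> ('y \<Rightarrow> 'x) \<Rightarrow> ('e, 'x, 'g) g_bundle \<Rightarrow> ('y \<times> 'e, 'y, 'g) g_bundle" where
  "pullback_bundle Y f E =
     \<lparr> tot_space = subtopology (prod_topology Y (tot_space E)) {(y, e). f y = proj E e},
       proj = fst,
       act = (\<lambda>(y, e) g. (y, act E e g)) \<rparr>"

definition bundle_isomorphic ::
    "('g, 'm) monoid_scheme \<Rightarrow> ('e, 'x, 'g) g_bundle \<Rightarrow> ('f, 'x, 'g) g_bundle \<Rightarrow> bool" where
  "bundle_isomorphic G E E' \<longleftrightarrow>
     (\<exists>h. homeomorphic_map (tot_space E) (tot_space E') h \<and>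
        (\<forall>e\<in>topspace (tot_space E). proj E' (h e) = proj E e \<and>
           (\<forall>g\<in>carrier G. h (act E e g) = act E' (h e) g)))"


section \<open>Simplices\<close>

abbreviation simplex_top :: "nat \<Rightarrow> (nat \<Rightarrow> real) topology" where
  "simplex_top p \<equiv> subtopology (powertop_real UNIV) (standard_simplex p)"

text \<open>The coface map \<open>\<epsilon>\<^sup>i\<close> is \<^const>\<open>simplical_face\<close>; the codegeneracy \<open>\<eta>\<^sup>i\<close> adds the coordinates
  \<open>i\<close> and \<open>i + 1\<close>.\<close>

definition codegen :: "nat \<Rightarrow> (nat \<Rightarrow> real) \<Rightarrow> nat \<Rightarrow> real" where
  "codegen i t = (\<lambda>k. if k < i then t k else if k = i then t i + t (Suc i) else t (Suc k))"

definition omit :: "nat \<Rightarrow> (nat \<Rightarrow> 'b) \<Rightarrow> nat \<Rightarrow> 'b" where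
  "omit k f = (\<lambda>i. if i < k then f i else f (Suc i))"

definition insert_at :: "nat \<Rightarrow> 'b \<Rightarrow> (nat \<Rightarrow> 'b) \<Rightarrow> nat \<Rightarrow> 'b" where
  "insert_at k y f = (\<lambda>i. if i < k then f i else if i = k then y else f (i - 1))"

definition repeat_at :: "nat \<Rightarrow> (nat \<Rightarrow> 'b) \<Rightarrow> nat \<Rightarrow> 'b" where
  "repeat_at k f = (\<lambda>i. if i \<le> k then f i else f (i - 1))"

definition omit_nth :: "nat \<Rightarrow> 'b list \<Rightarrow> 'b list" where
  "omit_nth k xs = take k xs @ drop (Suc k) xs"

definition repeat_nth :: "nat \<Rightarrow> 'b list \<Rightarrow> 'b list" where
  "repeat_nth k xs = take (Suc k) xs @ drop k xs"


section \<open>Simplicial sets\<close>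

text \<open>
  The operators are not indexed by the dimension of their argument, so an element is expected to
  determine its dimension. This holds in the simplicial sets used below, where it is the length
  of a vertex sequence minus one.
\<close>

record 's sset =
  simplices :: "nat \<Rightarrow> 's set"
  face :: "nat \<Rightarrow> 's \<Rightarrow> 's"
  degen :: "nat \<Rightarrow> 's \<Rightarrow> 's"

inductive sreal_rel :: "'s sset \<Rightarrow> (nat \<times> 's) \<times> (nat \<Rightarrow> real) \<Rightarrow> (nat \<times> 's) \<times> (nat \<Rightarrow> real) \<Rightarrow> bool"
  for S :: "'s sset" where
  "\<sigma> \<in> simplices S (Suc n) \<Longrightarrow> i \<le> Suc n \<Longrightarrow> t \<in> standard_simplex n \<Longrightarrow>
     sreal_rel S ((n, face S i \<sigma>), t) ((Suc n, \<sigma>), simplical_face i t)"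
| "\<sigma> \<in> simplices S n \<Longrightarrow> i \<le> n \<Longrightarrow> t \<in> standard_simplex (Suc n) \<Longrightarrow>
     sreal_rel S ((Suc n, degen S i \<sigma>), t) ((n, \<sigma>), codegen i t)"

definition sreal_cells :: "'s sset \<Rightarrow> ((nat \<times> 's) \<times> (nat \<Rightarrow> real)) topology" where
  "sreal_cells S = sum_topology (\<lambda>(n, \<sigma>). simplex_top n) {(n, \<sigma>). \<sigma> \<in> simplices S n}"

definition sreal_class ::
    "'s sset \<Rightarrow> (nat \<times> 's) \<times> (nat \<Rightarrow> real) \<Rightarrow> ((nat \<times> 's) \<times> (nat \<Rightarrow> real)) set" where
  "sreal_class S = qclass (sreal_cells S) (sreal_rel S)"

definition sreal :: "'s sset \<Rightarrow> ((nat \<times> 's) \<times> (nat \<Rightarrow> real)) set topology" where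
  "sreal S = quot_space (sreal_cells S) (sreal_rel S)"

text \<open>
  \<open>collapse S [\<nu>\<^sub>1, \<dots>, \<nu>\<^sub>r]\<close> is \<open>s\<^sub>\<nu>\<^sub>r \<circ> \<dots> \<circ> s\<^sub>\<nu>\<^sub>1 \<circ> d\<^sub>\<nu>\<^sub>1 \<circ> \<dots> \<circ> d\<^sub>\<nu>\<^sub>r\<close>. On an \<open>n\<close>-simplex its last factor
  \<open>s\<^sub>\<nu>\<^sub>r\<close> is applied in dimension \<open>n - 1\<close>, so the composite is defined only if \<open>\<nu>\<^sub>r < n\<close>. This is
  why both index lists below are bounded by \<open>n\<close> strictly.
\<close>

definition collapse :: "'s sset \<Rightarrow> nat list \<Rightarrow> 's \<Rightarrow> 's" where
  "collapse S \<nu> \<sigma> = fold (degen S) \<nu> (foldr (face S) \<nu> \<sigma>)"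

inductive in_star :: "'s sset \<Rightarrow> nat \<Rightarrow> 's \<Rightarrow> 's \<Rightarrow> bool" for S :: "'s sset" where
  generator: "\<sigma>' \<in> simplices S n \<Longrightarrow> n = length \<mu> + length \<nu> \<Longrightarrow>
     sorted_wrt (<) \<nu> \<Longrightarrow> sorted_wrt (<) \<mu> \<Longrightarrow> \<forall>i\<in>set \<nu>. i < n \<Longrightarrow> \<forall>i\<in>set \<mu>. i < n \<Longrightarrow>
     set \<nu> \<inter> set \<mu> = {} \<Longrightarrow> in_star S n (collapse S \<nu> \<sigma>') (collapse S \<mu> \<sigma>')"
| face: "in_star S (Suc n) \<sigma> \<tau> \<Longrightarrow> i \<le> Suc n \<Longrightarrow> in_star S n (face S i \<sigma>) (face S i \<tau>)"
| degen: "in_star S n \<sigma> \<tau> \<Longrightarrow> i \<le> n \<Longrightarrow> in_star S (Suc n) (degen S i \<sigma>) (degen S i \<tau>)"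

definition star_sset :: "'s sset \<Rightarrow> ('s \<times> 's) sset" where
  "star_sset S =
     \<lparr> simplices = (\<lambda>n. {(\<sigma>, \<tau>). in_star S n \<sigma> \<tau>}),
       face = (\<lambda>i. map_prod (face S i) (face S i)),
       degen = (\<lambda>i. map_prod (degen S i) (degen S i)) \<rparr>"


section \<open>Simplicial complexes\<close>

text \<open>A complex is its set of (nonempty) simplices; its vertices are ordered by the type class.\<close>

definition abstract_complex :: "'a set set \<Rightarrow> bool" where
  "abstract_complex K \<longleftrightarrow>
     finite (\<Union>K) \<and> {} \<notin> K \<and> (\<forall>\<rho>\<in>K. \<forall>\<rho>'. \<rho>' \<subseteq> \<rho> \<and> \<rho>' \<noteq> {} \<longrightarrow> \<rho>' \<in> K)"

definition complex_sset :: "'a::linorder set set \<Rightarrow> 'a list sset" where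
  "complex_sset K =
     \<lparr> simplices = (\<lambda>n. {\<sigma>. length \<sigma> = Suc n \<and> sorted \<sigma> \<and> set \<sigma> \<in> K}),
       face = omit_nth,
       degen = repeat_nth \<rparr>"

definition simplicial_map :: "'a::linorder set set \<Rightarrow> 'a set set \<Rightarrow> ('a \<Rightarrow> 'a) \<Rightarrow> bool" where
  "simplicial_map K L f \<longleftrightarrow>
     (\<forall>n. \<forall>\<sigma>\<in>simplices (complex_sset K) n. map f \<sigma> \<in> simplices (complex_sset L) n)"

text \<open>\<open>|K|\<close> in barycentric coordinates (\<open>K\<close> is finite, so the product topology is the weak one), and \<open>|St(K)| \<subseteq> |K| \<times> |K|\<close>.\<close>

definition complex_space :: "'a set set \<Rightarrow> ('a \<Rightarrow> real) topology" where
  "complex_space K = subtopology (powertop_real UNIV)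
     {x. (\<forall>a. 0 \<le> x a) \<and> {a. x a \<noteq> 0} \<in> K \<and> (\<Sum>a\<in>\<Union>K. x a) = 1}"

definition complex_star_space :: "'a set set \<Rightarrow> (('a \<Rightarrow> real) \<times> ('a \<Rightarrow> real)) topology" where
  "complex_star_space K = subtopology (prod_topology (complex_space K) (complex_space K))
     {(x, y). \<exists>\<rho>\<in>K. {a. x a \<noteq> 0} \<union> {a. y a \<noteq> 0} \<subseteq> \<rho>}"

definition barycentric :: "'a list \<Rightarrow> (nat \<Rightarrow> real) \<Rightarrow> 'a \<Rightarrow> real" where
  "barycentric \<sigma> t = (\<lambda>a. \<Sum>i | i < length \<sigma> \<and> \<sigma> ! i = a. t i)"

definition sreal_to_complex :: "((nat \<times> 'a list) \<times> (nat \<Rightarrow> real)) set \<Rightarrow> 'a \<Rightarrow> real" where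
  "sreal_to_complex = qlift (\<lambda>((n, \<sigma>), t). barycentric \<sigma> t)"

definition sreal_star_to_complex ::
    "((nat \<times> 'a list \<times> 'a list) \<times> (nat \<Rightarrow> real)) set \<Rightarrow> ('a \<Rightarrow> real) \<times> ('a \<Rightarrow> real)" where
  "sreal_star_to_complex = qlift (\<lambda>((n, (\<sigma>, \<tau>)), t). (barycentric \<sigma> t, barycentric \<tau> t))"


section \<open>Transition functions and the associated bundle\<close>

definition compatible_transitions ::
    "('g, 'm) monoid_scheme \<Rightarrow> 'g topology \<Rightarrow> 's sset \<Rightarrow> ('s \<Rightarrow> (nat \<Rightarrow> real) \<Rightarrow> 'g) \<Rightarrow> bool" where
  "compatible_transitions G T S v \<longleftrightarrow>
     (\<forall>p. \<forall>\<sigma>\<in>simplices S (Suc p). continuous_map (simplex_top p) T (v \<sigma>)) \<and>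
     (\<forall>p. \<forall>\<sigma>\<in>simplices S (Suc (Suc p)). \<forall>t\<in>standard_simplex p.
        (\<forall>i<Suc p. v \<sigma> (simplical_face i t) = v (face S i \<sigma>) t) \<and>
        v \<sigma> (simplical_face (Suc p) t) =
          v (face S (Suc p) \<sigma>) t \<otimes>\<^bsub>G\<^esub> inv\<^bsub>G\<^esub> (v (face S (Suc (Suc p)) \<sigma>) t)) \<and>
     (\<forall>p. \<forall>\<sigma>\<in>simplices S p. \<forall>t\<in>standard_simplex p.
        (\<forall>j<p. v (degen S j \<sigma>) t = v \<sigma> (codegen j t)) \<and>
        v (degen S p \<sigma>) t = \<one>\<^bsub>G\<^esub>)"

inductive assoc_rel ::
    "('g, 'm) monoid_scheme \<Rightarrow> 's sset \<Rightarrow> ('s \<Rightarrow> (nat \<Rightarrow> real) \<Rightarrow> 'g) \<Rightarrow>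
     (nat \<times> 's) \<times> (nat \<Rightarrow> real) \<times> 'g \<Rightarrow> (nat \<times> 's) \<times> (nat \<Rightarrow> real) \<times> 'g \<Rightarrow> bool"
  for G :: "('g, 'm) monoid_scheme" and S :: "'s sset" and v :: "'s \<Rightarrow> (nat \<Rightarrow> real) \<Rightarrow> 'g" where
  "\<sigma> \<in> simplices S (Suc p) \<Longrightarrow> i \<le> Suc p \<Longrightarrow> t \<in> standard_simplex p \<Longrightarrow> g \<in> carrier G \<Longrightarrow>
     assoc_rel G S v
       ((p, face S i \<sigma>), t, g)
       ((Suc p, \<sigma>), simplical_face i t, (if i = Suc p then v \<sigma> t else \<one>\<^bsub>G\<^esub>) \<otimes>\<^bsub>G\<^esub> g)"
| "\<sigma> \<in> simplices S p \<Longrightarrow> i \<le> p \<Longrightarrow> t \<in> standard_simplex (Suc p) \<Longrightarrow> g \<in> carrier G \<Longrightarrow>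
     assoc_rel G S v ((Suc p, degen S i \<sigma>), t, g) ((p, \<sigma>), codegen i t, g)"

definition assoc_cells ::
    "'g topology \<Rightarrow> 's sset \<Rightarrow> ((nat \<times> 's) \<times> (nat \<Rightarrow> real) \<times> 'g) topology" where
  "assoc_cells T S = sum_topology (\<lambda>(p, \<sigma>). prod_topology (simplex_top p) T)
     {(p, \<sigma>). \<sigma> \<in> simplices S p}"

definition assoc_bundle ::
    "('g, 'm) monoid_scheme \<Rightarrow> 'g topology \<Rightarrow> 's sset \<Rightarrow> ('s \<Rightarrow> (nat \<Rightarrow> real) \<Rightarrow> 'g) \<Rightarrow>
     (((nat \<times> 's) \<times> (nat \<Rightarrow> real) \<times> 'g) set, ((nat \<times> 's) \<times> (nat \<Rightarrow> real)) set, 'g) g_bundle" where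
  "assoc_bundle G T S v =
     \<lparr> tot_space = quot_space (assoc_cells T S) (assoc_rel G S v),
       proj = qlift (\<lambda>((p, \<sigma>), t, g). sreal_class S ((p, \<sigma>), t)),
       act = (\<lambda>e h. qlift (\<lambda>((p, \<sigma>), t, g).
                qclass (assoc_cells T S) (assoc_rel G S v) ((p, \<sigma>), t, g \<otimes>\<^bsub>G\<^esub> h)) e) \<rparr>"

text \<open>\<open>F \<rightarrow> |K|\<close>, using the identification \<open>|K\<^sup>s| = |K|\<close>.\<close>

definition complex_bundle ::
    "('g, 'm) monoid_scheme \<Rightarrow> 'g topology \<Rightarrow> 'a::linorder set set \<Rightarrow>
     ('a list \<Rightarrow> (nat \<Rightarrow> real) \<Rightarrow> 'g) \<Rightarrow>
     (((nat \<times> 'a list) \<times> (nat \<Rightarrow> real) \<times> 'g) set, 'a \<Rightarrow> real, 'g) g_bundle" where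
  "complex_bundle G T K v =
     (let F = assoc_bundle G T (complex_sset K) v
      in \<lparr> tot_space = tot_space F, proj = sreal_to_complex \<circ> proj F, act = act F \<rparr>)"


section \<open>Prismatic sets\<close>

text \<open>
  The multi-index \<open>(q\<^sub>0, \<dots>, q\<^sub>p)\<close> is a list of length \<open>p + 1\<close>; it is always the multi-index of
  the element to which an operator is applied. \<open>prism_face P qs i j\<close> is \<open>d\<^sup>i\<^sub>j\<close>,
  \<open>prism_degen P qs i j\<close> is \<open>s\<^sup>i\<^sub>j\<close> and \<open>base_face P qs k\<close> is \<open>d\<^sub>k\<close>.
\<close>

record 'x prismatic =
  cells :: "nat list \<Rightarrow> 'x set"
  prism_face :: "nat list \<Rightarrow> nat \<Rightarrow> nat \<Rightarrow> 'x \<Rightarrow> 'x"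
  prism_degen :: "nat list \<Rightarrow> nat \<Rightarrow> nat \<Rightarrow> 'x \<Rightarrow> 'x"
  base_face :: "nat list \<Rightarrow> nat \<Rightarrow> 'x \<Rightarrow> 'x"

abbreviation incr :: "nat list \<Rightarrow> nat \<Rightarrow> nat list" where
  "incr qs i \<equiv> qs[i := Suc (qs ! i)]"

definition prismatic_map :: "'x prismatic \<Rightarrow> 'y prismatic \<Rightarrow> (nat list \<Rightarrow> 'x \<Rightarrow> 'y) \<Rightarrow> bool" where
  "prismatic_map P P' \<Phi> \<longleftrightarrow>
     (\<forall>qs. qs \<noteq> [] \<longrightarrow> (\<forall>x\<in>cells P qs. \<Phi> qs x \<in> cells P' qs)) \<and>
     (\<forall>qs i. i < length qs \<longrightarrow> (\<forall>x\<in>cells P (incr qs i). \<forall>j\<le>Suc (qs ! i).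
        \<Phi> qs (prism_face P (incr qs i) i j x) =
          prism_face P' (incr qs i) i j (\<Phi> (incr qs i) x))) \<and>
     (\<forall>qs i. i < length qs \<longrightarrow> (\<forall>x\<in>cells P qs. \<forall>j\<le>qs ! i.
        \<Phi> (incr qs i) (prism_degen P qs i j x) = prism_degen P' qs i j (\<Phi> qs x))) \<and>
     (\<forall>qs k. 2 \<le> length qs \<and> k < length qs \<longrightarrow> (\<forall>x\<in>cells P qs.
        \<Phi> (omit_nth k qs) (base_face P qs k x) = base_face P' qs k (\<Phi> qs x)))"

abbreviation prism_top :: "nat list \<Rightarrow> (nat \<Rightarrow> nat \<Rightarrow> real) topology" where
  "prism_top qs \<equiv> product_topology (\<lambda>i. simplex_top (qs ! i)) {..<length qs}"

type_synonym 'x prism_point = "(nat list \<times> 'x) \<times> (nat \<Rightarrow> nat \<Rightarrow> real)"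

text \<open>\<open>slice P p\<close> is \<open>|P\<^sub>p|\<close> and \<open>preal P\<close> is \<open>\<parallel> |P| \<parallel>\<close>.\<close>

inductive slice_rel :: "'x prismatic \<Rightarrow> 'x prism_point \<Rightarrow> 'x prism_point \<Rightarrow> bool"
  for P :: "'x prismatic" where
  "i < length qs \<Longrightarrow> x \<in> cells P (incr qs i) \<Longrightarrow> j \<le> Suc (qs ! i) \<Longrightarrow>
     s \<in> topspace (prism_top qs) \<Longrightarrow>
     slice_rel P ((qs, prism_face P (incr qs i) i j x), s)
       ((incr qs i, x), s(i := simplical_face j (s i)))"
| "i < length qs \<Longrightarrow> x \<in> cells P qs \<Longrightarrow> j \<le> qs ! i \<Longrightarrow>
     s \<in> topspace (prism_top (incr qs i)) \<Longrightarrow>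
     slice_rel P ((incr qs i, prism_degen P qs i j x), s)
       ((qs, x), s(i := codegen j (s i)))"

definition slice_cells :: "'x prismatic \<Rightarrow> nat \<Rightarrow> 'x prism_point topology" where
  "slice_cells P p = sum_topology (\<lambda>(qs, x). prism_top qs)
     {(qs, x). length qs = Suc p \<and> x \<in> cells P qs}"

definition slice_class :: "'x prismatic \<Rightarrow> nat \<Rightarrow> 'x prism_point \<Rightarrow> 'x prism_point set" where
  "slice_class P p = qclass (slice_cells P p) (slice_rel P)"

definition slice :: "'x prismatic \<Rightarrow> nat \<Rightarrow> 'x prism_point set topology" where
  "slice P p = quot_space (slice_cells P p) (slice_rel P)"

type_synonym 'x preal_point = "nat \<times> (nat \<Rightarrow> real) \<times> 'x prism_point set"

inductive preal_rel :: "'x prismatic \<Rightarrow> 'x preal_point \<Rightarrow> 'x preal_point \<Rightarrow> bool"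
  for P :: "'x prismatic" where
  "length qs = Suc (Suc p) \<Longrightarrow> k \<le> Suc p \<Longrightarrow> x \<in> cells P qs \<Longrightarrow>
     t \<in> standard_simplex p \<Longrightarrow> s \<in> topspace (prism_top qs) \<Longrightarrow>
     preal_rel P
       (Suc p, simplical_face k t, slice_class P (Suc p) ((qs, x), s))
       (p, t, slice_class P p ((omit_nth k qs, base_face P qs k x), omit k s))"

definition preal_cells :: "'x prismatic \<Rightarrow> 'x preal_point topology" where
  "preal_cells P = sum_topology (\<lambda>p. prod_topology (simplex_top p) (slice P p)) UNIV"

definition preal_class :: "'x prismatic \<Rightarrow> 'x preal_point \<Rightarrow> 'x preal_point set" where
  "preal_class P = qclass (preal_cells P) (preal_rel P)"

definition preal :: "'x prismatic \<Rightarrow> 'x preal_point set topology" where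
  "preal P = quot_space (preal_cells P) (preal_rel P)"

definition slice_map ::
    "'y prismatic \<Rightarrow> (nat list \<Rightarrow> 'x \<Rightarrow> 'y) \<Rightarrow> nat \<Rightarrow> 'x prism_point set \<Rightarrow> 'y prism_point set" where
  "slice_map P' \<Phi> p = qlift (\<lambda>((qs, x), s). slice_class P' p ((qs, \<Phi> qs x), s))"

definition preal_map ::
    "'y prismatic \<Rightarrow> (nat list \<Rightarrow> 'x \<Rightarrow> 'y) \<Rightarrow> 'x preal_point set \<Rightarrow> 'y preal_point set" where
  "preal_map P' \<Phi> = qlift (\<lambda>(p, t, C). preal_class P' (p, t, slice_map P' \<Phi> p C))"


section \<open>The prismatic star\<close>

text \<open>\<open>repeat_vertices S qs = s\<^sub>0\<^bsup>q\<^sub>0\<^esup> \<circ> \<dots> \<circ> s\<^sub>p\<^bsup>q\<^sub>p\<^esup>\<close> is the operator \<open>\<mu>\<close>, and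
  \<open>block_start qs i = q\<^sub>0 + \<dots> + q\<^sub>i\<^sub>-\<^sub>1 + i\<close>.\<close>

definition repeat_vertices :: "'s sset \<Rightarrow> nat list \<Rightarrow> 's \<Rightarrow> 's" where
  "repeat_vertices S qs = foldr (\<lambda>i. degen S i ^^ (qs ! i)) [0..<length qs]"

definition block_start :: "nat list \<Rightarrow> nat \<Rightarrow> nat" where
  "block_start qs i = sum_list (take i qs) + i"

definition total_dim :: "nat list \<Rightarrow> nat" where
  "total_dim qs = sum_list qs + (length qs - 1)"

definition prismatic_star :: "'s sset \<Rightarrow> ('s \<times> 's \<times> 's) prismatic" where
  "prismatic_star S =
     \<lparr> cells = (\<lambda>qs. {(\<sigma>, \<tau>, \<beta>). (\<sigma>, \<tau>) \<in> simplices (star_sset S) (total_dim qs) \<and>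
                  \<beta> \<in> simplices S (length qs - 1) \<and> \<sigma> = repeat_vertices S qs \<beta>}),
       prism_face = (\<lambda>qs i j (\<sigma>, \<tau>, \<beta>).
         (face S (block_start qs i + j) \<sigma>, face S (block_start qs i + j) \<tau>, \<beta>)),
       prism_degen = (\<lambda>qs i j (\<sigma>, \<tau>, \<beta>).
         (degen S (block_start qs i + j) \<sigma>, degen S (block_start qs i + j) \<tau>, \<beta>)),
       base_face = (\<lambda>qs k (\<sigma>, \<tau>, \<beta>).
         let del = foldr (face S) [block_start qs k ..< Suc (block_start qs k + qs ! k)]
         in (del \<sigma>, del \<tau>, face S k \<beta>)) \<rparr>"

text \<open>\<open>join_coords qs t s\<close> is \<open>(t\<^sub>0 s\<^sup>0, \<dots>, t\<^sub>p s\<^sup>p) \<in> \<Delta>\<^sup>q\<^sup>+\<^sup>p\<close>.\<close>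

definition join_coords :: "nat list \<Rightarrow> (nat \<Rightarrow> real) \<Rightarrow> (nat \<Rightarrow> nat \<Rightarrow> real) \<Rightarrow> nat \<Rightarrow> real" where
  "join_coords qs t s = (\<lambda>k. \<Sum>i<length qs. \<Sum>j\<le>qs ! i. if block_start qs i + j = k then t i * s i j else 0)"

definition star_lambda ::
    "'s sset \<Rightarrow> ('s \<times> 's \<times> 's) preal_point set \<Rightarrow> ((nat \<times> 's \<times> 's) \<times> (nat \<Rightarrow> real)) set" where
  "star_lambda S = qlift (\<lambda>(p, t, C).
     qlift (\<lambda>((qs, (\<sigma>, \<tau>, \<beta>)), s).
       sreal_class (star_sset S) ((total_dim qs, (\<sigma>, \<tau>)), join_coords qs t s)) C)"

text \<open>The composite of \<open>\<lambda>\<close> with the canonical map \<open>|St(K\<^sup>s)| \<rightarrow> |St(K)|\<close>. From dimension two on the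
  latter is not onto for the generated simplicial set \<^const>\<open>star_sset\<close>: for vertices
  \<open>a < b < c\<close> of a simplex the edge \<open>(b, a), (c, a)\<close> is missing.\<close>

definition complex_lambda ::
    "'a::linorder set set \<Rightarrow> ('a list \<times> 'a list \<times> 'a list) preal_point set \<Rightarrow>
     ('a \<Rightarrow> real) \<times> ('a \<Rightarrow> real)" where
  "complex_lambda K = sreal_star_to_complex \<circ> star_lambda (complex_sset K)"


section \<open>The classifying space\<close>

type_synonym 'g EG_point = "nat \<times> (nat \<Rightarrow> real) \<times> (nat \<Rightarrow> 'g)"

inductive EG_rel :: "('g, 'm) monoid_scheme \<Rightarrow> 'g EG_point \<Rightarrow> 'g EG_point \<Rightarrow> bool"
  for G :: "('g, 'm) monoid_scheme" where
  "t \<in> standard_simplex p \<Longrightarrow> i \<le> Suc p \<Longrightarrow> a \<in> {..Suc p} \<rightarrow>\<^sub>E carrier G \<Longrightarrow>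
     EG_rel G (Suc p, simplical_face i t, a) (p, t, omit i a)"
| "t \<in> standard_simplex (Suc p) \<Longrightarrow> i \<le> p \<Longrightarrow> a \<in> {..p} \<rightarrow>\<^sub>E carrier G \<Longrightarrow>
     EG_rel G (p, codegen i t, a) (Suc p, t, repeat_at i a)"

definition EG_cells :: "'g topology \<Rightarrow> 'g EG_point topology" where
  "EG_cells T =
     sum_topology (\<lambda>p. prod_topology (simplex_top p) (product_topology (\<lambda>_. T) {..p})) UNIV"

definition EG_class ::
    "('g, 'm) monoid_scheme \<Rightarrow> 'g topology \<Rightarrow> 'g EG_point \<Rightarrow> 'g EG_point set" where
  "EG_class G T = qclass (EG_cells T) (EG_rel G)"

definition EG_space :: "('g, 'm) monoid_scheme \<Rightarrow> 'g topology \<Rightarrow> 'g EG_point set topology" where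
  "EG_space G T = quot_space (EG_cells T) (EG_rel G)"

definition EG_act ::
    "('g, 'm) monoid_scheme \<Rightarrow> 'g topology \<Rightarrow> 'g EG_point set \<Rightarrow> 'g \<Rightarrow> 'g EG_point set" where
  "EG_act G T e g = qlift (\<lambda>(p, t, a). EG_class G T (p, t, \<lambda>i\<in>{..p}. a i \<otimes>\<^bsub>G\<^esub> g)) e"

definition BG_rel ::
    "('g, 'm) monoid_scheme \<Rightarrow> 'g topology \<Rightarrow> 'g EG_point set \<Rightarrow> 'g EG_point set \<Rightarrow> bool" where
  "BG_rel G T e e' \<longleftrightarrow> (\<exists>g\<in>carrier G. e' = EG_act G T e g)"

definition BG_class ::
    "('g, 'm) monoid_scheme \<Rightarrow> 'g topology \<Rightarrow> 'g EG_point set \<Rightarrow> 'g EG_point set set" where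
  "BG_class G T = qclass (EG_space G T) (BG_rel G T)"

definition BG_space ::
    "('g, 'm) monoid_scheme \<Rightarrow> 'g topology \<Rightarrow> 'g EG_point set set topology" where
  "BG_space G T = quot_space (EG_space G T) (BG_rel G T)"

definition EG_bundle ::
    "('g, 'm) monoid_scheme \<Rightarrow> 'g topology \<Rightarrow>
     ('g EG_point set, 'g EG_point set set, 'g) g_bundle" where
  "EG_bundle G T = \<lparr> tot_space = EG_space G T, proj = BG_class G T, act = EG_act G T \<rparr>"

definition classifying_map ::
    "('g, 'm) monoid_scheme \<Rightarrow> 'g topology \<Rightarrow> 'x topology \<Rightarrow> ('e, 'x, 'g) g_bundle \<Rightarrow>
     ('x \<Rightarrow> 'g EG_point set set) \<Rightarrow> bool" where
  "classifying_map G T X E f \<longleftrightarrow>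
     continuous_map X (BG_space G T) f \<and>
     bundle_isomorphic G (pullback_bundle X f (EG_bundle G T)) E"


section \<open>The prismatic classifying space\<close>

type_synonym 'g peg = "(nat \<Rightarrow> real) \<times> (nat \<Rightarrow> nat \<Rightarrow> real) \<Rightarrow> nat \<Rightarrow> 'g"

abbreviation peg_top :: "nat list \<Rightarrow> ((nat \<Rightarrow> real) \<times> (nat \<Rightarrow> nat \<Rightarrow> real)) topology" where
  "peg_top qs \<equiv> prod_topology (simplex_top (length qs - 1)) (prism_top qs)"

text \<open>
  In the triangularity condition, \<open>s\<close> and \<open>s'\<close> agreeing on \<open>{..j}\<close> says that \<open>a\<^sub>j\<close> depends only
  on \<open>t, s\<^sup>0, \<dots>, s\<^sup>j\<close>. Elements are extensional, so that equality of maps is equality of values.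
\<close>

definition PEG :: "'g topology \<Rightarrow> nat list \<Rightarrow> 'g peg set" where
  "PEG T qs = {a \<in> extensional (topspace (peg_top qs)).
     continuous_map (peg_top qs) (product_topology (\<lambda>_. T) {..<length qs}) a \<and>
     (\<forall>t\<in>standard_simplex (length qs - 1).
      \<forall>s\<in>topspace (prism_top qs). \<forall>s'\<in>topspace (prism_top qs). \<forall>j<length qs.
        (\<forall>i\<le>j. s i = s' i) \<longrightarrow> a (t, s) j = a (t, s') j) \<and>
     (\<forall>i<length qs. \<forall>j<length qs. j \<noteq> i \<longrightarrow>
        (\<forall>t\<in>standard_simplex (length qs - 2).
         \<forall>s\<in>topspace (prism_top qs). \<forall>s'\<in>topspace (prism_top qs).
           (\<forall>l. l \<noteq> i \<longrightarrow> s l = s' l) \<longrightarrow>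
             a (simplical_face i t, s) j = a (simplical_face i t, s') j))}"

definition peg_face :: "nat list \<Rightarrow> nat \<Rightarrow> nat \<Rightarrow> 'g peg \<Rightarrow> 'g peg" where
  "peg_face qs i j a = restrict (\<lambda>(t, s). a (t, s(i := simplical_face j (s i))))
     (topspace (peg_top (qs[i := qs ! i - 1])))"

definition peg_degen :: "nat list \<Rightarrow> nat \<Rightarrow> nat \<Rightarrow> 'g peg \<Rightarrow> 'g peg" where
  "peg_degen qs i j a = restrict (\<lambda>(t, s). a (t, s(i := codegen j (s i))))
     (topspace (peg_top (incr qs i)))"

text \<open>
  The components of \<open>a \<circ> (\<epsilon>\<^sup>k \<times> id)\<close> other than the \<open>k\<close>-th do not depend on \<open>s\<^sup>k\<close>, which can
  therefore be given any value; the vertex \<open>0\<close> of \<open>\<Delta>\<close> is used.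
\<close>

definition peg_base_face :: "nat list \<Rightarrow> nat \<Rightarrow> 'g peg \<Rightarrow> 'g peg" where
  "peg_base_face qs k a = restrict
     (\<lambda>(t, s). omit k (a (simplical_face k t, insert_at k (\<lambda>i. if i = 0 then 1 else 0) s)))
     (topspace (peg_top (omit_nth k qs)))"

definition peg_orbit ::
    "('g, 'm) monoid_scheme \<Rightarrow> 'g topology \<Rightarrow> nat list \<Rightarrow> 'g peg \<Rightarrow> 'g peg set" where
  "peg_orbit G T qs a =
     {restrict (\<lambda>(t, s). \<lambda>j\<in>{..<length qs}. a (t, s) j \<otimes>\<^bsub>G\<^esub> g t) (topspace (peg_top qs)) | g.
        continuous_map (simplex_top (length qs - 1)) T g}"

definition PBG :: "('g, 'm) monoid_scheme \<Rightarrow> 'g topology \<Rightarrow> 'g peg set prismatic" where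
  "PBG G T =
     \<lparr> cells = (\<lambda>qs. peg_orbit G T qs ` PEG T qs),
       prism_face = (\<lambda>qs i j. qlift (\<lambda>a. peg_orbit G T (qs[i := qs ! i - 1]) (peg_face qs i j a))),
       prism_degen = (\<lambda>qs i j. qlift (\<lambda>a. peg_orbit G T (incr qs i) (peg_degen qs i j a))),
       base_face = (\<lambda>qs k. qlift (\<lambda>a. peg_orbit G T (omit_nth k qs) (peg_base_face qs k a))) \<rparr>"

definition ev ::
    "('g, 'm) monoid_scheme \<Rightarrow> 'g topology \<Rightarrow> 'g peg set preal_point set \<Rightarrow> 'g EG_point set set" where
  "ev G T = qlift (\<lambda>(p, t, C).
     qlift (\<lambda>((qs, A), s). qlift (\<lambda>a. BG_class G T (EG_class G T (p, t, a (t, s)))) A) C)"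


section \<open>Homotopy inverses\<close>

definition homotopy_inverse ::
    "'x topology \<Rightarrow> 'y topology \<Rightarrow> ('x \<Rightarrow> 'y) \<Rightarrow> ('y \<Rightarrow> 'x) \<Rightarrow> bool" where
  "homotopy_inverse X Y f g \<longleftrightarrow>
     continuous_map X Y f \<and> continuous_map Y X g \<and>
     homotopic_with (\<lambda>_. True) X X (g \<circ> f) id \<and> homotopic_with (\<lambda>_. True) Y Y (f \<circ> g) id"

end

theory Submission
  imports Defs
begin

text \<open>
  On a simplex with vertices \<open>b\<^sub>0 \<le> \<dots> \<le> b\<^sub>p\<close> the bundle \<open>F\<close> comes with a frame attached to the last
  vertex, and the transition functions compare the frames of faces. Let \<open>a\<^sub>j(t)\<close> be the product of
  the \<open>v(b\<^sub>0, \<dots>, b\<^sub>k)\<^sup>-\<^sup>1\<close>, \<open>k = j + 1, \<dots>, p\<close>, evaluated at the points \<open>(t\<^sub>0, \<dots>, t\<^sub>k\<^sub>-\<^sub>1)\<close> with the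
  remaining mass \<open>t\<^sub>k + \<dots> + t\<^sub>p\<close> added to \<open>t\<^sub>j\<close>. By the cocycle condition \<open>a\<^sub>j\<close> is the coordinate of the
  frame in a trivialisation of \<open>F\<close> over the open star of \<open>b\<^sub>j\<close>. Hence \<open>(a\<^sub>0, \<dots>, a\<^sub>p)\<close> defines an equivariant
  map \<open>F \<rightarrow> EG\<close> covering some \<open>f\<^sub>0 : |K| \<rightarrow> BG\<close>, and the prismatic map sends \<open>(\<sigma>, \<tau>, \<beta>)\<close> to the orbit of
  \<open>(a\<^sub>0, \<dots>, a\<^sub>p)\<close> for \<open>\<beta>\<close>, so that it realizes to \<open>f\<^sub>0 \<circ> fst \<circ> \<lambda>\<close>.

  The continuous bijection \<open>F \<rightarrow> f\<^sub>0\<^sup>*EG\<close> has a continuous inverse because the translation function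
  \<open>(e, e g) \<mapsto> g\<close> of \<open>EG\<close> is continuous: points of \<open>EG\<close> are step functions \<open>[0, 1] \<rightarrow> G\<close>, and if \<open>e\<close> and
  \<open>e g\<close> are each close to given constants on more than half of an interval, then they are so
  simultaneously at some point. The second projection and the homotopy inverses of \<open>\<lambda>\<close> are reduced to
  this by the homotopy invariance of pullbacks of \<open>F\<close> to the compact space \<open>|St(K)|\<close>, on which the two
  projections are linearly homotopic.
\<close>

section \<open>Quotient spaces\<close>

text \<open>The translation function has to be continuous on a subspace of
  \<open>EG \<times> EG\<close>. A product of two quotient maps need not be a quotient map, so this
  cannot be tested on pairs of cells. Masses get around the obstacle: they are constant under both
  identifications and lower semicontinuous on cells for open target sets, so they cut out open
  subsets of \<open>EG\<close> itself.

  Mass is moved to the vertex \<open>j\<close> because \<open>v \<sigma>\<close> lives on a simplex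
  of one dimension less than \<open>\<sigma>\<close>. To evaluate the transition function of a front
  face at \<open>t\<close>, the remaining coordinates have to be put somewhere, and \<open>j\<close>
  is the one vertex kept by every face on which the \<open>j\<close>-th coefficient still makes
  sense.

  Frames belong to last vertices, so dropping the last vertex changes all coefficients by one common
  right factor depending on \<open>t\<close> alone. The family of coefficients is therefore
  compatible with base faces only modulo right multiplication by functions of \<open>t\<close>,
  which is exactly the action divided out in the prismatic classifying space.\<close>

lemma equivclp_const:
  assumes "equivclp R x y" and "\<And>a b. R a b \<Longrightarrow> f a = f b"
  shows "f x = f y"
  using assms(1)
proof (induction rule: equivclp_induct)
  case (step y z)
  then show ?case using assms(2)[of y z] assms(2)[of z y] by auto
qed simp

lemma qclass_self: "x \<in> topspace X \<Longrightarrow> x \<in> qclass X r x"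
  by (simp add: qclass_def)

lemma qclass_eqI:
  assumes "x \<in> topspace X" "y \<in> topspace X" "r x y"
  shows "qclass X r x = qclass X r y"
proof -
  let ?R = "\<lambda>a b. a \<in> topspace X \<and> b \<in> topspace X \<and> r a b"
  have "equivclp ?R x y" using assms by (intro r_into_equivclp) auto
  then have "equivclp ?R x z \<longleftrightarrow> equivclp ?R y z" for z
    by (meson equivclp_sym equivclp_trans)
  then show ?thesis by (simp add: qclass_def)
qed

lemma qclass_invariant:
  assumes "y \<in> qclass X r x"
    and "\<And>a b. a \<in> topspace X \<Longrightarrow> b \<in> topspace X \<Longrightarrow> r a b \<Longrightarrow> f a = f b"
  shows "f x = f y"
proof -
  have "equivclp (\<lambda>a b. a \<in> topspace X \<and> b \<in> topspace X \<and> r a b) x y"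
    using assms(1) by (simp add: qclass_def)
  then show ?thesis by (rule equivclp_const) (use assms(2) in blast)
qed

lemma qclass_eq_invariant:
  assumes eq: "qclass X r x = qclass X r y" and x: "x \<in> topspace X"
    and inv: "\<And>a b. a \<in> topspace X \<Longrightarrow> b \<in> topspace X \<Longrightarrow> r a b \<Longrightarrow> f a = f b"
  shows "f x = f y"
proof -
  have "x \<in> qclass X r y" using qclass_self[OF x, of r] eq by simp
  then show ?thesis by (rule qclass_invariant[THEN sym]) (rule inv)
qed

text \<open>A point outside the space is related to nothing but itself, and it is filtered out of
  its own class, so that class is empty and differs from the class of every genuine point. This
  recovers membership of a representative when only its class is known to lie in the quotient, as
  happens for base faces of cells.\<close>

lemma topspace_if_qclass_in:
  assumes "qclass X r x \<in> qclass X r ` topspace X" shows "x \<in> topspace X"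
proof (rule ccontr)
  assume x: "x \<notin> topspace X"
  let ?R = "\<lambda>a b. a \<in> topspace X \<and> b \<in> topspace X \<and> r a b"
  obtain y where y: "y \<in> topspace X" "qclass X r x = qclass X r y" using assms by blast
  have "y \<in> qclass X r x" using qclass_self[OF y(1), of r] y(2) by simp
  then have "equivclp ?R x y" by (simp add: qclass_def)
  then have "(x \<in> topspace X) = (y \<in> topspace X)"
    by (rule equivclp_const[of ?R x y "\<lambda>z. z \<in> topspace X"]) simp
  then show False using x y by simp
qed

lemma qlift_const: "x \<in> C \<Longrightarrow> (\<And>y. y \<in> C \<Longrightarrow> f y = f x) \<Longrightarrow> qlift f C = f x"
  unfolding qlift_def by (rule the_elem_image_unique) blast+

lemma qlift_qclass:
  assumes "x \<in> topspace X"
    and "\<And>a b. a \<in> topspace X \<Longrightarrow> b \<in> topspace X \<Longrightarrow> r a b \<Longrightarrow> f a = f b"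
  shows "qlift f (qclass X r x) = f x"
proof (rule qlift_const[OF qclass_self[OF assms(1)]])
  show "f y = f x" if "y \<in> qclass X r x" for y
    using that by (rule qclass_invariant[THEN sym]) (rule assms(2))
qed

lemma qclass_in_quot_space: "x \<in> topspace X \<Longrightarrow> qclass X r x \<in> topspace (quot_space X r)"
  by (simp add: topspace_quot_space)

lemma continuous_map_qclass: "continuous_map X (quot_space X r) (qclass X r)"
  using quotient_map_qclass quotient_imp_continuous_map by blast

lemma continuous_map_sum_topology:
  "continuous_map (sum_topology X I) Y f \<longleftrightarrow> (\<forall>i\<in>I. continuous_map (X i) Y (\<lambda>x. f (i, x)))"
proof (intro iffI ballI)
  fix i assume "continuous_map (sum_topology X I) Y f" "i \<in> I"
  then show "continuous_map (X i) Y (\<lambda>x. f (i, x))"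
    using continuous_map_compose[OF continuous_map_component_injection[of i I X], of Y f]
    by (simp add: o_def)
next
  assume *: "\<forall>i\<in>I. continuous_map (X i) Y (\<lambda>x. f (i, x))"
  show "continuous_map (sum_topology X I) Y f"
    unfolding continuous_map_def
  proof (intro conjI allI impI)
    show "f \<in> topspace (sum_topology X I) \<rightarrow> topspace Y"
    proof
      fix z assume "z \<in> topspace (sum_topology X I)"
      then obtain i x where z: "z = (i, x)" "i \<in> I" "x \<in> topspace (X i)" by auto
      then show "f z \<in> topspace Y" using * by (auto simp: continuous_map_def Pi_iff)
    qed
  next
    fix U assume U: "openin Y U"
    have "openin (X i) {x \<in> topspace (X i). f (i, x) \<in> U}" if "i \<in> I" for i
      using * U that by (auto simp: continuous_map_def)
    moreover have "{x. (i, x) \<in> {x \<in> topspace (sum_topology X I). f x \<in> U}}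
        = {x \<in> topspace (X i). f (i, x) \<in> U}" if "i \<in> I" for i
      using that by auto
    ultimately show "openin (sum_topology X I) {x \<in> topspace (sum_topology X I). f x \<in> U}"
      by (auto simp: openin_sum_topology)
  qed
qed

section \<open>Pullbacks of bundles\<close>

text \<open>Bundle isomorphism with the inverse kept as data, so that both directions can be written
  down explicitly for pullbacks.\<close>

definition isom_over ::
    "('g, 'm) monoid_scheme \<Rightarrow> ('e, 'x, 'g) g_bundle \<Rightarrow> ('f, 'x, 'g) g_bundle \<Rightarrow>
      ('e \<Rightarrow> 'f) \<Rightarrow> ('f \<Rightarrow> 'e) \<Rightarrow> bool" where
  "isom_over G E E' h k \<longleftrightarrow>
     homeomorphic_maps (tot_space E) (tot_space E') h k \<and>
     (\<forall>e\<in>topspace (tot_space E). proj E' (h e) = proj E e \<and>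
        (\<forall>g\<in>carrier G. h (act E e g) = act E' (h e) g))"

lemma bundle_isomorphic_iff: "bundle_isomorphic G E E' \<longleftrightarrow> (\<exists>h k. isom_over G E E' h k)"
  unfolding bundle_isomorphic_def isom_over_def homeomorphic_map_maps by blast

definition act_closed :: "('g, 'm) monoid_scheme \<Rightarrow> ('e, 'x, 'g) g_bundle \<Rightarrow> bool" where
  "act_closed G E \<longleftrightarrow> (\<forall>e\<in>topspace (tot_space E). \<forall>g\<in>carrier G.
     act E e g \<in> topspace (tot_space E) \<and> proj E (act E e g) = proj E e)"

lemma bundle_isomorphic_refl: "bundle_isomorphic G E E"
  unfolding bundle_isomorphic_def by (rule exI[of _ id]) auto

lemma bundle_isomorphic_trans:
  assumes "bundle_isomorphic G E E'" "bundle_isomorphic G E' E''"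
  shows "bundle_isomorphic G E E''"
proof -
  obtain h where h: "homeomorphic_map (tot_space E) (tot_space E') h"
    "\<forall>e\<in>topspace (tot_space E). proj E' (h e) = proj E e \<and>
           (\<forall>g\<in>carrier G. h (act E e g) = act E' (h e) g)"
    using assms(1) by (auto simp: bundle_isomorphic_def)
  obtain k where k: "homeomorphic_map (tot_space E') (tot_space E'') k"
    "\<forall>e\<in>topspace (tot_space E'). proj E'' (k e) = proj E' e \<and>
           (\<forall>g\<in>carrier G. k (act E' e g) = act E'' (k e) g)"
    using assms(2) by (auto simp: bundle_isomorphic_def)
  have he: "h e \<in> topspace (tot_space E')" if "e \<in> topspace (tot_space E)" for e
    using h(1) that homeomorphic_imp_surjective_map by blast
  have "homeomorphic_map (tot_space E) (tot_space E'') (k \<circ> h)"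
    using h(1) k(1) homeomorphic_map_compose by blast
  moreover have "proj E'' (k (h e)) = proj E e \<and>
      (\<forall>g\<in>carrier G. k (h (act E e g)) = act E'' (k (h e)) g)"
    if "e \<in> topspace (tot_space E)" for e
    using h(2) k(2) he[OF that] that by simp
  ultimately show ?thesis
    unfolding bundle_isomorphic_def by (intro exI[of _ "k \<circ> h"]) simp
qed

text \<open>Equivariance of the inverse \<open>k\<close> comes from applying \<open>k\<close> to
  \<open>h (act E (k e) g)\<close>. This cancels only if \<open>act E (k e) g\<close> is again a
  point of the total space, which the record type of bundles does not enforce;
  \<open>act_closed\<close> supplies it.\<close>

lemma bundle_isomorphic_sym:
  assumes "act_closed G E" "bundle_isomorphic G E E'"
  shows "bundle_isomorphic G E' E"
proof -
  obtain h k where hk: "isom_over G E E' h k"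
    using assms(2) by (auto simp: bundle_isomorphic_iff)
  then have hm: "homeomorphic_maps (tot_space E) (tot_space E') h k"
    and 1: "\<And>e. e \<in> topspace (tot_space E) \<Longrightarrow> proj E' (h e) = proj E e"
    and 2: "\<And>e g. e \<in> topspace (tot_space E) \<Longrightarrow> g \<in> carrier G \<Longrightarrow> h (act E e g) = act E' (h e) g"
    by (auto simp: isom_over_def)
  have k: "k e \<in> topspace (tot_space E)" "h (k e) = e" if "e \<in> topspace (tot_space E')" for e
    using hm that by (auto simp: homeomorphic_maps_def continuous_map_def)
  have k': "k (h e) = e" if "e \<in> topspace (tot_space E)" for e
    using hm that by (auto simp: homeomorphic_maps_def)
  have "isom_over G E' E k h"
    unfolding isom_over_def
  proof (intro conjI ballI)
    show "homeomorphic_maps (tot_space E') (tot_space E) k h"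
      using hm homeomorphic_maps_sym by blast
    fix e assume e: "e \<in> topspace (tot_space E')"
    show "proj E (k e) = proj E' e" using 1[OF k(1)[OF e]] k(2)[OF e] by simp
    fix g assume g: "g \<in> carrier G"
    have "act E (k e) g \<in> topspace (tot_space E)"
      using assms(1) k(1)[OF e] g by (auto simp: act_closed_def)
    then have "k (h (act E (k e) g)) = act E (k e) g" by (rule k')
    then show "k (act E' e g) = act E (k e) g" using 2[OF k(1)[OF e] g] k(2)[OF e] by simp
  qed
  then show ?thesis by (auto simp: bundle_isomorphic_iff)
qed

lemma tot_space_pullback:
  "tot_space (pullback_bundle Y f E) =
     subtopology (prod_topology Y (tot_space E)) {(y, e). f y = proj E e}"
  by (simp add: pullback_bundle_def)

lemma topspace_pullback:
  "topspace (tot_space (pullback_bundle Y f E)) =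
     {(y, e). y \<in> topspace Y \<and> e \<in> topspace (tot_space E) \<and> f y = proj E e}"
  by (auto simp: pullback_bundle_def)

lemma proj_pullback: "proj (pullback_bundle Y f E) = fst"
  by (simp add: pullback_bundle_def)

lemma act_pullback: "act (pullback_bundle Y f E) (y, e) g = (y, act E e g)"
  by (simp add: pullback_bundle_def)

lemma act_closed_pullback: "act_closed G E \<Longrightarrow> act_closed G (pullback_bundle Y f E)"
  unfolding act_closed_def topspace_pullback
  by (auto simp: proj_pullback act_pullback)

lemma continuous_map_into_pullback:
  "continuous_map Z (tot_space (pullback_bundle Y f E)) h \<longleftrightarrow>
     continuous_map Z Y (\<lambda>z. fst (h z)) \<and> continuous_map Z (tot_space E) (\<lambda>z. snd (h z)) \<and>
     (\<forall>z\<in>topspace Z. f (fst (h z)) = proj E (snd (h z)))"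
  unfolding tot_space_pullback continuous_map_in_subtopology continuous_map_pairwise
  by (auto simp: o_def Pi_iff case_prod_beta')

lemma continuous_map_pullback_fst:
  "continuous_map (tot_space (pullback_bundle Y f E)) Y fst"
  unfolding tot_space_pullback using continuous_map_fst continuous_map_from_subtopology by blast

lemma continuous_map_pullback_snd:
  "continuous_map (tot_space (pullback_bundle Y f E)) (tot_space E) snd"
  unfolding tot_space_pullback using continuous_map_snd continuous_map_from_subtopology by blast

lemma pullback_bundle_cong:
  assumes "\<And>y. y \<in> topspace Y \<Longrightarrow> f y = f' y"
  shows "bundle_isomorphic G (pullback_bundle Y f E) (pullback_bundle Y f' E)"
proof -
  have "tot_space (pullback_bundle Y f E) = tot_space (pullback_bundle Y f' E)"
  proof -
    have "topspace (prod_topology Y (tot_space E)) \<inter> {(y, e). f y = proj E e}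
        = topspace (prod_topology Y (tot_space E)) \<inter> {(y, e). f' y = proj E e}"
      using assms by auto
    then show ?thesis unfolding tot_space_pullback by (metis subtopology_restrict)
  qed
  then show ?thesis
    unfolding bundle_isomorphic_def
    by (intro exI[of _ id]) (auto simp: proj_pullback act_pullback topspace_pullback)
qed

lemma pullback_bundle_comp:
  assumes "continuous_map X Y f"
  shows "bundle_isomorphic G (pullback_bundle X f (pullback_bundle Y g E))
           (pullback_bundle X (g \<circ> f) E)"
proof -
  have "isom_over G (pullback_bundle X f (pullback_bundle Y g E)) (pullback_bundle X (g \<circ> f) E)
      (\<lambda>(x, y, e). (x, e)) (\<lambda>(x, e). (x, f x, e))"
    unfolding isom_over_def homeomorphic_maps_def
  proof (intro conjI)
    let ?P = "pullback_bundle X f (pullback_bundle Y g E)" and ?Q = "pullback_bundle X (g \<circ> f) E"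
    have "continuous_map (tot_space ?P) (tot_space E) (\<lambda>z. snd (snd z))"
      using continuous_map_compose[OF continuous_map_pullback_snd[of X f "pullback_bundle Y g E"]
          continuous_map_pullback_snd[of Y g E]] by (simp add: o_def)
    moreover have "continuous_map (tot_space ?P) X fst" by (rule continuous_map_pullback_fst)
    ultimately show "continuous_map (tot_space ?P) (tot_space ?Q) (\<lambda>(x, y, e). (x, e))"
      unfolding continuous_map_into_pullback case_prod_beta'
      by (simp add: topspace_pullback proj_pullback split_beta)
    have "continuous_map (tot_space ?Q) Y (\<lambda>z. f (fst z))"
      using continuous_map_compose[OF continuous_map_pullback_fst assms, of "g \<circ> f" E]
      by (simp add: o_def)
    moreover have "continuous_map (tot_space ?Q) X fst" by (rule continuous_map_pullback_fst)
    moreover have "continuous_map (tot_space ?Q) (tot_space E) snd"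
      by (rule continuous_map_pullback_snd)
    ultimately show "continuous_map (tot_space ?Q) (tot_space ?P) (\<lambda>(x, e). (x, f x, e))"
      unfolding continuous_map_into_pullback case_prod_beta'
      by (simp add: topspace_pullback proj_pullback split_beta)
  qed (auto simp: topspace_pullback proj_pullback act_pullback)
  then show ?thesis by (auto simp: bundle_isomorphic_iff)
qed

lemma pullback_bundle_isomorphic:
  assumes "continuous_map X Y f" "bundle_isomorphic G E E'"
  shows "bundle_isomorphic G (pullback_bundle X f E) (pullback_bundle X f E')"
proof -
  obtain h k where hk: "isom_over G E E' h k"
    using assms(2) by (auto simp: bundle_isomorphic_iff)
  then have hm: "continuous_map (tot_space E) (tot_space E') h"
      "continuous_map (tot_space E') (tot_space E) k"
      "\<And>e. e \<in> topspace (tot_space E) \<Longrightarrow> k (h e) = e"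
      "\<And>e. e \<in> topspace (tot_space E') \<Longrightarrow> h (k e) = e"
    and 1: "\<And>e. e \<in> topspace (tot_space E) \<Longrightarrow> proj E' (h e) = proj E e"
    and 2: "\<And>e g. e \<in> topspace (tot_space E) \<Longrightarrow> g \<in> carrier G \<Longrightarrow> h (act E e g) = act E' (h e) g"
    by (auto simp: isom_over_def homeomorphic_maps_def)
  have kt: "k e \<in> topspace (tot_space E)" if "e \<in> topspace (tot_space E')" for e
    using hm(2) that by (auto simp: continuous_map_def)
  have 3: "proj E (k e) = proj E' e" if "e \<in> topspace (tot_space E')" for e
    using 1[OF kt[OF that]] hm(4)[OF that] by simp
  have "isom_over G (pullback_bundle X f E) (pullback_bundle X f E')
      (\<lambda>(x, e). (x, h e)) (\<lambda>(x, e). (x, k e))"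
    unfolding isom_over_def homeomorphic_maps_def
  proof (intro conjI)
    show "continuous_map (tot_space (pullback_bundle X f E))
       (tot_space (pullback_bundle X f E')) (\<lambda>(x, e). (x, h e))"
      unfolding continuous_map_into_pullback
      using continuous_map_pullback_fst[of X f E]
        continuous_map_compose[OF continuous_map_pullback_snd[of X f E] hm(1)]
      by (auto simp: o_def case_prod_beta' topspace_pullback 1)
    show "continuous_map (tot_space (pullback_bundle X f E'))
       (tot_space (pullback_bundle X f E)) (\<lambda>(x, e). (x, k e))"
      unfolding continuous_map_into_pullback
      using continuous_map_pullback_fst[of X f E']
        continuous_map_compose[OF continuous_map_pullback_snd[of X f E'] hm(2)]
      by (auto simp: o_def case_prod_beta' topspace_pullback 3)
  qed (auto simp: topspace_pullback proj_pullback act_pullback hm 2)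
  then show ?thesis by (auto simp: bundle_isomorphic_iff)
qed

section \<open>Simplices\<close>

definition skip :: "nat \<Rightarrow> nat \<Rightarrow> nat" where
  "skip i k = (if k < i then k else Suc k)"

lemma sum_skip:
  fixes F :: "nat \<Rightarrow> 'b::comm_monoid_add"
  assumes "i \<le> Suc p"
  shows "(\<Sum>k\<le>Suc p. F k) = F i + (\<Sum>k\<le>p. F (skip i k))"
proof -
  have "{..Suc p} = insert i (skip i ` {..p})"
  proof (intro equalityI subsetI)
    fix k assume k: "k \<in> {..Suc p}"
    show "k \<in> insert i (skip i ` {..p})"
    proof (cases k i rule: linorder_cases)
      case less
      then have "k = skip i k" "k \<le> p" using assms by (auto simp: skip_def)
      then show ?thesis by blast
    next
      case greater
      then have "k = skip i (k - 1)" "k - 1 \<le> p" using k by (auto simp: skip_def)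
      then show ?thesis by blast
    qed auto
  qed (use assms in \<open>auto simp: skip_def\<close>)
  moreover have "i \<notin> skip i ` {..p}" by (auto simp: skip_def)
  moreover have "inj_on (skip i) {..p}" by (auto simp: inj_on_def skip_def split: if_splits)
  ultimately show ?thesis by (simp add: sum.reindex)
qed

text \<open>The merged family is the original one with the entry \<open>Suc i\<close> left out and
  added back at the index \<open>i\<close>. This is the summation pattern of every
  codegeneracy.\<close>

lemma sum_merge:
  fixes F :: "nat \<Rightarrow> 'b::comm_monoid_add"
  assumes "i \<le> p" and "\<And>k. k < i \<Longrightarrow> F' k = F k" and "F' i = F i + F (Suc i)"
    and "\<And>k. i < k \<Longrightarrow> F' k = F (Suc k)"
  shows "(\<Sum>k\<le>p. F' k) = (\<Sum>k\<le>Suc p. F k)"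
proof -
  have "F' k = F (skip (Suc i) k) + (if k = i then F (Suc i) else 0)" for k
    using assms(2)[of k] assms(3) assms(4)[of k] by (cases k i rule: linorder_cases) (auto simp: skip_def)
  then have "(\<Sum>k\<le>p. F' k) = (\<Sum>k\<le>p. F (skip (Suc i) k)) + (\<Sum>k\<le>p. if k = i then F (Suc i) else 0)"
    by (simp add: sum.distrib)
  also have "\<dots> = F (Suc i) + (\<Sum>k\<le>p. F (skip (Suc i) k))"
    using assms(1) by (simp add: add.commute)
  finally show ?thesis using sum_skip[of "Suc i" p F] assms(1) by simp
qed

lemma simplical_face_at:
  "simplical_face i t i = (0::real)" "simplical_face i t (skip i k) = t k"
  by (auto simp: simplical_face_def skip_def)

lemma omit_skip: "omit i f k = f (skip i k)"
  by (simp add: omit_def skip_def)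

lemma standard_simplexD:
  assumes "t \<in> standard_simplex p"
  shows "0 \<le> t i" "t i \<le> 1" "i > p \<Longrightarrow> t i = 0" "(\<Sum>i\<le>p. t i) = 1"
  using assms by (auto simp: standard_simplex_def)

lemma standard_simplexI:
  assumes "\<And>i. 0 \<le> t i" "\<And>i. i > p \<Longrightarrow> t i = 0" "(\<Sum>i\<le>p. t i) = 1"
  shows "t \<in> standard_simplex p"
proof -
  have "t i \<le> 1" for i
  proof (cases "i \<le> p")
    case True
    then have "t i \<le> (\<Sum>i\<le>p. t i)" using assms(1) by (intro member_le_sum) auto
    then show ?thesis using assms(3) by simp
  qed (simp add: assms(2))
  then show ?thesis using assms by (auto simp: standard_simplex_def)
qed

lemma simplical_face_in:
  "t \<in> standard_simplex p \<Longrightarrow> i \<le> Suc p \<Longrightarrow> simplical_face i t \<in> standard_simplex (Suc p)"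
  by (rule simplical_face_in_standard_simplex) auto

lemma codegen_in:
  assumes "t \<in> standard_simplex (Suc p)" "i \<le> p"
  shows "codegen i t \<in> standard_simplex p"
proof (rule standard_simplexI)
  show "0 \<le> codegen i t k" for k
    using standard_simplexD(1)[OF assms(1)] by (simp add: codegen_def)
  show "codegen i t k = 0" if "k > p" for k
    using standard_simplexD(3)[OF assms(1)] that assms(2) by (simp add: codegen_def)
  have "(\<Sum>k\<le>p. codegen i t k) = (\<Sum>k\<le>Suc p. t k)"
    by (rule sum_merge[OF assms(2)]) (auto simp: codegen_def)
  then show "(\<Sum>k\<le>p. codegen i t k) = 1" using standard_simplexD(4)[OF assms(1)] by simp
qed

lemma continuous_map_simplex_coord:
  "continuous_map (simplex_top p) euclideanreal (\<lambda>t. t i)"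
  by (intro continuous_map_from_subtopology continuous_map_product_projection) simp

lemma continuous_map_into_simplex:
  "continuous_map X (simplex_top p) f \<longleftrightarrow>
     (\<forall>i. continuous_map X euclideanreal (\<lambda>x. f x i)) \<and> f \<in> topspace X \<rightarrow> standard_simplex p"
  by (simp add: continuous_map_in_subtopology continuous_map_componentwise_UNIV)

text \<open>The right ends of the consecutive intervals of lengths \<open>t 0, t 1, ...\<close> in
  the unit interval, starting from \<open>0\<close>. In these terms a coface repeats an end point
  and a codegeneracy forgets one.\<close>

definition psum :: "(nat \<Rightarrow> real) \<Rightarrow> nat \<Rightarrow> real" where
  "psum t k = (\<Sum>l<k. t l)"

lemma psum_0 [simp]: "psum t 0 = 0"
  and psum_Suc: "psum t (Suc k) = psum t k + t k"
  by (simp_all add: psum_def)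

lemma psum_simplical_face:
  "psum (simplical_face i t) k = psum t (if k \<le> i then k else k - 1)"
proof (induction k)
  case (Suc k)
  show ?case
  proof (cases k i rule: linorder_cases)
    case greater
    then obtain m where "k = Suc m" by (cases k) auto
    then show ?thesis using Suc greater by (auto simp: psum_Suc simplical_face_def)
  qed (use Suc in \<open>auto simp: psum_Suc simplical_face_def\<close>)
qed simp

lemma psum_codegen: "psum (codegen i t) k = psum t (if k \<le> i then k else Suc k)"
  by (induction k) (auto simp: psum_Suc codegen_def)

lemma psum_le_1:
  assumes "t \<in> standard_simplex p" shows "psum t k \<le> 1"
proof -
  have "psum t k \<le> sum t {..max k p}"
    unfolding psum_def using standard_simplexD(1)[OF assms] by (intro sum_mono2) auto
  also have "\<dots> = sum t {..p}"
    using standard_simplexD(3)[OF assms] by (intro sum.mono_neutral_right) auto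
  finally show ?thesis using standard_simplexD(4)[OF assms] by simp
qed

lemma psum_eq_1:
  assumes "t \<in> standard_simplex p" shows "psum t (Suc p) = 1"
  using standard_simplexD(4)[OF assms] unfolding psum_def lessThan_Suc_atMost by simp

lemma psum_mono:
  assumes "t \<in> standard_simplex p" "k \<le> l" shows "psum t k \<le> psum t l"
  unfolding psum_def using assms(2) standard_simplexD(1)[OF assms(1)] by (intro sum_mono2) auto

lemma continuous_map_psum: "continuous_map (simplex_top p) euclideanreal (\<lambda>t. psum t k)"
  unfolding psum_def by (intro continuous_map_sum continuous_map_simplex_coord) auto

lemma simplex_pos:
  assumes "t \<in> standard_simplex p" obtains i where "i \<le> p" "t i > 0"
proof -
  have "\<exists>i\<le>p. t i > 0"
  proof (rule ccontr)
    assume "\<not> ?thesis"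
    then have "(\<Sum>i\<le>p. t i) \<le> 0" by (intro sum_nonpos) (auto simp: not_less)
    then show False using standard_simplexD(4)[OF assms] by simp
  qed
  then show ?thesis using that by blast
qed

section \<open>The total space \<open>EG\<close>\<close>

locale top_group = group G for G :: "('g, 'm) monoid_scheme" (structure) +
  fixes T :: "'g topology"
  assumes topspace_T: "topspace T = carrier G"
    and continuous_mult: "continuous_map (prod_topology T T) T (\<lambda>(x, y). x \<otimes> y)"
    and continuous_inv: "continuous_map T T (\<lambda>x. inv x)"
begin

lemma continuous_map_mult:
  assumes "continuous_map X T f" "continuous_map X T g"
  shows "continuous_map X T (\<lambda>x. f x \<otimes> g x)"
  using continuous_map_compose[OF _ continuous_mult, of X "\<lambda>x. (f x, g x)"] assms
  by (simp add: o_def continuous_map_pairwise)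

lemma continuous_map_inverse: "continuous_map X T f \<Longrightarrow> continuous_map X T (\<lambda>x. inv f x)"
  using continuous_map_compose[OF _ continuous_inv] by (simp add: o_def)

lemma continuous_map_carrier: "continuous_map X T f \<Longrightarrow> x \<in> topspace X \<Longrightarrow> f x \<in> carrier G"
  using topspace_T by (auto simp: continuous_map_def Pi_iff)

end

definition steps :: "('g, 'm) monoid_scheme \<Rightarrow> nat \<Rightarrow> (nat \<Rightarrow> 'g) set" where
  "steps G p = {..p} \<rightarrow>\<^sub>E carrier G"

definition rmul :: "('g, 'm) monoid_scheme \<Rightarrow> nat \<Rightarrow> (nat \<Rightarrow> 'g) \<Rightarrow> 'g \<Rightarrow> nat \<Rightarrow> 'g" where
  "rmul G p a g = (\<lambda>i\<in>{..p}. a i \<otimes>\<^bsub>G\<^esub> g)"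

text \<open>A point \<open>(t, a)\<close> is a step function on \<open>[0, 1]\<close> with the value \<open>a\<^sub>i\<close> on the \<open>i\<close>-th of
  consecutive intervals of lengths \<open>t\<^sub>i\<close>; the mass of \<open>W\<close> is the \<open>d\<phi>\<close>-measure of its preimage.\<close>

fun mass :: "(real \<Rightarrow> real) \<Rightarrow> 'g set \<Rightarrow> 'g EG_point \<Rightarrow> real" where
  "mass \<phi> W (p, t, a) = (\<Sum>i\<le>p. if a i \<in> W then \<phi> (psum t (Suc i)) - \<phi> (psum t i) else 0)"

text \<open>A face relation inserts an interval of length zero, and a degeneracy relation subdivides
  an interval on both parts of which the step function has the same value. Neither changes the
  function up to end points, and the increments of \<open>\<phi>\<close> over the two parts add
  up.\<close>

lemma mass_EG_rel:
  assumes "EG_rel G z z'" shows "mass \<phi> W z = mass \<phi> W z'"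
  using assms
proof cases
  case (1 t p i a)
  let ?s = "simplical_face i t"
  let ?F = "\<lambda>k. if a k \<in> W then \<phi> (psum ?s (Suc k)) - \<phi> (psum ?s k) else 0"
  have "?F i = 0" by (simp add: psum_Suc simplical_face_at)
  moreover have "?F (skip i k) = (if omit i a k \<in> W then \<phi> (psum t (Suc k)) - \<phi> (psum t k) else 0)" for k
    unfolding psum_simplical_face omit_skip by (auto simp: skip_def)
  ultimately show ?thesis unfolding 1(1,2) mass.simps sum_skip[OF 1(4)] by simp
next
  case (2 t p i a)
  let ?F = "\<lambda>k. if repeat_at i a k \<in> W then \<phi> (psum t (Suc k)) - \<phi> (psum t k) else 0"
  let ?F' = "\<lambda>k. if a k \<in> W then \<phi> (psum (codegen i t) (Suc k)) - \<phi> (psum (codegen i t) k) else 0"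
  have "(\<Sum>k\<le>p. ?F' k) = (\<Sum>k\<le>Suc p. ?F k)"
    by (rule sum_merge[OF 2(4)]) (simp_all add: psum_codegen repeat_at_def)
  then show ?thesis unfolding 2(1,2) mass.simps .
qed

context top_group
begin

lemma topspace_EG_cells:
  "z \<in> topspace (EG_cells T) \<longleftrightarrow>
     (\<exists>p t a. z = (p, t, a) \<and> t \<in> standard_simplex p \<and> a \<in> steps G p)"
  by (cases z) (auto simp: EG_cells_def steps_def topspace_T)

lemma EG_cells_iff: "(p, t, a) \<in> topspace (EG_cells T) \<longleftrightarrow> t \<in> standard_simplex p \<and> a \<in> steps G p"
  by (auto simp: topspace_EG_cells)

lemma topspace_EG: "topspace (EG_space G T) = EG_class G T ` topspace (EG_cells T)"
  by (simp add: EG_space_def EG_class_def topspace_quot_space)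

lemma EG_cases:
  assumes "e \<in> topspace (EG_space G T)"
  obtains p t a where "e = EG_class G T (p, t, a)" "t \<in> standard_simplex p" "a \<in> steps G p"
  using assms by (auto simp: topspace_EG topspace_EG_cells)

lemma EG_class_in: "t \<in> standard_simplex p \<Longrightarrow> a \<in> steps G p \<Longrightarrow> EG_class G T (p, t, a) \<in> topspace (EG_space G T)"
  by (auto simp: topspace_EG topspace_EG_cells)

lemma rmul_steps: "a \<in> steps G p \<Longrightarrow> g \<in> carrier G \<Longrightarrow> rmul G p a g \<in> steps G p"
  by (auto simp: steps_def rmul_def)

lemma steps_at: "a \<in> steps G p \<Longrightarrow> i \<le> p \<Longrightarrow> a i \<in> carrier G"
  by (auto simp: steps_def)

lemma rmul_at: "i \<le> p \<Longrightarrow> rmul G p a g i = a i \<otimes> g"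
  by (simp add: rmul_def)

lemma steps_eqI:
  "a \<in> steps G p \<Longrightarrow> b \<in> steps G p \<Longrightarrow> (\<And>i. i \<le> p \<Longrightarrow> a i = b i) \<Longrightarrow> a = b"
  unfolding steps_def by (rule PiE_ext) auto

lemma omit_steps: "a \<in> steps G (Suc p) \<Longrightarrow> i \<le> Suc p \<Longrightarrow> omit i a \<in> steps G p"
  by (auto simp: steps_def omit_def PiE_iff extensional_def)

lemma repeat_steps: "a \<in> steps G p \<Longrightarrow> i \<le> p \<Longrightarrow> repeat_at i a \<in> steps G (Suc p)"
  by (auto simp: steps_def repeat_at_def PiE_iff extensional_def)

lemma rmul_rmul:
  "a \<in> steps G p \<Longrightarrow> g \<in> carrier G \<Longrightarrow> h \<in> carrier G \<Longrightarrow> rmul G p (rmul G p a g) h = rmul G p a (g \<otimes> h)"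
  by (rule steps_eqI[of _ p]) (auto simp: rmul_steps rmul_at steps_at m_assoc)

lemma rmul_one: "a \<in> steps G p \<Longrightarrow> rmul G p a \<one> = a"
  by (rule steps_eqI[of _ p]) (auto simp: rmul_steps rmul_at steps_at)

lemma EG_class_face:
  assumes "t \<in> standard_simplex p" "i \<le> Suc p" "a \<in> steps G (Suc p)"
  shows "EG_class G T (Suc p, simplical_face i t, a) = EG_class G T (p, t, omit i a)"
  unfolding EG_class_def
proof (rule qclass_eqI)
  show "EG_rel G (Suc p, simplical_face i t, a) (p, t, omit i a)"
    using assms by (intro EG_rel.intros(1)) (auto simp: steps_def)
qed (use assms in \<open>auto simp: EG_cells_iff simplical_face_in omit_steps\<close>)

lemma EG_class_degen:
  assumes "t \<in> standard_simplex (Suc p)" "i \<le> p" "a \<in> steps G p"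
  shows "EG_class G T (p, codegen i t, a) = EG_class G T (Suc p, t, repeat_at i a)"
  unfolding EG_class_def
proof (rule qclass_eqI)
  show "EG_rel G (p, codegen i t, a) (Suc p, t, repeat_at i a)"
    using assms by (intro EG_rel.intros(2)) (auto simp: steps_def)
qed (use assms in \<open>auto simp: EG_cells_iff codegen_in repeat_steps\<close>)

lemma omit_rmul: "i \<le> Suc p \<Longrightarrow> omit i (rmul G (Suc p) a g) = rmul G p (omit i a) g"
  by (rule ext) (auto simp: omit_def rmul_def)

lemma repeat_rmul: "i \<le> p \<Longrightarrow> repeat_at i (rmul G p a g) = rmul G (Suc p) (repeat_at i a) g"
  by (rule ext) (auto simp: repeat_at_def rmul_def)

lemma EG_act_class:
  assumes "t \<in> standard_simplex p" "a \<in> steps G p" "g \<in> carrier G"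
  shows "EG_act G T (EG_class G T (p, t, a)) g = EG_class G T (p, t, rmul G p a g)"
proof -
  let ?f = "\<lambda>(p, t, a). EG_class G T (p, t, \<lambda>i\<in>{..p}. a i \<otimes> g)"
  have "?f z = ?f z'" if "EG_rel G z z'" for z z'
    using that
  proof cases
    case (1 t p i a)
    then have "a \<in> steps G (Suc p)" by (simp add: steps_def)
    then show ?thesis using 1 assms(3)
      by (simp add: EG_class_face[OF _ _ rmul_steps] omit_rmul flip: rmul_def)
  next
    case (2 t p i a)
    then have "a \<in> steps G p" by (simp add: steps_def)
    then show ?thesis using 2 assms(3)
      by (simp add: EG_class_degen[OF _ _ rmul_steps] repeat_rmul flip: rmul_def)
  qed
  then have "qlift ?f (EG_class G T (p, t, a)) = ?f (p, t, a)"
    unfolding EG_class_def by (intro qlift_qclass) (auto simp: EG_cells_iff assms)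
  then show ?thesis by (simp add: EG_act_def rmul_def)
qed

lemma EG_act_in: "e \<in> topspace (EG_space G T) \<Longrightarrow> g \<in> carrier G \<Longrightarrow> EG_act G T e g \<in> topspace (EG_space G T)"
  by (elim EG_cases) (simp add: EG_act_class EG_class_in rmul_steps)

lemma EG_act_act:
  "e \<in> topspace (EG_space G T) \<Longrightarrow> g \<in> carrier G \<Longrightarrow> h \<in> carrier G \<Longrightarrow>
     EG_act G T (EG_act G T e g) h = EG_act G T e (g \<otimes> h)"
  by (elim EG_cases) (simp add: EG_act_class EG_class_in rmul_steps rmul_rmul)

lemma EG_act_one: "e \<in> topspace (EG_space G T) \<Longrightarrow> EG_act G T e \<one> = e"
  by (elim EG_cases) (simp add: EG_act_class EG_class_in rmul_steps rmul_one)

text \<open>The generated equivalence relation is no coarser than the orbit relation, because the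
  orbit of a point is constant along \<open>BG_rel\<close>.\<close>

lemma BG_class_eq_iff:
  assumes "e \<in> topspace (EG_space G T)" "e' \<in> topspace (EG_space G T)"
  shows "BG_class G T e = BG_class G T e' \<longleftrightarrow> (\<exists>g\<in>carrier G. e' = EG_act G T e g)"
proof
  assume "\<exists>g\<in>carrier G. e' = EG_act G T e g"
  then show "BG_class G T e = BG_class G T e'"
    unfolding BG_class_def by (intro qclass_eqI) (auto simp: assms BG_rel_def)
next
  assume eq: "BG_class G T e = BG_class G T e'"
  let ?orb = "\<lambda>e. (\<lambda>g. EG_act G T e g) ` carrier G"
  have "?orb a = ?orb b" if ab: "a \<in> topspace (EG_space G T)" "b \<in> topspace (EG_space G T)" "BG_rel G T a b" for a b
  proof -
    obtain g where g: "g \<in> carrier G" "b = EG_act G T a g" using ab(3) by (auto simp: BG_rel_def)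
    show ?thesis
    proof (intro equalityI image_subsetI)
      fix h assume h: "h \<in> carrier G"
      have "EG_act G T a h = EG_act G T b (inv g \<otimes> h)"
        using ab g h by (simp add: EG_act_act flip: m_assoc)
      then show "EG_act G T a h \<in> ?orb b" using g h by blast
      have "EG_act G T b h = EG_act G T a (g \<otimes> h)"
        using ab g h by (simp add: EG_act_act)
      then show "EG_act G T b h \<in> ?orb a" using g h by blast
    qed
  qed
  then have "?orb e = ?orb e'"
    by (rule qclass_eq_invariant[where f = ?orb, OF eq[unfolded BG_class_def] assms(1)])
  moreover have "e' \<in> ?orb e'" using EG_act_one[OF assms(2)] one_closed by (metis image_eqI)
  ultimately show "\<exists>g\<in>carrier G. e' = EG_act G T e g" by blast
qed

end

section \<open>Majority values of step functions\<close>

lemma mass_total: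
  fixes \<phi> :: "real \<Rightarrow> real"
  assumes "t \<in> standard_simplex p"
  shows "(\<Sum>i\<le>p. \<phi> (psum t (Suc i)) - \<phi> (psum t i)) = \<phi> 1 - \<phi> 0"
  using psum_eq_1[OF assms] sum_lessThan_telescope[of "\<lambda>k. \<phi> (psum t k)" "Suc p"]
  by (simp add: lessThan_Suc_atMost)

lemma mass_increment:
  fixes \<phi> :: "real \<Rightarrow> real"
  shows "mono \<phi> \<Longrightarrow> t \<in> standard_simplex p \<Longrightarrow> 0 \<le> \<phi> (psum t (Suc i)) - \<phi> (psum t i)"
  using psum_mono[of t p i "Suc i"] by (simp add: monoD)

text \<open>Two sets of measure more than half of the total must meet. Both step functions refer to
  the same subdivision \<open>t\<close>, as representatives of \<open>e\<close> and
  \<open>e g\<close> may be chosen to do.\<close>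

lemma mass_overlap:
  assumes "mono \<phi>" "t \<in> standard_simplex p"
    and "mass \<phi> A (p, t, a) > (\<phi> 1 - \<phi> 0) / 2" "mass \<phi> B (p, t, b) > (\<phi> 1 - \<phi> 0) / 2"
  obtains i where "i \<le> p" "a i \<in> A" "b i \<in> B"
proof -
  have "\<exists>i\<le>p. a i \<in> A \<and> b i \<in> B"
  proof (rule ccontr)
    assume n: "\<not> ?thesis"
    have "mass \<phi> A (p, t, a) + mass \<phi> B (p, t, b) \<le> (\<Sum>i\<le>p. \<phi> (psum t (Suc i)) - \<phi> (psum t i))"
      unfolding mass.simps sum.distrib[symmetric]
    proof (rule sum_mono)
      fix i assume "i \<in> {..p}"
      then show "(if a i \<in> A then \<phi> (psum t (Suc i)) - \<phi> (psum t i) else 0) +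
         (if b i \<in> B then \<phi> (psum t (Suc i)) - \<phi> (psum t i) else 0)
         \<le> \<phi> (psum t (Suc i)) - \<phi> (psum t i)"
        using n mass_increment[OF assms(1,2), of i] by simp
    qed
    also have "\<dots> = (\<phi> 1 - \<phi> 0) / 2 + (\<phi> 1 - \<phi> 0) / 2"
      unfolding mass_total[OF assms(2)] by simp
    finally show False using add_strict_mono[OF assms(3,4)] by (metis not_le)
  qed
  then show ?thesis using that by blast
qed

text \<open>Truncation to an interval: its measure is the length of the part inside
  \<open>[lo, hi]\<close>, so the mass taken with it only looks at the step function on that
  interval. It is monotone and continuous, which is all that the openness of masses asks
  for.\<close>

definition clamp_to :: "real \<Rightarrow> real \<Rightarrow> real \<Rightarrow> real" where
  "clamp_to lo hi y = max lo (min hi y)"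

lemma mono_clamp: "mono (clamp_to lo hi)"
  by (auto simp: mono_def clamp_to_def)

lemma continuous_clamp: "continuous_map euclideanreal euclideanreal (clamp_to lo hi)"
  unfolding clamp_to_def continuous_map_iff_continuous2 by (intro continuous_intros)

text \<open>Truncation to the \<open>i\<close>-th interval gives total mass \<open>t i\<close>, and
  the \<open>i\<close>-th step alone contributes all of it. So for \<open>t i > 0\<close> any set
  containing \<open>a i\<close> holds more than half.\<close>

lemma mass_at_step:
  assumes t: "t \<in> standard_simplex p" and i: "i \<le> p" "a i \<in> A"
  defines "\<phi> \<equiv> clamp_to (psum t i) (psum t (Suc i))"
  shows "\<phi> 1 - \<phi> 0 = t i" "mass \<phi> A (p, t, a) \<ge> t i"
proof -
  have "0 \<le> psum t i" using psum_mono[OF t, of 0 i] by simp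
  then show "\<phi> 1 - \<phi> 0 = t i"
    using psum_mono[OF t, of i "Suc i"] psum_le_1[OF t, of "Suc i"]
    by (auto simp: \<phi>_def clamp_to_def psum_Suc)
  let ?F = "\<lambda>k. if a k \<in> A then \<phi> (psum t (Suc k)) - \<phi> (psum t k) else 0"
  have "?F i = t i"
    using i psum_mono[OF t, of i "Suc i"] by (auto simp: \<phi>_def clamp_to_def psum_Suc)
  moreover have "?F i \<le> (\<Sum>k\<le>p. ?F k)"
  proof (rule member_le_sum)
    have "mono \<phi>" by (simp add: \<phi>_def mono_clamp)
    then show "0 \<le> ?F k" for k using mass_increment[OF _ t] by simp
  qed (use i in auto)
  ultimately show "mass \<phi> A (p, t, a) \<ge> t i" by simp
qed

context top_group
begin

text \<open>Increments of a monotone \<open>\<phi>\<close> are nonnegative, so the mass exceeds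
  \<open>r\<close> as soon as the steps in some index set \<open>I\<close> take values in
  \<open>W\<close> and their increments already sum to more than \<open>r\<close>; conversely
  \<open>I\<close> can be taken to be all steps with value in \<open>W\<close>. For each of the
  finitely many \<open>I\<close> this is a product of an open condition on \<open>t\<close> and one
  on \<open>a\<close>.\<close>

lemma openin_mass:
  assumes "mono \<phi>" "continuous_map euclideanreal euclideanreal \<phi>" "openin T W"
  shows "openin (EG_cells T) {z \<in> topspace (EG_cells T). mass \<phi> W z > r}"
proof -
  have "openin (prod_topology (simplex_top p) (product_topology (\<lambda>_. T) {..p}))
      {z. (p, z) \<in> {z \<in> topspace (EG_cells T). mass \<phi> W z > r}}" (is "openin ?X ?S") for p
  proof -
    let ?d = "\<lambda>I t. \<Sum>i\<in>I. \<phi> (psum t (Suc i)) - \<phi> (psum t i)"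
    let ?O = "\<lambda>I. {t \<in> topspace (simplex_top p). ?d I t \<in> {r<..}} \<times> {a \<in> topspace (product_topology (\<lambda>_. T) {..p}). \<forall>i\<in>I. a i \<in> W}"
    have "?S = (\<Union>I\<in>Pow {..p}. ?O I)"
    proof (intro equalityI subsetI)
      fix z assume z: "z \<in> ?S"
      obtain t a where ta: "z = (t, a)" by (cases z)
      have *: "t \<in> standard_simplex p" "a \<in> steps G p" "mass \<phi> W (p, t, a) > r"
        using z by (auto simp: ta EG_cells_iff simp del: mass.simps)
      let ?I = "{i\<in>{..p}. a i \<in> W}"
      have "mass \<phi> W (p, t, a) = ?d ?I t"
        unfolding mass.simps by (rule sum.inter_filter[symmetric]) simp
      then have "?d ?I t > r" using *(3) by (simp only:)
      moreover have "a \<in> topspace (product_topology (\<lambda>_. T) {..p})"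
        using *(2) by (simp add: steps_def topspace_T)
      ultimately have "z \<in> ?O ?I"
        using *(1) unfolding ta by (intro SigmaI CollectI conjI) auto
      moreover have "?I \<in> Pow {..p}" by blast
      ultimately show "z \<in> (\<Union>I\<in>Pow {..p}. ?O I)" by (rule UN_I[rotated])
    next
      fix z assume "z \<in> (\<Union>I\<in>Pow {..p}. ?O I)"
      then obtain I where I: "I \<in> Pow {..p}" "z \<in> ?O I" by (rule UN_E)
      obtain t a where ta: "z = (t, a)" by (cases z)
      have t: "t \<in> standard_simplex p" "a \<in> steps G p" "?d I t > r" "\<forall>i\<in>I. a i \<in> W"
        using I(2) unfolding ta by (simp_all add: steps_def topspace_T)
      let ?F = "\<lambda>i. if a i \<in> W then \<phi> (psum t (Suc i)) - \<phi> (psum t i) else 0"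
      have "?d I t = (\<Sum>i\<in>I. ?F i)" using t(4) by (intro sum.cong) auto
      also have "\<dots> \<le> (\<Sum>i\<le>p. ?F i)"
        using I(1) PowD mass_increment[OF assms(1) t(1)] by (intro sum_mono2) auto
      finally show "z \<in> ?S" using t by (simp add: ta EG_cells_iff)
    qed
    moreover have "openin ?X (?O I)" if "I \<in> Pow {..p}" for I
    proof (subst openin_prod_Times_iff, intro disjI2 conjI)
      have "continuous_map (simplex_top p) euclideanreal (\<lambda>t. \<phi> (psum t i))" for i
        using continuous_map_compose[OF continuous_map_psum assms(2)] by (simp add: o_def)
      then have "continuous_map (simplex_top p) euclideanreal (?d I)"
        using that by (intro continuous_map_sum continuous_map_diff) (auto intro: finite_subset)
      then show "openin (simplex_top p) {t \<in> topspace (simplex_top p). ?d I t \<in> {r<..}}"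
        by (rule openin_continuous_map_preimage) simp
      have "{a \<in> topspace (product_topology (\<lambda>_. T) {..p}). \<forall>i\<in>I. a i \<in> W}
          = PiE {..p} (\<lambda>i. if i \<in> I then W else topspace T)"
      proof (intro equalityI subsetI)
        fix a assume a: "a \<in> PiE {..p} (\<lambda>i. if i \<in> I then W else topspace T)"
        then have *: "a i \<in> (if i \<in> I then W else topspace T)" if "i \<le> p" for i
          using that by (simp add: PiE_iff)
        have "a i \<in> topspace T" if "i \<le> p" for i
          using *[OF that] openin_subset[OF assms(3)] by (auto split: if_splits)
        moreover have "a i \<in> W" if "i \<in> I" for i
          using *[of i] that \<open>I \<in> Pow {..p}\<close> by auto
        ultimately show "a \<in> {a \<in> topspace (product_topology (\<lambda>_. T) {..p}). \<forall>i\<in>I. a i \<in> W}"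
          using a by (simp add: PiE_iff)
      qed (simp add: PiE_iff)
      then show "openin (product_topology (\<lambda>_. T) {..p})
          {a \<in> topspace (product_topology (\<lambda>_. T) {..p}). \<forall>i\<in>I. a i \<in> W}"
        using assms(3) by (simp add: openin_PiE_gen)
    qed
    ultimately show ?thesis by (simp only:) (rule openin_Union, blast)
  qed
  moreover have "{z \<in> topspace (EG_cells T). mass \<phi> W z > r} \<subseteq>
      topspace (EG_cells T)" by blast
  ultimately show ?thesis
    unfolding openin_sum_topology EG_cells_def by simp
qed

text \<open>The threshold is half of the total mass, the least for which \<open>mass_overlap\<close>
  applies. The set is given as an image of cells, but membership is seen on any representative by
  \<open>in_massive_iff\<close>.\<close>

definition massive :: "(real \<Rightarrow> real) \<Rightarrow> 'g set \<Rightarrow> 'g EG_point set set" where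
  "massive \<phi> W = EG_class G T ` {z \<in> topspace (EG_cells T). mass \<phi> W z > (\<phi> 1 - \<phi> 0) / 2}"

lemma in_massive_iff:
  assumes "t \<in> standard_simplex p" "a \<in> steps G p"
  shows "EG_class G T (p, t, a) \<in> massive \<phi> W \<longleftrightarrow> mass \<phi> W (p, t, a) > (\<phi> 1 - \<phi> 0) / 2"
proof
  assume "EG_class G T (p, t, a) \<in> massive \<phi> W"
  then obtain z where z: "z \<in> topspace (EG_cells T)" "mass \<phi> W z > (\<phi> 1 - \<phi> 0) / 2"
    "EG_class G T z = EG_class G T (p, t, a)" by (auto simp: massive_def simp del: mass.simps)
  have "mass \<phi> W z = mass \<phi> W (p, t, a)"
    by (rule qclass_eq_invariant[OF z(3)[unfolded EG_class_def] z(1)]) (rule mass_EG_rel)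
  then show "mass \<phi> W (p, t, a) > (\<phi> 1 - \<phi> 0) / 2" using z(2) by simp
qed (use assms in \<open>auto simp: massive_def EG_cells_iff simp del: mass.simps\<close>)

lemma openin_massive:
  assumes "mono \<phi>" "continuous_map euclideanreal euclideanreal \<phi>" "openin T W"
  shows "openin (EG_space G T) (massive \<phi> W)"
proof -
  have "{x \<in> topspace (EG_cells T). EG_class G T x \<in> massive \<phi> W}
     = {z \<in> topspace (EG_cells T). mass \<phi> W z > (\<phi> 1 - \<phi> 0) / 2}"
    by (auto simp: topspace_EG_cells in_massive_iff simp del: mass.simps)
  then have "openin (EG_cells T) {x \<in> topspace (EG_cells T). EG_class G T x \<in> massive \<phi> W}"
    by (simp only: openin_mass[OF assms])
  moreover have "massive \<phi> W \<subseteq> EG_class G T ` topspace (EG_cells T)"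
    by (auto simp: massive_def simp del: mass.simps)
  ultimately show ?thesis
    unfolding EG_space_def openin_quot_space EG_class_def by simp
qed

text \<open>If \<open>e g = e h\<close>, then one and the same step function has both
  \<open>a i \<otimes> g\<close> and \<open>a i \<otimes> h\<close> as a majority value over the
  \<open>i\<close>-th interval, so these agree and \<open>a i\<close> cancels. Singletons are used
  as target sets, since openness plays no part in a statement about points.\<close>

lemma EG_act_free:
  assumes e: "e \<in> topspace (EG_space G T)" and gh: "g \<in> carrier G" "h \<in> carrier G"
    and eq: "EG_act G T e g = EG_act G T e h"
  shows "g = h"
proof -
  obtain p t a where pta: "e = EG_class G T (p, t, a)" "t \<in> standard_simplex p" "a \<in> steps G p"
    using e by (rule EG_cases)
  obtain i where i: "i \<le> p" "t i > 0" using simplex_pos[OF pta(2)] .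
  let ?\<phi> = "clamp_to (psum t i) (psum t (Suc i))"
  have m: "EG_class G T (p, t, rmul G p a k) \<in> massive ?\<phi> {a i \<otimes> k}" if "k \<in> carrier G" for k
    using mass_at_step[OF pta(2) i(1), of "rmul G p a k" "{a i \<otimes> k}"] i that pta
    by (subst in_massive_iff) (simp_all add: rmul_at rmul_steps del: mass.simps)
  have eq': "EG_class G T (p, t, rmul G p a g) = EG_class G T (p, t, rmul G p a h)"
    using eq gh pta by (simp add: EG_act_class)
  obtain j where "j \<le> p" "rmul G p a h j \<in> {a i \<otimes> g}" "rmul G p a h j \<in> {a i \<otimes> h}"
  proof (rule mass_overlap[OF mono_clamp pta(2)])
    show "mass ?\<phi> {a i \<otimes> g} (p, t, rmul G p a h) > (?\<phi> 1 - ?\<phi> 0) / 2"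
      using m[OF gh(1)] gh pta unfolding eq' by (simp add: in_massive_iff rmul_steps del: mass.simps)
    show "mass ?\<phi> {a i \<otimes> h} (p, t, rmul G p a h) > (?\<phi> 1 - ?\<phi> 0) / 2"
      using m[OF gh(2)] gh pta by (simp add: in_massive_iff rmul_steps del: mass.simps)
  qed auto
  then have "a i \<otimes> g = a i \<otimes> h" by auto
  then show ?thesis using gh steps_at[OF pta(3) i(1)] by simp
qed

section \<open>The translation function and its continuity\<close>

definition same_orbit :: "('g EG_point set \<times> 'g EG_point set) set" where
  "same_orbit = {(e, e'). \<exists>g\<in>carrier G. e' = EG_act G T e g}"

definition transl :: "'g EG_point set \<Rightarrow> 'g EG_point set \<Rightarrow> 'g" where
  "transl e e' = (THE g. g \<in> carrier G \<and> e' = EG_act G T e g)"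

lemma transl_act:
  assumes "e \<in> topspace (EG_space G T)" "g \<in> carrier G"
  shows "transl e (EG_act G T e g) = g"
  unfolding transl_def using assms EG_act_free by (intro the_equality) auto

text \<open>Near \<open>(e, e g)\<close>, let \<open>i\<close> be a step of positive length with
  value \<open>a i\<close>. Continuity of \<open>(x, y) \<mapsto> inv x \<otimes> y\<close> at
  \<open>(a i, a i \<otimes> g)\<close> provides neighbourhoods \<open>A\<close> and
  \<open>B\<close> sent into \<open>W\<close>, and the required neighbourhood consists of pairs
  having majority values in \<open>A\<close> and in \<open>B\<close> over the \<open>i\<close>-th
  interval.\<close>

lemma continuous_map_transl:
  "continuous_map (subtopology (prod_topology (EG_space G T) (EG_space G T)) same_orbit) T
     (\<lambda>(e, e'). transl e e')" (is "continuous_map ?X T ?d")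
proof -
  have val: "transl e e' \<in> carrier G \<and> e' = EG_act G T e (transl e e')" if "(e, e') \<in> topspace ?X" for e e'
    using that transl_act by (auto simp: same_orbit_def)
  have nbhd: "\<exists>U. openin ?X U \<and> z \<in> U \<and> (\<forall>y\<in>U. ?d y \<in> W)"
    if z: "z \<in> topspace ?X" "?d z \<in> W" and W: "openin T W" for z W
  proof -
    obtain e e' where ee: "z = (e, e')" by (cases z)
    have e: "e \<in> topspace (EG_space G T)" using z ee by auto
    then obtain p t a where pta: "e = EG_class G T (p, t, a)" "t \<in> standard_simplex p" "a \<in> steps G p"
      by (rule EG_cases)
    define g where "g = transl e e'"
    have g: "g \<in> carrier G" "e' = EG_act G T e g" "g \<in> W" using val z ee g_def by auto
    obtain i where i: "i \<le> p" "t i > 0" using simplex_pos[OF pta(2)] .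
    let ?\<phi> = "clamp_to (psum t i) (psum t (Suc i))"
    have ai: "a i \<in> carrier G" using steps_at[OF pta(3) i(1)] .
    let ?m = "\<lambda>z. inv (fst z) \<otimes> snd z"
    have "continuous_map (prod_topology T T) T ?m"
      by (intro continuous_map_mult continuous_map_inverse continuous_map_fst continuous_map_snd)
    then have "openin (prod_topology T T) {z \<in> topspace (prod_topology T T). ?m z \<in> W}"
      using W by (rule openin_continuous_map_preimage)
    moreover have "(a i, a i \<otimes> g) \<in> {z \<in> topspace (prod_topology T T). ?m z \<in> W}"
      using ai g by (simp add: topspace_T flip: m_assoc)
    ultimately have "\<exists>A B. openin T A \<and> openin T B \<and> a i \<in> A \<and> a i \<otimes> g \<in> B \<and>
        A \<times> B \<subseteq> {z \<in> topspace (prod_topology T T). ?m z \<in> W}"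
      by (rule openin_prod_topology_alt[THEN iffD1, rule_format])
    then obtain A B where AB: "openin T A" "openin T B" "a i \<in> A" "a i \<otimes> g \<in> B"
      "A \<times> B \<subseteq> {z \<in> topspace (prod_topology T T). ?m z \<in> W}"
      by (elim exE conjE)
    let ?U = "(massive ?\<phi> A \<times> massive ?\<phi> B) \<inter> same_orbit"
    have "openin (prod_topology (EG_space G T) (EG_space G T)) (massive ?\<phi> A \<times> massive ?\<phi> B)"
      using AB(1,2) openin_massive[OF mono_clamp continuous_clamp] by (auto simp: openin_prod_Times_iff)
    then have U: "openin ?X ?U" by (rule openin_subtopology_Int)
    have "z \<in> ?U"
    proof -
      have "e \<in> massive ?\<phi> A"
        using mass_at_step[OF pta(2) i(1), of a A] AB(3) i pta
        by (simp add: in_massive_iff del: mass.simps)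
      moreover have "e' \<in> massive ?\<phi> B"
        using mass_at_step[OF pta(2) i(1), of "rmul G p a g" B] AB(4) i pta g
        by (simp add: EG_act_class in_massive_iff rmul_at rmul_steps del: mass.simps)
      ultimately show ?thesis using z ee by auto
    qed
    moreover have "?d y \<in> W" if y: "y \<in> ?U" for y
    proof -
      obtain f f' where ff: "y = (f, f')" by (cases y)
      define h where "h = transl f f'"
      have "(f, f') \<in> topspace ?X" using y U ff openin_subset by blast
      then have h: "h \<in> carrier G" "f' = EG_act G T f h" "f \<in> topspace (EG_space G T)"
        using val[of f f'] h_def by auto
      from h(3) obtain q s b where qsb: "f = EG_class G T (q, s, b)" "s \<in> standard_simplex q" "b \<in> steps G q"
        by (rule EG_cases)
      have "f \<in> massive ?\<phi> A" "f' \<in> massive ?\<phi> B" using y ff by auto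
      then have "mass ?\<phi> A (q, s, b) > (?\<phi> 1 - ?\<phi> 0) / 2"
        "mass ?\<phi> B (q, s, rmul G q b h) > (?\<phi> 1 - ?\<phi> 0) / 2"
        using qsb h by (simp_all add: EG_act_class in_massive_iff rmul_steps del: mass.simps)
      \<comment> \<open>The index \<open>j\<close> depends on the representative of the nearby pair,
        but every index at which both conditions hold recovers the same group element
        \<open>h\<close> as \<open>inv (b j) \<otimes> (b j \<otimes> h)\<close>.\<close>
      then obtain j where j: "j \<le> q" "b j \<in> A" "rmul G q b h j \<in> B"
        by (rule mass_overlap[OF mono_clamp qsb(2)])
      then have "inv (b j) \<otimes> (b j \<otimes> h) \<in> W" using AB(5) by (auto simp: rmul_at)
      moreover have "b j \<in> carrier G" using steps_at[OF qsb(3) j(1)] .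
      ultimately have "h \<in> W" using h by (simp flip: m_assoc)
      then show ?thesis by (simp add: ff h_def)
    qed
    ultimately show ?thesis using U by blast
  qed
  show ?thesis
    unfolding continuous_map_def
  proof (intro conjI allI impI)
    show "?d \<in> topspace ?X \<rightarrow> topspace T"
    proof
      fix z assume "z \<in> topspace ?X"
      then show "?d z \<in> topspace T" using val topspace_T by (cases z) simp
    qed
    fix W assume W: "openin T W"
    show "openin ?X {z \<in> topspace ?X. ?d z \<in> W}"
    proof (subst openin_subopen, intro ballI)
      fix z assume "z \<in> {z \<in> topspace ?X. ?d z \<in> W}"
      then obtain U where U: "openin ?X U" "z \<in> U" "\<forall>y\<in>U. ?d y \<in> W"
        using nbhd[OF _ _ W, of z] by blast
      then have "U \<subseteq> {z \<in> topspace ?X. ?d z \<in> W}" using openin_subset[OF U(1)] by blast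
      then show "\<exists>U. openin ?X U \<and> z \<in> U \<and> U \<subseteq> {z \<in> topspace ?X. ?d z \<in> W}"
        using U(1,2) by blast
    qed
  qed
qed

end

section \<open>Faces and degeneracies of vertex sequences\<close>

lemma length_omit_nth: "k < length xs \<Longrightarrow> length (omit_nth k xs) = length xs - 1"
  by (simp add: omit_nth_def)

lemma nth_omit_nth: "k < length xs \<Longrightarrow> Suc i < length xs \<Longrightarrow> omit_nth k xs ! i = xs ! skip k i"
  by (auto simp: omit_nth_def skip_def nth_append min_def)

lemma length_repeat_nth: "k < length xs \<Longrightarrow> length (repeat_nth k xs) = Suc (length xs)"
  by (simp add: repeat_nth_def)

lemma nth_repeat_nth:
  "k < length xs \<Longrightarrow> i \<le> length xs \<Longrightarrow> repeat_nth k xs ! i = (if i \<le> k then xs ! i else xs ! (i - 1))"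
  by (auto simp: repeat_nth_def nth_append min_def intro!: arg_cong[of _ _ "(!) xs"])

lemma take_omit_nth_le: "m \<le> i \<Longrightarrow> i < length xs \<Longrightarrow> take m (omit_nth i xs) = take m xs"
  by (simp add: omit_nth_def min_def)

lemma take_omit_nth_gt:
  "i < m \<Longrightarrow> i < length xs \<Longrightarrow> take m (omit_nth i xs) = omit_nth i (take (Suc m) xs)"
  by (simp add: omit_nth_def min_def drop_take)

lemma take_repeat_nth_le: "m \<le> Suc i \<Longrightarrow> i < length xs \<Longrightarrow> take m (repeat_nth i xs) = take m xs"
  by (simp add: repeat_nth_def min_def)

lemma take_repeat_nth_gt:
  "i < m \<Longrightarrow> i < length xs \<Longrightarrow> take (Suc m) (repeat_nth i xs) = repeat_nth i (take m xs)"
  by (simp add: repeat_nth_def min_def drop_take)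

lemma set_omit_nth_subset: "set (omit_nth i xs) \<subseteq> set xs"
  by (auto simp: omit_nth_def dest: in_set_takeD in_set_dropD)

lemma set_repeat_nth: "set (repeat_nth i xs) = set xs"
proof
  show "set (repeat_nth i xs) \<subseteq> set xs"
    by (auto simp: repeat_nth_def dest: in_set_takeD in_set_dropD)
  have "set xs = set (take i xs) \<union> set (drop i xs)" by (metis append_take_drop_id set_append)
  also have "\<dots> \<subseteq> set (repeat_nth i xs)"
    using set_take_subset_set_take[of i "Suc i" xs] by (auto simp: repeat_nth_def)
  finally show "set xs \<subseteq> set (repeat_nth i xs)" .
qed

lemma sorted_omit_nth: "sorted xs \<Longrightarrow> sorted (omit_nth i xs)"
  unfolding omit_nth_def sorted_append
  by (auto simp: sorted_wrt_take sorted_wrt_drop in_set_conv_nth sorted_iff_nth_mono)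

lemma sorted_repeat_nth: "sorted xs \<Longrightarrow> sorted (repeat_nth i xs)"
  unfolding repeat_nth_def sorted_append
  by (auto simp: sorted_wrt_take sorted_wrt_drop in_set_conv_nth sorted_iff_nth_mono)

lemma simplices_complex_iff:
  "\<sigma> \<in> simplices (complex_sset K) n \<longleftrightarrow> length \<sigma> = Suc n \<and> sorted \<sigma> \<and> set \<sigma> \<in> K"
  by (simp add: complex_sset_def)

lemma face_complex [simp]: "face (complex_sset K) = omit_nth"
  and degen_complex [simp]: "degen (complex_sset K) = repeat_nth"
  by (simp_all add: complex_sset_def)

lemma repeat_nth_simplex:
  "\<sigma> \<in> simplices (complex_sset K) n \<Longrightarrow> i \<le> n \<Longrightarrow> repeat_nth i \<sigma> \<in> simplices (complex_sset K) (Suc n)"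
  by (simp add: simplices_complex_iff length_repeat_nth sorted_repeat_nth set_repeat_nth)

context
  fixes K :: "'a::linorder set set"
  assumes K: "abstract_complex K"
begin

lemma complex_face: "\<rho> \<in> K \<Longrightarrow> \<rho>' \<subseteq> \<rho> \<Longrightarrow> \<rho>' \<noteq> {} \<Longrightarrow> \<rho>' \<in> K"
  using K unfolding abstract_complex_def by blast

lemma omit_nth_simplex:
  assumes "\<sigma> \<in> simplices (complex_sset K) (Suc n)" "i \<le> Suc n"
  shows "omit_nth i \<sigma> \<in> simplices (complex_sset K) n"
proof -
  have l: "length (omit_nth i \<sigma>) = Suc n"
    using assms by (simp add: simplices_complex_iff length_omit_nth)
  then have "omit_nth i \<sigma> \<noteq> []" by auto
  then show ?thesis
    using assms l complex_face[OF _ set_omit_nth_subset] sorted_omit_nth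
    by (auto simp: simplices_complex_iff)
qed

lemma take_simplex:
  assumes "\<sigma> \<in> simplices (complex_sset K) n" "m \<le> n"
  shows "take (Suc m) \<sigma> \<in> simplices (complex_sset K) m"
proof -
  have l: "length (take (Suc m) \<sigma>) = Suc m" using assms by (simp add: simplices_complex_iff)
  then have "take (Suc m) \<sigma> \<noteq> []" by auto
  then show ?thesis
    using assms l complex_face[OF _ set_take_subset] sorted_wrt_take
    by (auto simp: simplices_complex_iff)
qed

end

section \<open>The cocycle on a simplex\<close>

text \<open>\<open>front j k t\<close> is the point of the front face with \<open>k\<close> vertices obtained by moving the
  remaining mass of \<open>t\<close> to the vertex \<open>j\<close>.\<close>

definition front :: "nat \<Rightarrow> nat \<Rightarrow> (nat \<Rightarrow> real) \<Rightarrow> nat \<Rightarrow> real" where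
  "front j k t = (\<lambda>i. if i < k then t i + (if i = j then 1 - psum t k else 0) else 0)"

lemma front_in:
  assumes "t \<in> standard_simplex p" "j \<le> k"
  shows "front j (Suc k) t \<in> standard_simplex k"
proof (rule standard_simplexI)
  show "0 \<le> front j (Suc k) t i" for i
    using standard_simplexD(1)[OF assms(1)] psum_le_1[OF assms(1)] by (simp add: front_def)
  have "(\<Sum>i\<le>k. front j (Suc k) t i) = (\<Sum>i\<le>k. t i) + (\<Sum>i\<le>k. if i = j then 1 - psum t (Suc k) else 0)"
    by (subst sum.distrib[symmetric]) (auto simp: front_def intro: sum.cong)
  also have "\<dots> = 1" using assms(2) by (simp add: psum_def lessThan_Suc_atMost)
  finally show "(\<Sum>i\<le>k. front j (Suc k) t i) = 1" .
qed (simp add: front_def)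

lemma front_face_le: "k \<le> i \<Longrightarrow> front j k (simplical_face i t) = front j k t"
  by (rule ext) (simp add: front_def psum_simplical_face, simp add: simplical_face_def)

text \<open>The inserted coordinate is zero and lies before the cut, so the mass beyond the cut is
  unchanged, while the receiving vertex \<open>j\<close> is renumbered to
  \<open>skip i j\<close>.\<close>

lemma front_face_ge:
  assumes "i \<le> k"
  shows "front (skip i j) (Suc k) (simplical_face i t) = simplical_face i (front j k t)"
proof
  fix l
  have "psum (simplical_face i t) (Suc k) = psum t k" using assms by (simp add: psum_simplical_face)
  then show "front (skip i j) (Suc k) (simplical_face i t) l = simplical_face i (front j k t) l"
    using assms by (cases l i rule: linorder_cases) (auto simp: front_def simplical_face_def skip_def)
qed

text \<open>The monotone index map of the \<open>i\<close>-th codegeneracy, identifying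
  \<open>i\<close> and \<open>Suc i\<close>; counterpart of \<open>skip\<close>.\<close>

definition merge :: "nat \<Rightarrow> nat \<Rightarrow> nat" where
  "merge i j = (if j \<le> i then j else j - 1)"

lemma front_degen_le: "k \<le> i \<Longrightarrow> front j k (codegen i t) = front j k t"
  by (rule ext) (simp add: front_def psum_codegen, simp add: codegen_def)

lemma front_degen_gt:
  assumes "i < k"
  shows "codegen i (front j (Suc k) t) = front (merge i j) k (codegen i t)"
proof
  fix l
  have "psum (codegen i t) k = psum t (Suc k)" using assms by (simp add: psum_codegen)
  then show "codegen i (front j (Suc k) t) l = front (merge i j) k (codegen i t) l"
    using assms by (cases l i rule: linorder_cases) (auto simp: front_def codegen_def merge_def)
qed

lemma front_full: "t \<in> standard_simplex p \<Longrightarrow> front j (Suc p) t = t"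
  using psum_eq_1[of t p] standard_simplexD(3)[of t p] by (auto simp: front_def)

lemma continuous_map_front:
  assumes "j \<le> k"
  shows "continuous_map (simplex_top p) (simplex_top k) (front j (Suc k))"
  unfolding continuous_map_into_simplex
proof (intro conjI allI)
  show "continuous_map (simplex_top p) euclideanreal (\<lambda>t. front j (Suc k) t i)" for i
    unfolding front_def
    by (cases "i < Suc k"; cases "i = j")
      (auto intro!: continuous_map_add continuous_map_diff continuous_map_psum continuous_map_simplex_coord)
  show "front j (Suc k) \<in> topspace (simplex_top p) \<rightarrow> standard_simplex k"
    using front_in assms by auto
qed

locale transitions = top_group G T for G :: "('g, 'm) monoid_scheme" (structure) and T +
  fixes K :: "'a::linorder set set" and v :: "'a list \<Rightarrow> (nat \<Rightarrow> real) \<Rightarrow> 'g"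
  assumes complex: "abstract_complex K"
    and compatible: "compatible_transitions G T (complex_sset K) v"
begin

abbreviation S :: "nat \<Rightarrow> 'a list set" where
  "S \<equiv> simplices (complex_sset K)"

lemma v_continuous: "\<sigma> \<in> S (Suc p) \<Longrightarrow> continuous_map (simplex_top p) T (v \<sigma>)"
  using compatible by (simp add: compatible_transitions_def)

lemma v_carrier: "\<sigma> \<in> S (Suc p) \<Longrightarrow> t \<in> standard_simplex p \<Longrightarrow> v \<sigma> t \<in> carrier G"
  using continuous_map_carrier[OF v_continuous] by simp

lemma v_face:
  "\<sigma> \<in> S (Suc (Suc p)) \<Longrightarrow> t \<in> standard_simplex p \<Longrightarrow> i < Suc p \<Longrightarrow>
     v \<sigma> (simplical_face i t) = v (omit_nth i \<sigma>) t"
  using compatible by (simp add: compatible_transitions_def)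

lemma v_last_face:
  "\<sigma> \<in> S (Suc (Suc p)) \<Longrightarrow> t \<in> standard_simplex p \<Longrightarrow>
     v \<sigma> (simplical_face (Suc p) t) = v (omit_nth (Suc p) \<sigma>) t \<otimes> inv (v (omit_nth (Suc (Suc p)) \<sigma>) t)"
  using compatible by (simp add: compatible_transitions_def)

lemma v_degen:
  "\<sigma> \<in> S p \<Longrightarrow> t \<in> standard_simplex p \<Longrightarrow> j < p \<Longrightarrow> v (repeat_nth j \<sigma>) t = v \<sigma> (codegen j t)"
  using compatible by (simp add: compatible_transitions_def)

lemma v_last_degen: "\<sigma> \<in> S p \<Longrightarrow> t \<in> standard_simplex p \<Longrightarrow> v (repeat_nth p \<sigma>) t = \<one>"
  using compatible by (simp add: compatible_transitions_def)

lemmas S_face = omit_nth_simplex[OF complex]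
lemmas S_take = take_simplex[OF complex]
lemmas S_degen = repeat_nth_simplex[where K = K]

end

text \<open>The transition function of the front face with vertices \<open>0, ..., k\<close>
  compares its frame with that of the face opposite to \<open>k\<close>. The factor is its inverse
  at the point of that face obtained by collecting the remaining mass at \<open>j\<close>. It is
  trivial for \<open>k \<le> j\<close>, where the vertex \<open>j\<close> is not yet in the face
  that would receive the mass.\<close>

definition factor :: "('g, 'm) monoid_scheme \<Rightarrow> ('a list \<Rightarrow> (nat \<Rightarrow> real) \<Rightarrow> 'g) \<Rightarrow>
    'a list \<Rightarrow> (nat \<Rightarrow> real) \<Rightarrow> nat \<Rightarrow> nat \<Rightarrow> 'g" where
  "factor G v \<beta> t j k = (if j < k then inv\<^bsub>G\<^esub> v (take (Suc k) \<beta>) (front j k t) else \<one>\<^bsub>G\<^esub>)"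

primrec coef_upto :: "('g, 'm) monoid_scheme \<Rightarrow> ('a list \<Rightarrow> (nat \<Rightarrow> real) \<Rightarrow> 'g) \<Rightarrow>
    'a list \<Rightarrow> (nat \<Rightarrow> real) \<Rightarrow> nat \<Rightarrow> nat \<Rightarrow> 'g" where
  "coef_upto G v \<beta> t j 0 = \<one>\<^bsub>G\<^esub>"
| "coef_upto G v \<beta> t j (Suc k) = coef_upto G v \<beta> t j k \<otimes>\<^bsub>G\<^esub> factor G v \<beta> t j (Suc k)"

text \<open>The coordinate of the frame of a simplex \<open>\<beta>\<close> at \<open>t\<close> in a trivialisation of the bundle over
  the open star of the vertex \<open>\<beta> ! j\<close>. The frame of a front face differs from that of the
  next one by a transition function; moving mass to the vertex \<open>j\<close> makes the product of these
  compatible with all faces except the one opposite to \<open>j\<close>.\<close>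

definition coef :: "('g, 'm) monoid_scheme \<Rightarrow> ('a list \<Rightarrow> (nat \<Rightarrow> real) \<Rightarrow> 'g) \<Rightarrow>
    'a list \<Rightarrow> (nat \<Rightarrow> real) \<Rightarrow> nat \<Rightarrow> 'g" where
  "coef G v \<beta> t j = coef_upto G v \<beta> t j (length \<beta> - 1)"

context transitions
begin

lemma factor_carrier:
  assumes "\<beta> \<in> S p" "t \<in> standard_simplex q" "Suc k \<le> p"
  shows "factor G v \<beta> t j (Suc k) \<in> carrier G"
  using v_carrier[OF S_take[OF assms(1,3)] front_in[OF assms(2), of j k]] by (simp add: factor_def)

lemma coef_upto_carrier:
  assumes "\<beta> \<in> S p" "t \<in> standard_simplex q"
  shows "k \<le> p \<Longrightarrow> coef_upto G v \<beta> t j k \<in> carrier G"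
  by (induction k) (simp_all add: factor_carrier[OF assms])

lemma coef_carrier: "\<beta> \<in> S p \<Longrightarrow> t \<in> standard_simplex q \<Longrightarrow> coef G v \<beta> t j \<in> carrier G"
  unfolding coef_def by (rule coef_upto_carrier[where p = p]) (auto simp: simplices_complex_iff)

lemma continuous_map_coef:
  assumes "\<beta> \<in> S p" shows "continuous_map (simplex_top q) T (\<lambda>t. coef G v \<beta> t j)"
proof -
  have "continuous_map (simplex_top q) T (\<lambda>t. factor G v \<beta> t j (Suc k))" if "Suc k \<le> p" for k
  proof (cases "j \<le> k")
    case True
    have "continuous_map (simplex_top q) T (\<lambda>t. v (take (Suc (Suc k)) \<beta>) (front j (Suc k) t))"
      using continuous_map_compose[OF continuous_map_front[OF True] v_continuous[OF S_take[OF assms that]]]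
      by (simp add: o_def)
    then show ?thesis using True unfolding factor_def by (simp add: continuous_map_inverse)
  qed (simp add: factor_def topspace_T)
  then have "continuous_map (simplex_top q) T (\<lambda>t. coef_upto G v \<beta> t j k)" if "k \<le> p" for k
    using that by (induction k) (simp_all add: topspace_T continuous_map_mult)
  then show ?thesis using assms by (simp add: coef_def simplices_complex_iff)
qed

lemma coef_upto_face_lt:
  assumes "\<beta> \<in> S (Suc p)" "i \<le> Suc p"
  shows "k < i \<Longrightarrow> coef_upto G v \<beta> (simplical_face i t) (skip i j) k = coef_upto G v (omit_nth i \<beta>) t j k"
proof (induction k)
  case (Suc k)
  have "factor G v \<beta> (simplical_face i t) (skip i j) (Suc k) = factor G v (omit_nth i \<beta>) t j (Suc k)"
    using Suc.prems assms
    by (auto simp: factor_def take_omit_nth_le simplices_complex_iff front_face_le skip_def)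
  then show ?case using Suc by simp
qed simp

text \<open>Deleting the vertex \<open>i\<close> fuses the factors with indices \<open>i\<close> and
  \<open>Suc i\<close> into a single one: this is the cocycle condition for the last two faces of
  the front simplex with last vertex \<open>Suc i\<close>. Later factors correspond one to one by
  the condition on the earlier faces.\<close>

lemma coef_upto_face_ge:
  assumes \<beta>: "\<beta> \<in> S (Suc p)" and i: "i \<le> p" and t: "t \<in> standard_simplex p"
  shows "i \<le> k \<Longrightarrow> k \<le> p \<Longrightarrow>
    coef_upto G v \<beta> (simplical_face i t) (skip i j) (Suc k) = coef_upto G v (omit_nth i \<beta>) t j k"
proof (induction k rule: nat_induct_at_least)
  case base
  note coef_upto.simps(2) [simp del]
  show ?case
  proof (cases i)
    case 0
    then show ?thesis by (simp add: coef_upto.simps(2) factor_def skip_def)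
  next
    case (Suc m)
    have eq: "coef_upto G v \<beta> (simplical_face i t) (skip i j) m = coef_upto G v (omit_nth i \<beta>) t j m"
      using coef_upto_face_lt[OF \<beta>, of i m] i Suc by simp
    have c: "coef_upto G v (omit_nth i \<beta>) t j m \<in> carrier G"
      using coef_upto_carrier[OF S_face[OF \<beta>] t, of i m j] i Suc by simp
    show ?thesis
    \<comment> \<open>For \<open>j \<ge> i\<close> the reinserted vertex has number
      \<open>Suc j > i\<close>, so both factors on the left and the one on the right are
      trivial.\<close>
    proof (cases "j < i")
      case True
      then have j: "skip i j = j" "j \<le> m" using Suc by (auto simp: skip_def)
      let ?c = "front j (Suc m) t"
      have cin: "?c \<in> standard_simplex m" using front_in[OF t j(2)] .
      have \<sigma>: "take (Suc (Suc (Suc m))) \<beta> \<in> S (Suc (Suc m))" using S_take[OF \<beta>, of "Suc (Suc m)"] i Suc by simp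
      have l: "length \<beta> = Suc (Suc p)" using \<beta> by (simp add: simplices_complex_iff)
      have f1: "front j (Suc m) (simplical_face i t) = ?c" using Suc by (simp add: front_face_le)
      have f2: "front j (Suc (Suc m)) (simplical_face i t) = simplical_face (Suc m) ?c"
        using front_face_ge[of i "Suc m" j t] Suc j by simp
      have o1: "omit_nth (Suc (Suc m)) (take (Suc (Suc (Suc m))) \<beta>) = take (Suc (Suc m)) \<beta>"
        using l i Suc by (simp add: omit_nth_def min_def)
      have o2: "omit_nth (Suc m) (take (Suc (Suc (Suc m))) \<beta>) = take (Suc (Suc m)) (omit_nth i \<beta>)"
        using l i Suc by (simp add: take_omit_nth_gt)
      let ?V1 = "v (take (Suc (Suc m)) \<beta>) ?c" and ?V2 = "v (take (Suc (Suc m)) (omit_nth i \<beta>)) ?c"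
      have V: "?V1 \<in> carrier G" "?V2 \<in> carrier G"
        using v_carrier[OF S_face[OF \<sigma>, of "Suc (Suc m)"] cin] v_carrier[OF S_face[OF \<sigma>, of "Suc m"] cin] o1 o2
        by simp_all
      have "v (take (Suc (Suc (Suc m))) \<beta>) (simplical_face (Suc m) ?c) = ?V2 \<otimes> inv ?V1"
        using v_last_face[OF \<sigma> cin] o1 o2 by simp
      then have "coef_upto G v \<beta> (simplical_face i t) (skip i j) (Suc i)
          = coef_upto G v (omit_nth i \<beta>) t j m \<otimes> inv ?V1 \<otimes> inv (?V2 \<otimes> inv ?V1)"
        using eq j f1 f2 Suc by (simp add: coef_upto.simps(2) factor_def)
      \<comment> \<open>With \<open>?V1\<close> belonging to the face that keeps \<open>i\<close>
        and \<open>?V2\<close> to the one that skips it,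
        \<open>inv ?V1 \<otimes> inv (?V2 \<otimes> inv ?V1)\<close> telescopes to
        \<open>inv ?V2\<close>.\<close>
      also have "\<dots> = coef_upto G v (omit_nth i \<beta>) t j m \<otimes> inv ?V2"
        using V c by (simp add: inv_mult_group m_assoc) (simp flip: m_assoc)
      finally show ?thesis using Suc j by (simp add: coef_upto.simps(2) factor_def)
    next
      case False
      then have "skip i j = Suc j" by (simp add: skip_def)
      then show ?thesis using Suc False eq c by (simp add: coef_upto.simps(2) factor_def)
    qed
  qed
next
  case (Suc k)
  have l: "length \<beta> = Suc (Suc p)" using \<beta> by (simp add: simplices_complex_iff)
  have lt: "skip i j < Suc (Suc k) \<longleftrightarrow> j < Suc k" using Suc.hyps by (auto simp: skip_def)
  have "factor G v \<beta> (simplical_face i t) (skip i j) (Suc (Suc k)) = factor G v (omit_nth i \<beta>) t j (Suc k)"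
  proof (cases "j < Suc k")
    case True
    then have cin: "front j (Suc k) t \<in> standard_simplex k" using front_in[OF t, of j k] by simp
    have \<sigma>: "take (Suc (Suc (Suc k))) \<beta> \<in> S (Suc (Suc k))" using S_take[OF \<beta>, of "Suc (Suc k)"] Suc.prems by simp
    have "v (take (Suc (Suc (Suc k))) \<beta>) (front (skip i j) (Suc (Suc k)) (simplical_face i t))
        = v (omit_nth i (take (Suc (Suc (Suc k))) \<beta>)) (front j (Suc k) t)"
      using front_face_ge[of i "Suc k" j t] v_face[OF \<sigma> cin, of i] Suc.hyps by simp
    then show ?thesis
      using True lt l i Suc.hyps by (simp add: factor_def take_omit_nth_gt)
  qed (use lt in \<open>simp add: factor_def\<close>)
  then show ?case
    using Suc by (simp only: coef_upto.simps Suc_leD)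
qed

text \<open>For the last face the product for \<open>\<beta>\<close> has one factor more than that
  for the face, namely \<open>inv v \<beta> t\<close>, since on that face the front point is
  \<open>t\<close> itself; the extra right factor cancels it. The same factor appears in
  \<open>assoc_rel\<close>, which is what makes the map to \<open>EG\<close> well defined.\<close>

lemma coef_face:
  assumes \<beta>: "\<beta> \<in> S (Suc p)" and i: "i \<le> Suc p" and t: "t \<in> standard_simplex p" and j: "j \<le> p"
  shows "coef G v \<beta> (simplical_face i t) (skip i j) \<otimes> (if i = Suc p then v \<beta> t else \<one>)
    = coef G v (omit_nth i \<beta>) t j"
proof -
  have l: "length \<beta> = Suc (Suc p)" "length (omit_nth i \<beta>) = Suc p"
    using \<beta> i by (auto simp: simplices_complex_iff length_omit_nth)
  have c: "coef_upto G v (omit_nth i \<beta>) t j p \<in> carrier G"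
    using coef_upto_carrier[OF S_face[OF \<beta> i] t, of p] by simp
  show ?thesis
  proof (cases "i = Suc p")
    case True
    have "front j (Suc p) (simplical_face i t) = t"
      using True front_face_le[of "Suc p" i] front_full[OF t] by simp
    then have "factor G v \<beta> (simplical_face i t) j (Suc p) = inv v \<beta> t"
      using j l by (simp add: factor_def)
    moreover have "skip i j = j" using True j by (simp add: skip_def)
    moreover have "v \<beta> t \<in> carrier G" using v_carrier[OF \<beta> t] .
    ultimately show ?thesis
      using True l c coef_upto_face_lt[OF \<beta> i, of p t j] by (simp add: coef_def m_assoc)
  next
    case False
    then show ?thesis
      using coef_upto_face_ge[OF \<beta> _ t, of i p j] i l c by (simp add: coef_def del: coef_upto.simps)
  qed
qed

text \<open>The repeated vertex contributes one additional factor, of index \<open>Suc i\<close>. It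
  is the transition function of a last degeneracy, hence trivial. The other factors match after
  renumbering.\<close>

lemma coef_degen:
  assumes \<beta>: "\<beta> \<in> S p" and i: "i \<le> p" and t: "t \<in> standard_simplex (Suc p)" and j: "j \<le> Suc p"
  shows "coef G v (repeat_nth i \<beta>) t j = coef G v \<beta> (codegen i t) (merge i j)"
proof -
  have l: "length \<beta> = Suc p" "length (repeat_nth i \<beta>) = Suc (Suc p)"
    using \<beta> i by (auto simp: simplices_complex_iff length_repeat_nth)
  let ?L = "coef_upto G v (repeat_nth i \<beta>) t j" and ?R = "coef_upto G v \<beta> (codegen i t) (merge i j)"
  have 1: "k \<le> i \<Longrightarrow> ?L k = ?R k" for k
  proof (induction k)
    case (Suc k)
    have "factor G v (repeat_nth i \<beta>) t j (Suc k) = factor G v \<beta> (codegen i t) (merge i j) (Suc k)"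
      using Suc.prems l i
      by (auto simp: factor_def take_repeat_nth_le front_degen_le merge_def)
    then show ?case using Suc by simp
  qed simp
  have 2: "i \<le> k \<Longrightarrow> k \<le> p \<Longrightarrow> ?L (Suc k) = ?R k" for k
  proof (induction k rule: nat_induct_at_least)
    case base
    have "factor G v (repeat_nth i \<beta>) t j (Suc i) = \<one>"
    proof (cases "j \<le> i")
      case True
      have "take (Suc (Suc i)) (repeat_nth i \<beta>) = repeat_nth i (take (Suc i) \<beta>)"
        using l i by (simp add: take_repeat_nth_gt)
      moreover have "v (repeat_nth i (take (Suc i) \<beta>)) (front j (Suc i) t) = \<one>"
        using v_last_degen[OF S_take[OF \<beta> i] front_in[OF t True]] .
      ultimately show ?thesis using True by (simp add: factor_def)
    qed (simp add: factor_def)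
    then show ?case
      using 1[of i] coef_upto_carrier[OF \<beta> codegen_in[OF t i] i] by simp
  next
    case (Suc k)
    have lt: "j < Suc (Suc k) \<longleftrightarrow> merge i j < Suc k" using Suc.hyps by (auto simp: merge_def)
    have "factor G v (repeat_nth i \<beta>) t j (Suc (Suc k)) = factor G v \<beta> (codegen i t) (merge i j) (Suc k)"
    proof (cases "j < Suc (Suc k)")
      case True
      then have cin: "front j (Suc (Suc k)) t \<in> standard_simplex (Suc k)" using front_in[OF t, of j "Suc k"] by simp
      have "v (repeat_nth i (take (Suc (Suc k)) \<beta>)) (front j (Suc (Suc k)) t)
         = v (take (Suc (Suc k)) \<beta>) (codegen i (front j (Suc (Suc k)) t))"
        using v_degen[OF S_take[OF \<beta>, of "Suc k"] cin, of i] Suc.prems Suc.hyps by simp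
      moreover have "take (Suc (Suc (Suc k))) (repeat_nth i \<beta>) = repeat_nth i (take (Suc (Suc k)) \<beta>)"
        using l i Suc.hyps by (simp add: take_repeat_nth_gt)
      ultimately show ?thesis
        using True lt front_degen_gt[of i "Suc k" j t] Suc.hyps by (simp add: factor_def)
    qed (use lt in \<open>simp add: factor_def\<close>)
    then show ?case using Suc by (simp only: coef_upto.simps Suc_leD)
  qed
  show ?thesis using 2[OF i] l by (simp add: coef_def)
qed

end

section \<open>Barycentric coordinates\<close>

lemma barycentric_eq:
  assumes "length \<sigma> = Suc n"
  shows "barycentric \<sigma> t a = (\<Sum>i\<le>n. if \<sigma> ! i = a then t i else 0)"
proof -
  have "{i. i < length \<sigma> \<and> \<sigma> ! i = a} = {i \<in> {..n}. \<sigma> ! i = a}" using assms by auto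
  then show ?thesis unfolding barycentric_def by (simp only: sum.inter_filter finite_atMost)
qed

lemma barycentric_face:
  assumes "length \<sigma> = Suc (Suc n)" "i \<le> Suc n"
  shows "barycentric (omit_nth i \<sigma>) t = barycentric \<sigma> (simplical_face i t)"
proof
  fix a
  have l: "length (omit_nth i \<sigma>) = Suc n" using assms by (simp add: length_omit_nth)
  show "barycentric (omit_nth i \<sigma>) t a = barycentric \<sigma> (simplical_face i t) a"
    unfolding barycentric_eq[OF l] barycentric_eq[OF assms(1)] sum_skip[OF assms(2)]
    using assms by (simp add: simplical_face_at nth_omit_nth cong: if_cong)
qed

lemma barycentric_degen:
  assumes "length \<sigma> = Suc n" "i \<le> n"
  shows "barycentric (repeat_nth i \<sigma>) t = barycentric \<sigma> (codegen i t)"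
proof
  fix a
  have l: "length (repeat_nth i \<sigma>) = Suc (Suc n)" using assms by (simp add: length_repeat_nth)
  let ?F = "\<lambda>k. if k \<le> Suc n \<and> repeat_nth i \<sigma> ! k = a then t k else 0"
  let ?F' = "\<lambda>k. if k \<le> n \<and> \<sigma> ! k = a then codegen i t k else 0"
  have "(\<Sum>k\<le>n. ?F' k) = (\<Sum>k\<le>Suc n. ?F k)"
    by (rule sum_merge[OF assms(2)]) (use assms in \<open>auto simp: nth_repeat_nth codegen_def\<close>)
  then show "barycentric (repeat_nth i \<sigma>) t a = barycentric \<sigma> (codegen i t) a"
    unfolding barycentric_eq[OF l] barycentric_eq[OF assms(1)] by (simp cong: if_cong)
qed

definition supp :: "('a \<Rightarrow> real) \<Rightarrow> 'a set" where
  "supp x = {a. x a \<noteq> 0}"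

lemma supp_barycentric: "supp (barycentric \<sigma> t) \<subseteq> set \<sigma>"
proof
  fix a assume "a \<in> supp (barycentric \<sigma> t)"
  then have "{i. i < length \<sigma> \<and> \<sigma> ! i = a} \<noteq> {}"
    unfolding supp_def barycentric_def by (metis (mono_tags, lifting) mem_Collect_eq sum.empty)
  then show "a \<in> set \<sigma>" by auto
qed

lemma barycentric_nonneg: "(\<And>i. 0 \<le> t i) \<Longrightarrow> 0 \<le> barycentric \<sigma> t a"
  by (auto simp: barycentric_def intro: sum_nonneg)

lemma sum_barycentric:
  assumes "length \<sigma> = Suc n" "t \<in> standard_simplex n" "finite A" "set \<sigma> \<subseteq> A"
  shows "(\<Sum>a\<in>A. barycentric \<sigma> t a) = 1"
proof -
  have "(\<Sum>a\<in>A. barycentric \<sigma> t a) = (\<Sum>i\<le>n. \<Sum>a\<in>A. if \<sigma> ! i = a then t i else 0)"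
    unfolding barycentric_eq[OF assms(1)] by (rule sum.swap)
  also have "\<dots> = (\<Sum>i\<le>n. t i)"
  proof (rule sum.cong)
    fix i assume "i \<in> {..n}"
    then have "\<sigma> ! i \<in> A" using assms(1,4) by auto
    then show "(\<Sum>a\<in>A. if \<sigma> ! i = a then t i else 0) = t i" using assms(3) by simp
  qed simp
  finally show ?thesis using standard_simplexD(4)[OF assms(2)] by simp
qed

lemma topspace_complex_space:
  "x \<in> topspace (complex_space K) \<longleftrightarrow> (\<forall>a. 0 \<le> x a) \<and> supp x \<in> K \<and> (\<Sum>a\<in>\<Union>K. x a) = 1"
  by (simp add: complex_space_def supp_def)

lemma barycentric_in:
  fixes K :: "'a::linorder set set"
  assumes K: "abstract_complex K" and \<sigma>: "length \<sigma> = Suc n" "set \<sigma> \<in> K" and t: "t \<in> standard_simplex n"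
  shows "barycentric \<sigma> t \<in> topspace (complex_space K)"
proof -
  have fin: "finite (\<Union>K)" using K by (simp add: abstract_complex_def)
  have 1: "(\<Sum>a\<in>\<Union>K. barycentric \<sigma> t a) = 1"
    using \<sigma> by (intro sum_barycentric[OF \<sigma>(1) t fin]) auto
  have "supp (barycentric \<sigma> t) \<noteq> {}"
  proof
    assume "supp (barycentric \<sigma> t) = {}"
    then have "\<And>a. barycentric \<sigma> t a = 0" by (auto simp: supp_def)
    then show False using 1 by simp
  qed
  then have "supp (barycentric \<sigma> t) \<in> K"
    using complex_face[OF K \<sigma>(2) supp_barycentric] by simp
  moreover have "0 \<le> barycentric \<sigma> t a" for a
    by (rule barycentric_nonneg) (rule standard_simplexD(1)[OF t])
  ultimately show ?thesis using 1 by (simp add: topspace_complex_space)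
qed

lemma continuous_map_complex_coord: "continuous_map (complex_space K) euclideanreal (\<lambda>x. x a)"
  unfolding complex_space_def
  by (intro continuous_map_from_subtopology continuous_map_product_projection) simp

lemma continuous_map_into_complex_space:
  "continuous_map X (complex_space K) f \<longleftrightarrow>
     (\<forall>a. continuous_map X euclideanreal (\<lambda>x. f x a)) \<and> f \<in> topspace X \<rightarrow> topspace (complex_space K)"
  unfolding complex_space_def continuous_map_in_subtopology by (simp add: continuous_map_componentwise_UNIV)

lemma continuous_map_barycentric_coord:
  assumes "\<And>i. continuous_map X euclideanreal (\<lambda>x. f x i)"
  shows "continuous_map X euclideanreal (\<lambda>x. barycentric \<sigma> (f x) a)"
  unfolding barycentric_def by (intro continuous_map_sum assms) auto

lemma sreal_cells_iff:
  "((n, \<sigma>), t) \<in> topspace (sreal_cells S) \<longleftrightarrow> \<sigma> \<in> simplices S n \<and> t \<in> standard_simplex n"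
  by (auto simp: sreal_cells_def)

lemma sreal_to_complex_class:
  assumes "abstract_complex K" "\<sigma> \<in> simplices (complex_sset K) n" "t \<in> standard_simplex n"
  shows "sreal_to_complex (sreal_class (complex_sset K) ((n, \<sigma>), t)) = barycentric \<sigma> t"
proof -
  let ?f = "\<lambda>((n::nat, \<sigma>), t). barycentric \<sigma> t"
  have "?f a = ?f b" if "sreal_rel (complex_sset K) a b" for a b
    using that by cases (auto simp: simplices_complex_iff barycentric_face barycentric_degen)
  then have "qlift ?f (sreal_class (complex_sset K) ((n, \<sigma>), t)) = ?f ((n, \<sigma>), t)"
    unfolding sreal_class_def by (intro qlift_qclass) (simp_all add: sreal_cells_iff assms)
  then show ?thesis by (simp add: sreal_to_complex_def)
qed

section \<open>Ordered simplices as cells\<close>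

definition verts :: "'a::linorder set \<Rightarrow> 'a list" where
  "verts \<rho> = sorted_list_of_set \<rho>"

definition coords :: "'a::linorder set \<Rightarrow> ('a \<Rightarrow> real) \<Rightarrow> nat \<Rightarrow> real" where
  "coords \<rho> x = (\<lambda>i. if i < card \<rho> then x (verts \<rho> ! i) else 0)"

definition index_in :: "'a::linorder set \<Rightarrow> 'a \<Rightarrow> nat" where
  "index_in \<rho> a = (SOME j. j < card \<rho> \<and> verts \<rho> ! j = a)"

lemma verts_props:
  assumes "finite \<rho>"
  shows "length (verts \<rho>) = card \<rho>" "set (verts \<rho>) = \<rho>" "distinct (verts \<rho>)" "sorted (verts \<rho>)"
  using assms by (simp_all add: verts_def)

lemma verts_unique: "sorted xs \<Longrightarrow> distinct xs \<Longrightarrow> verts (set xs) = xs"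
  unfolding verts_def by (rule sorted_list_of_set.idem_if_sorted_distinct)

lemma index_in:
  assumes "finite \<rho>" "a \<in> \<rho>"
  shows "index_in \<rho> a < card \<rho>" "verts \<rho> ! index_in \<rho> a = a"
proof -
  have "\<exists>j. j < card \<rho> \<and> verts \<rho> ! j = a"
    using assms verts_props[OF assms(1)] by (metis in_set_conv_nth)
  then have "index_in \<rho> a < card \<rho> \<and> verts \<rho> ! index_in \<rho> a = a"
    unfolding index_in_def by (rule someI_ex)
  then show "index_in \<rho> a < card \<rho>" "verts \<rho> ! index_in \<rho> a = a" by auto
qed

lemma index_in_eq: "finite \<rho> \<Longrightarrow> j < card \<rho> \<Longrightarrow> verts \<rho> ! j = a \<Longrightarrow> index_in \<rho> a = j"
  using index_in[of \<rho> a] verts_props[of \<rho>] by (metis nth_eq_iff_index_eq nth_mem)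

lemma verts_remove:
  assumes "finite \<rho>" "c \<in> \<rho>"
  shows "verts (\<rho> - {c}) = omit_nth (index_in \<rho> c) (verts \<rho>)"
proof -
  let ?i = "index_in \<rho> c" and ?V = "verts \<rho>"
  note V = verts_props[OF assms(1)] and i = index_in[OF assms]
  have split: "?V = take ?i ?V @ c # drop (Suc ?i) ?V" using i V id_take_nth_drop by metis
  then have d: "distinct (take ?i ?V @ c # drop (Suc ?i) ?V)" using V(3) by simp
  have "set ?V = insert c (set (omit_nth ?i ?V))"
    by (subst split) (auto simp: omit_nth_def)
  moreover have "c \<notin> set (omit_nth ?i ?V)" "distinct (omit_nth ?i ?V)"
    using d by (auto simp: omit_nth_def)
  ultimately have "set (omit_nth ?i ?V) = \<rho> - {c}" using V(2) by blast
  then show ?thesis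
    using verts_unique[OF sorted_omit_nth[OF V(4)] \<open>distinct (omit_nth ?i ?V)\<close>] by simp
qed

text \<open>If the coordinate at \<open>c\<close> vanishes, the point lies on the face opposite to
  \<open>c\<close>, so its coordinate vector in \<open>\<rho>\<close> is that in the face with a
  zero inserted at the position of \<open>c\<close>.\<close>

lemma coords_remove:
  assumes "finite \<rho>" "c \<in> \<rho>" "x c = 0"
  shows "coords \<rho> x = simplical_face (index_in \<rho> c) (coords (\<rho> - {c}) x)"
proof
  fix l
  let ?i = "index_in \<rho> c"
  note V = verts_props[OF assms(1)] and i = index_in[OF assms(1,2)]
  have card: "card (\<rho> - {c}) = card \<rho> - 1" using assms by simp
  have nth: "verts (\<rho> - {c}) ! k = verts \<rho> ! skip ?i k" if "Suc k < card \<rho>" for k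
    using that V(1) i(1) by (simp add: verts_remove[OF assms(1,2)] nth_omit_nth)
  show "coords \<rho> x l = simplical_face ?i (coords (\<rho> - {c}) x) l"
  proof (cases l ?i rule: linorder_cases)
    case less
    then have "Suc l < card \<rho>" using i(1) by linarith
    then show ?thesis using less nth[of l] by (simp add: coords_def card simplical_face_def skip_def)
  next
    case equal
    then show ?thesis using i assms(3) by (simp add: coords_def simplical_face_def)
  next
    case greater
    then have "0 < l" by linarith
    then obtain m where m: "l = Suc m" using gr0_implies_Suc by blast
    have "skip ?i m = l" "m < card \<rho> - 1 \<longleftrightarrow> l < card \<rho>"
      using greater m by (simp_all add: skip_def less_diff_conv)
    then show ?thesis
      using greater m nth[of m] by (simp add: coords_def card simplical_face_def)
  qed
qed

lemma index_in_remove: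
  assumes "finite \<rho>" "c \<in> \<rho>" "a \<in> \<rho>" "a \<noteq> c"
  shows "index_in \<rho> a = skip (index_in \<rho> c) (index_in (\<rho> - {c}) a)"
proof (rule index_in_eq[OF assms(1)])
  let ?j = "index_in (\<rho> - {c}) a"
  have j: "?j < card \<rho> - 1" "verts (\<rho> - {c}) ! ?j = a"
    using index_in[of "\<rho> - {c}" a] assms by auto
  then show "skip (index_in \<rho> c) ?j < card \<rho>" by (auto simp: skip_def)
  show "verts \<rho> ! skip (index_in \<rho> c) ?j = a"
    using j verts_remove[OF assms(1,2)] nth_omit_nth[of "index_in \<rho> c" "verts \<rho>" ?j]
      index_in[OF assms(1,2)] verts_props[OF assms(1)] by auto
qed

text \<open>In a sorted sequence equal entries may be found next to each other; dropping one of the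
  pair and repeating the other restores the sequence. Thus a simplex with a repeated vertex is a
  degeneracy of one of its faces.\<close>

lemma repeat_of_sorted:
  assumes "sorted \<sigma>" "\<not> distinct \<sigma>"
  obtains i where "Suc i < length \<sigma>" "\<sigma> = repeat_nth i (omit_nth (Suc i) \<sigma>)"
proof -
  have "\<exists>i. Suc i < length \<sigma> \<and> \<sigma> ! i = \<sigma> ! Suc i"
  proof (rule ccontr)
    assume n: "\<nexists>i. Suc i < length \<sigma> \<and> \<sigma> ! i = \<sigma> ! Suc i"
    have "\<sigma> ! i < \<sigma> ! Suc i" if "Suc i < length \<sigma>" for i
      using n that assms(1) sorted_nth_mono[OF assms(1), of i "Suc i"] by (metis le_SucI le_refl order_le_less)
    then have "sorted_wrt (<) \<sigma>" by (simp add: sorted_wrt_iff_nth_Suc_transp)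
    then show False using assms(2) strict_sorted_iff by blast
  qed
  then obtain i where i: "Suc i < length \<sigma>" "\<sigma> ! i = \<sigma> ! Suc i" by blast
  have "\<sigma> = repeat_nth i (omit_nth (Suc i) \<sigma>)"
  proof (rule nth_equalityI)
    have l: "length (omit_nth (Suc i) \<sigma>) = length \<sigma> - 1" using i by (simp add: length_omit_nth)
    then show "length \<sigma> = length (repeat_nth i (omit_nth (Suc i) \<sigma>))" using i by (simp add: length_repeat_nth)
    fix k assume k: "k < length \<sigma>"
    show "\<sigma> ! k = repeat_nth i (omit_nth (Suc i) \<sigma>) ! k"
      using i k l by (cases "k = Suc i") (auto simp: nth_repeat_nth nth_omit_nth skip_def)
  qed
  then show ?thesis using that i by blast
qed

context transitions
begin

lemma finite_simplex: "\<rho> \<in> K \<Longrightarrow> finite \<rho>"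
  using complex unfolding abstract_complex_def by (meson Sup_upper finite_subset)

lemma simplex_nonempty: "\<rho> \<in> K \<Longrightarrow> card \<rho> = Suc (card \<rho> - 1)"
  using complex finite_simplex[of \<rho>] unfolding abstract_complex_def
  by (metis Suc_pred' card_gt_0_iff diff_Suc_1)

lemma finite_vertices: "finite (\<Union>K)"
  using complex unfolding abstract_complex_def by blast

lemma verts_simplex: "\<rho> \<in> K \<Longrightarrow> verts \<rho> \<in> S (card \<rho> - 1)"
  using verts_props[OF finite_simplex] simplex_nonempty by (simp add: simplices_complex_iff)

abbreviation Ksp :: "('a \<Rightarrow> real) topology" where
  "Ksp \<equiv> complex_space K"

lemma coords_in:
  assumes x: "x \<in> topspace Ksp" and \<rho>: "\<rho> \<in> K" "supp x \<subseteq> \<rho>"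
  shows "coords \<rho> x \<in> standard_simplex (card \<rho> - 1)"
proof (rule standard_simplexI)
  note V = verts_props[OF finite_simplex[OF \<rho>(1)]] and card = simplex_nonempty[OF \<rho>(1)]
  show "0 \<le> coords \<rho> x i" for i using x by (simp add: coords_def topspace_complex_space)
  show "coords \<rho> x i = 0" if "i > card \<rho> - 1" for i using that card by (simp add: coords_def)
  have "(\<Sum>i\<le>card \<rho> - 1. coords \<rho> x i) = (\<Sum>i<card \<rho>. x (verts \<rho> ! i))"
    using card by (intro sum.cong) (auto simp: coords_def)
  also have "\<dots> = (\<Sum>a\<in>\<rho>. x a)"
  proof (rule sum.reindex_bij_betw)
    show "bij_betw ((!) (verts \<rho>)) {..<card \<rho>} \<rho>" using V by (intro bij_betw_nth) auto
  qed
  also have "\<dots> = (\<Sum>a\<in>\<Union>K. x a)"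
    using \<rho> finite_vertices by (intro sum.mono_neutral_left) (auto simp: supp_def)
  finally show "(\<Sum>i\<le>card \<rho> - 1. coords \<rho> x i) = 1" using x by (simp add: topspace_complex_space)
qed

lemma barycentric_coords:
  assumes \<rho>: "\<rho> \<in> K" "supp x \<subseteq> \<rho>"
  shows "barycentric (verts \<rho>) (coords \<rho> x) = x"
proof
  fix a
  note V = verts_props[OF finite_simplex[OF \<rho>(1)]]
  show "barycentric (verts \<rho>) (coords \<rho> x) a = x a"
  proof (cases "a \<in> \<rho>")
    case True
    note j = index_in[OF finite_simplex[OF \<rho>(1)] True]
    have "{i. i < length (verts \<rho>) \<and> verts \<rho> ! i = a} = {index_in \<rho> a}"
    proof (intro equalityI subsetI)
      fix i assume "i \<in> {i. i < length (verts \<rho>) \<and> verts \<rho> ! i = a}"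
      then show "i \<in> {index_in \<rho> a}"
        using index_in_eq[OF finite_simplex[OF \<rho>(1)], of i a] V(1) by simp
    qed (simp add: j V(1))
    then show ?thesis using j by (simp add: barycentric_def coords_def)
  next
    case False
    then have "{i. i < length (verts \<rho>) \<and> verts \<rho> ! i = a} = {}" using V(2) nth_mem by blast
    moreover have "x a = 0" using False \<rho>(2) by (auto simp: supp_def)
    ultimately show ?thesis unfolding barycentric_def by (simp only: sum.empty)
  qed
qed

lemma coords_barycentric:
  assumes \<rho>: "\<rho> \<in> K" and t: "t \<in> standard_simplex (card \<rho> - 1)"
  shows "coords \<rho> (barycentric (verts \<rho>) t) = t"
proof
  fix i
  note V = verts_props[OF finite_simplex[OF \<rho>]] and card = simplex_nonempty[OF \<rho>]
  show "coords \<rho> (barycentric (verts \<rho>) t) i = t i"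
  proof (cases "i < card \<rho>")
    case True
    then have "{k. k < length (verts \<rho>) \<and> verts \<rho> ! k = verts \<rho> ! i} = {i}"
      using V(1) nth_eq_iff_index_eq[OF V(3)] by auto
    then show ?thesis using True by (simp add: barycentric_def coords_def)
  next
    case False
    then have "i > card \<rho> - 1" using card by linarith
    then show ?thesis using False standard_simplexD(3)[OF t, of i] by (simp add: coords_def)
  qed
qed

end

section \<open>The associated bundle\<close>

lemma (in group) mult_inv_mult:
  assumes "c \<in> carrier G" "w \<in> carrier G" "g \<in> carrier G"
  shows "w \<otimes> (inv (c \<otimes> w) \<otimes> g) = inv c \<otimes> g"
  using assms m_assoc[of w "inv w" "inv c \<otimes> g"] by (simp add: inv_mult_group m_assoc)

context transitions
begin

definition fclass :: "(nat \<times> 'a list) \<times> (nat \<Rightarrow> real) \<times> 'g \<Rightarrow> ((nat \<times> 'a list) \<times> (nat \<Rightarrow> real) \<times> 'g) set" where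
  "fclass = qclass (assoc_cells T (complex_sset K)) (assoc_rel G (complex_sset K) v)"

abbreviation F :: "(((nat \<times> 'a list) \<times> (nat \<Rightarrow> real) \<times> 'g) set, 'a \<Rightarrow> real, 'g) g_bundle" where
  "F \<equiv> complex_bundle G T K v"

lemma tot_space_F: "tot_space F = quot_space (assoc_cells T (complex_sset K)) (assoc_rel G (complex_sset K) v)"
  by (simp add: complex_bundle_def assoc_bundle_def Let_def)

lemma assoc_cells_iff:
  "((p, \<sigma>), t, g) \<in> topspace (assoc_cells T (complex_sset K)) \<longleftrightarrow>
     \<sigma> \<in> S p \<and> t \<in> standard_simplex p \<and> g \<in> carrier G"
  by (auto simp: assoc_cells_def topspace_T)

lemma fclass_in:
  "\<sigma> \<in> S p \<Longrightarrow> t \<in> standard_simplex p \<Longrightarrow> g \<in> carrier G \<Longrightarrow> fclass ((p, \<sigma>), t, g) \<in> topspace (tot_space F)"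
  unfolding tot_space_F fclass_def by (intro qclass_in_quot_space) (simp add: assoc_cells_iff)

lemma F_cases:
  assumes "u \<in> topspace (tot_space F)"
  obtains p \<sigma> t g where "u = fclass ((p, \<sigma>), t, g)" "\<sigma> \<in> S p" "t \<in> standard_simplex p" "g \<in> carrier G"
  using assms unfolding tot_space_F topspace_quot_space fclass_def
  by (auto simp: assoc_cells_iff)

lemma fclass_face:
  assumes "\<sigma> \<in> S (Suc p)" "i \<le> Suc p" "t \<in> standard_simplex p" "g \<in> carrier G"
  shows "fclass ((p, omit_nth i \<sigma>), t, g)
    = fclass ((Suc p, \<sigma>), simplical_face i t, (if i = Suc p then v \<sigma> t else \<one>) \<otimes> g)"
  unfolding fclass_def
proof (rule qclass_eqI)
  show "assoc_rel G (complex_sset K) v ((p, omit_nth i \<sigma>), t, g)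
      ((Suc p, \<sigma>), simplical_face i t, (if i = Suc p then v \<sigma> t else \<one>) \<otimes> g)"
    using assoc_rel.intros(1)[OF assms(1-3), of g G v] assms(4) by simp
qed (use assms v_carrier in \<open>auto simp: assoc_cells_iff S_face simplical_face_in\<close>)

lemma fclass_degen:
  assumes "\<sigma> \<in> S p" "i \<le> p" "t \<in> standard_simplex (Suc p)" "g \<in> carrier G"
  shows "fclass ((Suc p, repeat_nth i \<sigma>), t, g) = fclass ((p, \<sigma>), codegen i t, g)"
  unfolding fclass_def
proof (rule qclass_eqI)
  show "assoc_rel G (complex_sset K) v ((Suc p, repeat_nth i \<sigma>), t, g) ((p, \<sigma>), codegen i t, g)"
    using assoc_rel.intros(2)[OF assms(1-3), of g G v] assms(4) by simp
qed (use assms in \<open>auto simp: assoc_cells_iff S_degen codegen_in\<close>)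

lemma qlift_fclass:
  assumes "\<sigma> \<in> S p" "t \<in> standard_simplex p" "g \<in> carrier G"
    and "\<And>a b. assoc_rel G (complex_sset K) v a b \<Longrightarrow> f a = f b"
  shows "qlift f (fclass ((p, \<sigma>), t, g)) = f ((p, \<sigma>), t, g)"
  unfolding fclass_def by (rule qlift_qclass) (use assms in \<open>simp_all add: assoc_cells_iff\<close>)

lemma proj_F:
  assumes "\<sigma> \<in> S p" "t \<in> standard_simplex p" "g \<in> carrier G"
  shows "proj F (fclass ((p, \<sigma>), t, g)) = barycentric \<sigma> t"
proof -
  let ?f = "\<lambda>((p, \<sigma>), t, g :: 'g). sreal_class (complex_sset K) ((p, \<sigma>), t)"
  have "?f a = ?f b" if "assoc_rel G (complex_sset K) v a b" for a b
    using that
  proof cases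
    case (1 \<sigma> p i t g)
    have "sreal_class (complex_sset K) ((p, face (complex_sset K) i \<sigma>), t)
       = sreal_class (complex_sset K) ((Suc p, \<sigma>), simplical_face i t)"
      unfolding sreal_class_def
      by (rule qclass_eqI, simp_all only: sreal_rel.intros(1)[OF 1(3-5)])
        (use 1 in \<open>simp_all add: sreal_cells_iff S_face simplical_face_in\<close>)
    then show ?thesis by (simp add: 1)
  next
    case (2 \<sigma> p i t g)
    have "sreal_class (complex_sset K) ((Suc p, degen (complex_sset K) i \<sigma>), t)
       = sreal_class (complex_sset K) ((p, \<sigma>), codegen i t)"
      unfolding sreal_class_def
      by (rule qclass_eqI, simp_all only: sreal_rel.intros(2)[OF 2(3-5)])
        (use 2 in \<open>simp_all add: sreal_cells_iff S_degen codegen_in\<close>)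
    then show ?thesis by (simp add: 2)
  qed
  then have "qlift ?f (fclass ((p, \<sigma>), t, g)) = ?f ((p, \<sigma>), t, g)"
    by (intro qlift_fclass assms)
  then show ?thesis
    using sreal_to_complex_class[OF complex assms(1,2)]
    by (simp add: complex_bundle_def assoc_bundle_def Let_def)
qed

lemma act_F:
  assumes "\<sigma> \<in> S p" "t \<in> standard_simplex p" "g \<in> carrier G" "h \<in> carrier G"
  shows "act F (fclass ((p, \<sigma>), t, g)) h = fclass ((p, \<sigma>), t, g \<otimes> h)"
proof -
  let ?f = "\<lambda>((p, \<sigma>), t, g). fclass ((p, \<sigma>), t, g \<otimes> h)"
  have "?f a = ?f b" if "assoc_rel G (complex_sset K) v a b" for a b
    using that
  proof cases
    case (1 \<sigma> p i t g)
    then show ?thesis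
      using fclass_face[of \<sigma> p i t "g \<otimes> h"] assms(4) v_carrier[of \<sigma> p t]
      by (simp add: m_assoc)
  next
    case (2 \<sigma> p i t g)
    then show ?thesis using fclass_degen[of \<sigma> p i t "g \<otimes> h"] assms(4) by simp
  qed
  then have "qlift ?f (fclass ((p, \<sigma>), t, g)) = ?f ((p, \<sigma>), t, g)"
    by (intro qlift_fclass assms(1-3))
  then show ?thesis
    by (simp add: complex_bundle_def assoc_bundle_def Let_def fclass_def)
qed

lemma act_closed_F: "act_closed G F"
  unfolding act_closed_def
proof (intro ballI)
  fix u h assume "u \<in> topspace (tot_space F)" and h: "h \<in> carrier G"
  from this(1) show "act F u h \<in> topspace (tot_space F) \<and> proj F (act F u h) = proj F u"
    by (rule F_cases) (simp add: act_F proj_F fclass_in h)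
qed

lemma proj_F_in: "u \<in> topspace (tot_space F) \<Longrightarrow> proj F u \<in> topspace Ksp"
  by (erule F_cases) (auto simp: proj_F simplices_complex_iff intro: barycentric_in[OF complex])

lemma continuous_map_fclass:
  assumes "\<sigma> \<in> S p"
  shows "continuous_map (prod_topology (simplex_top p) T) (tot_space F) (\<lambda>(t, g). fclass ((p, \<sigma>), t, g))"
proof -
  have "continuous_map (prod_topology (simplex_top p) T) (assoc_cells T (complex_sset K)) (\<lambda>z. ((p, \<sigma>), z))"
    using continuous_map_component_injection[of "(p, \<sigma>)" "{(p, \<sigma>). \<sigma> \<in> S p}" "\<lambda>(p, \<sigma>). prod_topology (simplex_top p) T"]
      assms by (simp add: assoc_cells_def)
  from continuous_map_compose[OF this continuous_map_qclass]
  show ?thesis unfolding tot_space_F fclass_def by (simp add: o_def case_prod_beta')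
qed

lemma continuous_map_from_F:
  assumes "\<And>p \<sigma>. \<sigma> \<in> S p \<Longrightarrow> continuous_map (prod_topology (simplex_top p) T) Z (\<lambda>(t, g). f (fclass ((p, \<sigma>), t, g)))"
  shows "continuous_map (tot_space F) Z f"
  unfolding tot_space_F
proof (rule continuous_compose_quotient_map[OF quotient_map_qclass])
  show "continuous_map (assoc_cells T (complex_sset K)) Z
      (f \<circ> qclass (assoc_cells T (complex_sset K)) (assoc_rel G (complex_sset K) v))"
    unfolding assoc_cells_def continuous_map_sum_topology
    using assms unfolding fclass_def assoc_cells_def by (auto simp: case_prod_beta')
qed

lemma continuous_map_proj_F: "continuous_map (tot_space F) Ksp (proj F)"
proof (rule continuous_map_from_F)
  fix p \<sigma> assume \<sigma>: "\<sigma> \<in> S p"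
  have "continuous_map (prod_topology (simplex_top p) T) euclideanreal (\<lambda>z. fst z i)" for i
    using continuous_map_compose[OF continuous_map_fst continuous_map_simplex_coord] by (simp add: o_def)
  then have "continuous_map (prod_topology (simplex_top p) T) Ksp (\<lambda>z. barycentric \<sigma> (fst z))"
    unfolding continuous_map_into_complex_space
    using \<sigma> by (auto simp: simplices_complex_iff intro!: continuous_map_barycentric_coord barycentric_in[OF complex])
  then show "continuous_map (prod_topology (simplex_top p) T) Ksp (\<lambda>(t, g). proj F (fclass ((p, \<sigma>), t, g)))"
    by (rule continuous_map_eq) (auto simp: proj_F \<sigma> topspace_T)
qed

subsection \<open>The equivariant map to \<open>EG\<close>\<close>

definition coefs :: "nat \<Rightarrow> 'a list \<Rightarrow> (nat \<Rightarrow> real) \<Rightarrow> nat \<Rightarrow> 'g" where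
  "coefs p \<beta> t = (\<lambda>j\<in>{..p}. coef G v \<beta> t j)"

lemma coefs_steps: "\<beta> \<in> S p \<Longrightarrow> t \<in> standard_simplex q \<Longrightarrow> coefs p \<beta> t \<in> steps G p"
  by (auto simp: coefs_def steps_def coef_carrier)

text \<open>This is \<open>coef_face\<close> in the shape in which it matches the face relations of
  the associated bundle and of \<open>EG\<close> against each other: the common factor
  \<open>?w\<close> is absorbed by the group coordinate.\<close>

lemma coefs_face:
  assumes "\<beta> \<in> S (Suc p)" "i \<le> Suc p" "t \<in> standard_simplex p" "g \<in> carrier G"
  shows "omit i (rmul G (Suc p) (coefs (Suc p) \<beta> (simplical_face i t)) ((if i = Suc p then v \<beta> t else \<one>) \<otimes> g))
    = rmul G p (coefs p (omit_nth i \<beta>) t) g" (is "omit i (rmul G _ ?a (?w \<otimes> g)) = _")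
proof (rule steps_eqI[of _ p])
  have w: "?w \<in> carrier G" using v_carrier[OF assms(1,3)] by simp
  have a: "?a \<in> steps G (Suc p)" by (rule coefs_steps[OF assms(1) simplical_face_in[OF assms(3,2)]])
  show "omit i (rmul G (Suc p) ?a (?w \<otimes> g)) \<in> steps G p"
    using a w assms(2,4) by (intro omit_steps rmul_steps) auto
  show "rmul G p (coefs p (omit_nth i \<beta>) t) g \<in> steps G p"
    by (intro rmul_steps coefs_steps[OF S_face[OF assms(1,2)] assms(3)] assms(4))
  fix j assume j: "j \<le> p"
  then have sk: "skip i j \<le> Suc p" by (simp add: skip_def)
  have c: "coef G v \<beta> (simplical_face i t) (skip i j) \<in> carrier G"
    by (rule coef_carrier[OF assms(1) simplical_face_in[OF assms(3,2)]])
  have "coef G v \<beta> (simplical_face i t) (skip i j) \<otimes> (?w \<otimes> g) = coef G v (omit_nth i \<beta>) t j \<otimes> g"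
    unfolding coef_face[OF assms(1-3) j, symmetric] by (rule m_assoc[OF c w assms(4), symmetric])
  then show "omit i (rmul G (Suc p) ?a (?w \<otimes> g)) j = rmul G p (coefs p (omit_nth i \<beta>) t) g j"
    using j sk by (simp add: omit_skip rmul_at coefs_def)
qed

lemma coefs_degen:
  assumes "\<beta> \<in> S p" "i \<le> p" "t \<in> standard_simplex (Suc p)"
  shows "coefs (Suc p) (repeat_nth i \<beta>) t = repeat_at i (coefs p \<beta> (codegen i t))"
proof (rule steps_eqI[of _ "Suc p"])
  show "coefs (Suc p) (repeat_nth i \<beta>) t \<in> steps G (Suc p)"
    using assms by (intro coefs_steps S_degen)
  show "repeat_at i (coefs p \<beta> (codegen i t)) \<in> steps G (Suc p)"
    using assms by (intro repeat_steps coefs_steps codegen_in)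
  fix j assume "j \<le> Suc p"
  then show "coefs (Suc p) (repeat_nth i \<beta>) t j = repeat_at i (coefs p \<beta> (codegen i t)) j"
    using coef_degen[OF assms] assms(2) by (auto simp: coefs_def repeat_at_def merge_def)
qed

definition frame_map :: "((nat \<times> 'a list) \<times> (nat \<Rightarrow> real) \<times> 'g) set \<Rightarrow> 'g EG_point set" where
  "frame_map = qlift (\<lambda>((p, \<beta>), t, g). EG_class G T (p, t, rmul G p (coefs p \<beta> t) g))"

lemma frame_map_fclass:
  assumes "\<sigma> \<in> S p" "t \<in> standard_simplex p" "g \<in> carrier G"
  shows "frame_map (fclass ((p, \<sigma>), t, g)) = EG_class G T (p, t, rmul G p (coefs p \<sigma> t) g)"
proof -
  let ?f = "\<lambda>((p, \<beta>), t, g). EG_class G T (p, t, rmul G p (coefs p \<beta> t) g)"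
  have "?f a = ?f b" if "assoc_rel G (complex_sset K) v a b" for a b
    using that
  proof cases
    case (1 \<sigma> p i t g)
    let ?w = "if i = Suc p then v \<sigma> t else \<one>"
    have "?w \<otimes> g \<in> carrier G" using 1 v_carrier[of \<sigma> p t] by simp
    then have "rmul G (Suc p) (coefs (Suc p) \<sigma> (simplical_face i t)) (?w \<otimes> g) \<in> steps G (Suc p)"
      by (intro rmul_steps coefs_steps[OF 1(3) simplical_face_in[OF 1(5,4)]])
    from EG_class_face[OF 1(5,4) this] show ?thesis
      using coefs_face[OF 1(3-6)] by (simp add: 1(1,2))
  next
    case (2 \<sigma> p i t g)
    have "rmul G p (coefs p \<sigma> (codegen i t)) g \<in> steps G p"
      by (intro rmul_steps coefs_steps[OF 2(3) codegen_in[OF 2(5,4)]] 2(6))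
    from EG_class_degen[OF 2(5,4) this] show ?thesis
      using coefs_degen[OF 2(3-5)] 2 by (simp add: repeat_rmul)
  qed
  then have "qlift ?f (fclass ((p, \<sigma>), t, g)) = ?f ((p, \<sigma>), t, g)"
    by (intro qlift_fclass assms)
  then show ?thesis by (simp add: frame_map_def)
qed

lemma frame_map_in: "u \<in> topspace (tot_space F) \<Longrightarrow> frame_map u \<in> topspace (EG_space G T)"
  by (erule F_cases) (simp add: frame_map_fclass EG_class_in rmul_steps coefs_steps)

lemma frame_map_act:
  "u \<in> topspace (tot_space F) \<Longrightarrow> h \<in> carrier G \<Longrightarrow> frame_map (act F u h) = EG_act G T (frame_map u) h"
  by (erule F_cases)
    (simp add: frame_map_fclass act_F EG_act_class rmul_steps coefs_steps[of _ _ _ p for p] rmul_rmul)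

lemma continuous_map_frame_map: "continuous_map (tot_space F) (EG_space G T) frame_map"
proof (rule continuous_map_from_F)
  fix p \<sigma> assume \<sigma>: "\<sigma> \<in> S p"
  let ?X = "prod_topology (simplex_top p) T"
  let ?E = "\<lambda>p. prod_topology (simplex_top p) (product_topology (\<lambda>_. T) {..p})"
  have "continuous_map ?X T (\<lambda>z. coef G v \<sigma> (fst z) j \<otimes> snd z)" for j
    using continuous_map_compose[OF continuous_map_fst continuous_map_coef[OF \<sigma>]]
    by (intro continuous_map_mult continuous_map_snd) (simp add: o_def)
  then have "continuous_map ?X T (\<lambda>z. rmul G p (coefs p \<sigma> (fst z)) (snd z) j)" if "j \<le> p" for j
    using that by (simp add: rmul_def coefs_def)
  then have "continuous_map ?X (product_topology (\<lambda>_. T) {..p}) (\<lambda>z. rmul G p (coefs p \<sigma> (fst z)) (snd z))"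
    by (simp add: continuous_map_componentwise image_subset_iff rmul_def)
  then have 1: "continuous_map ?X (?E p) (\<lambda>z. (fst z, rmul G p (coefs p \<sigma> (fst z)) (snd z)))"
    by (simp add: continuous_map_pairwise o_def continuous_map_fst)
  have 2: "continuous_map (?E p) (EG_cells T) (\<lambda>z. (p, z))"
    unfolding EG_cells_def by (rule continuous_map_component_injection) simp
  have 3: "continuous_map (EG_cells T) (EG_space G T) (EG_class G T)"
    unfolding EG_space_def EG_class_def by (rule continuous_map_qclass)
  have "continuous_map ?X (EG_space G T) (\<lambda>z. EG_class G T (p, fst z, rmul G p (coefs p \<sigma> (fst z)) (snd z)))"
    using continuous_map_compose[OF continuous_map_compose[OF 1 2] 3] by (simp add: o_def)
  then show "continuous_map ?X (EG_space G T) (\<lambda>(t, g). frame_map (fclass ((p, \<sigma>), t, g)))"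
    by (rule continuous_map_eq) (auto simp: frame_map_fclass \<sigma> topspace_T)
qed

subsection \<open>Local sections over open stars\<close>

definition frame :: "'a set \<Rightarrow> ('a \<Rightarrow> real) \<Rightarrow> 'g \<Rightarrow> ((nat \<times> 'a list) \<times> (nat \<Rightarrow> real) \<times> 'g) set" where
  "frame \<rho> x g = fclass ((card \<rho> - 1, verts \<rho>), coords \<rho> x, g)"

lemma frame_facts:
  assumes "x \<in> topspace Ksp" "\<rho> \<in> K" "supp x \<subseteq> \<rho>" "g \<in> carrier G"
  shows "frame \<rho> x g \<in> topspace (tot_space F)" "proj F (frame \<rho> x g) = x"
    "h \<in> carrier G \<Longrightarrow> act F (frame \<rho> x g) h = frame \<rho> x (g \<otimes> h)"
  using assms fclass_in[OF verts_simplex coords_in] proj_F[OF verts_simplex coords_in]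
    act_F[OF verts_simplex coords_in] barycentric_coords
  by (auto simp: frame_def)

text \<open>Repeated vertices are removed one at a time. Degeneracy relations carry no transition
  function, so the group coordinate \<open>g\<close> stays the same, and a sequence without
  repetitions is the ordered list of its own vertex set.\<close>

lemma fclass_eq_frame:
  "\<sigma> \<in> S p \<Longrightarrow> t \<in> standard_simplex p \<Longrightarrow> g \<in> carrier G \<Longrightarrow>
     fclass ((p, \<sigma>), t, g) = frame (set \<sigma>) (barycentric \<sigma> t) g"
proof (induction p arbitrary: \<sigma> t)
  case 0
  then have \<sigma>: "length \<sigma> = 1" "set \<sigma> \<in> K" by (auto simp: simplices_complex_iff)
  then have d: "distinct \<sigma>" "sorted \<sigma>" by (cases \<sigma>; auto)+
  then have v: "verts (set \<sigma>) = \<sigma>" and c: "card (set \<sigma>) - 1 = 0"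
    using verts_unique distinct_card[of \<sigma>] \<sigma>(1) by auto
  then show ?case using coords_barycentric[OF \<sigma>(2), of t] 0 by (simp add: frame_def)
next
  case (Suc p)
  then have \<sigma>: "length \<sigma> = Suc (Suc p)" "set \<sigma> \<in> K" "sorted \<sigma>" by (auto simp: simplices_complex_iff)
  show ?case
  proof (cases "distinct \<sigma>")
    case True
    then have v: "verts (set \<sigma>) = \<sigma>" and c: "card (set \<sigma>) - 1 = Suc p"
      using verts_unique distinct_card[of \<sigma>] \<sigma> by auto
    then show ?thesis using coords_barycentric[OF \<sigma>(2), of t] Suc.prems by (simp add: frame_def)
  next
    case False
    obtain i where i: "Suc i < length \<sigma>" "\<sigma> = repeat_nth i (omit_nth (Suc i) \<sigma>)"
      using repeat_of_sorted[OF \<sigma>(3) False] .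
    let ?\<sigma> = "omit_nth (Suc i) \<sigma>"
    have "i \<le> p" using i(1) \<sigma>(1) by simp
    have s: "?\<sigma> \<in> S p" using S_face[OF Suc.prems(1), of "Suc i"] \<open>i \<le> p\<close> by simp
    have l: "length ?\<sigma> = Suc p" using s by (simp add: simplices_complex_iff)
    have "fclass ((Suc p, \<sigma>), t, g) = fclass ((p, ?\<sigma>), codegen i t, g)"
      using fclass_degen[OF s \<open>i \<le> p\<close> Suc.prems(2,3)] i(2) by simp
    also have "\<dots> = frame (set ?\<sigma>) (barycentric ?\<sigma> (codegen i t)) g"
      using Suc.IH[OF s codegen_in[OF Suc.prems(2) \<open>i \<le> p\<close>] Suc.prems(3)] .
    also have "\<dots> = frame (set \<sigma>) (barycentric \<sigma> t) g"
      using barycentric_degen[OF l \<open>i \<le> p\<close>, of t] set_repeat_nth[of i ?\<sigma>] i(2) by simp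
    finally show ?thesis .
  qed
qed

definition star_coef :: "'a set \<Rightarrow> 'a \<Rightarrow> ('a \<Rightarrow> real) \<Rightarrow> 'g" where
  "star_coef \<rho> a x = coef G v (verts \<rho>) (coords \<rho> x) (index_in \<rho> a)"

text \<open>The frame with group coordinate \<open>h\<close> has coordinate
  \<open>star_coef \<otimes> h\<close> in the trivialisation over the star of \<open>a\<close>; the
  point of coordinate \<open>g\<close> is therefore obtained from
  \<open>inv star_coef \<otimes> g\<close>. It is written with the smallest simplex containing
  \<open>x\<close>, which needs no choice but jumps with \<open>x\<close>.\<close>

definition star_section :: "'a \<Rightarrow> ('a \<Rightarrow> real) \<Rightarrow> 'g \<Rightarrow> ((nat \<times> 'a list) \<times> (nat \<Rightarrow> real) \<times> 'g) set" where
  "star_section a x g = frame (supp x) x (inv star_coef (supp x) a x \<otimes> g)"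

lemma star_coef_carrier:
  "x \<in> topspace Ksp \<Longrightarrow> \<rho> \<in> K \<Longrightarrow> supp x \<subseteq> \<rho> \<Longrightarrow> star_coef \<rho> a x \<in> carrier G"
  unfolding star_coef_def by (rule coef_carrier[OF verts_simplex coords_in])

lemma frame_remove:
  assumes x: "x \<in> topspace Ksp" and \<rho>: "\<rho> \<in> K" "supp x \<subseteq> \<rho>" and a: "a \<in> supp x"
    and c: "c \<in> \<rho>" "c \<notin> supp x" and g: "g \<in> carrier G"
  shows "frame (\<rho> - {c}) x (inv star_coef (\<rho> - {c}) a x \<otimes> g) = frame \<rho> x (inv star_coef \<rho> a x \<otimes> g)"
proof -
  let ?\<rho> = "\<rho> - {c}" and ?i = "index_in \<rho> c"
  note fin = finite_simplex[OF \<rho>(1)]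
  have "a \<in> ?\<rho>" using a c \<rho>(2) by auto
  then have r: "?\<rho> \<in> K" "supp x \<subseteq> ?\<rho>" using complex_face[OF complex \<rho>(1), of ?\<rho>] c \<rho>(2) by auto
  obtain p where p: "card \<rho> = Suc (Suc p)" "card ?\<rho> = Suc p"
    using fin c(1) simplex_nonempty[OF r(1)] simplex_nonempty[OF \<rho>(1)] by (metis card_Diff_singleton diff_Suc_1)
  let ?t = "coords ?\<rho> x" and ?V = "verts \<rho>"
  have V: "?V \<in> S (Suc p)" using verts_simplex[OF \<rho>(1)] p by simp
  have t: "?t \<in> standard_simplex p" using coords_in[OF x r] p by simp
  have i: "?i \<le> Suc p" using index_in[OF fin c(1)] p by simp
  let ?w = "if ?i = Suc p then v ?V ?t else \<one>"
  have w: "?w \<in> carrier G" using v_carrier[OF V t] by simp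
  have j: "index_in ?\<rho> a \<le> p" using index_in[of ?\<rho> a] \<open>a \<in> ?\<rho>\<close> fin p by simp
  have x0: "x c = 0" using c by (simp add: supp_def)
  have C: "star_coef \<rho> a x \<otimes> ?w = star_coef ?\<rho> a x"
    unfolding star_coef_def
    using coef_face[OF V i t j] index_in_remove[OF fin c(1), of a] \<open>a \<in> ?\<rho>\<close>
      coords_remove[OF fin c(1), of x, OF x0] verts_remove[OF fin c(1)] by auto
  have cc: "star_coef \<rho> a x \<in> carrier G" "star_coef ?\<rho> a x \<in> carrier G"
    using star_coef_carrier[OF x \<rho>] star_coef_carrier[OF x r] by auto
  have "frame ?\<rho> x (inv star_coef ?\<rho> a x \<otimes> g) = frame \<rho> x (?w \<otimes> (inv star_coef ?\<rho> a x \<otimes> g))"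
    using fclass_face[OF V i t, of "inv star_coef ?\<rho> a x \<otimes> g"] cc g p
      coords_remove[OF fin c(1), of x, OF x0] verts_remove[OF fin c(1)]
    by (simp add: frame_def)
  also have "?w \<otimes> (inv star_coef ?\<rho> a x \<otimes> g) = inv star_coef \<rho> a x \<otimes> g"
    unfolding C[symmetric] by (rule mult_inv_mult[OF cc(1) w g])
  finally show ?thesis .
qed

text \<open>The vertices of \<open>\<rho>\<close> outside the support are removed one by one with
  \<open>frame_remove\<close>. The gain is a formula with a fixed simplex, which is visibly
  continuous on the whole closed face.\<close>

lemma star_section_eq:
  assumes x: "x \<in> topspace Ksp" and a: "a \<in> supp x" and g: "g \<in> carrier G"
    and \<rho>: "\<rho> \<in> K" "supp x \<subseteq> \<rho>"
  shows "star_section a x g = frame \<rho> x (inv star_coef \<rho> a x \<otimes> g)"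
  using \<rho>
proof (induction "card (\<rho> - supp x)" arbitrary: \<rho>)
  case 0
  then have "\<rho> = supp x" using finite_simplex by auto
  then show ?case by (simp add: star_section_def)
next
  case (Suc n)
  then obtain c where c: "c \<in> \<rho>" "c \<notin> supp x" by (metis Diff_eq_empty_iff card.empty nat.distinct(1) subsetI)
  let ?\<rho> = "\<rho> - {c}"
  have r: "?\<rho> \<in> K" "supp x \<subseteq> ?\<rho>" using complex_face[OF complex Suc.prems(1), of ?\<rho>] c Suc.prems(2) a by auto
  have "?\<rho> - supp x = (\<rho> - supp x) - {c}" by auto
  moreover have "c \<in> \<rho> - supp x" using c by simp
  moreover have "finite (\<rho> - supp x)" using finite_simplex[OF Suc.prems(1)] by simp
  ultimately have "n = card (?\<rho> - supp x)" using Suc.hyps(2) by simp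
  from Suc.hyps(1)[OF this r] show ?case
    using frame_remove[OF x Suc.prems a c g] by simp
qed

lemma star_section_facts:
  assumes "x \<in> topspace Ksp" "a \<in> supp x" "g \<in> carrier G"
  shows "star_section a x g \<in> topspace (tot_space F)" "proj F (star_section a x g) = x"
    "h \<in> carrier G \<Longrightarrow> act F (star_section a x g) h = star_section a x (g \<otimes> h)"
proof -
  have s: "supp x \<in> K" using assms(1) by (simp add: topspace_complex_space)
  note c = star_coef_carrier[OF assms(1) s order_refl, of a]
  note f = frame_facts[OF assms(1) s order_refl, of "inv star_coef (supp x) a x \<otimes> g"]
  show "star_section a x g \<in> topspace (tot_space F)" "proj F (star_section a x g) = x"
    "h \<in> carrier G \<Longrightarrow> act F (star_section a x g) h = star_section a x (g \<otimes> h)"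
    using c f assms(3) by (simp_all add: star_section_def m_assoc)
qed

text \<open>Local triviality over the open star of \<open>a\<close>: a point with group coordinate
  \<open>h\<close> in the frame of any simplex has coordinate
  \<open>star_coef \<otimes> h\<close>.\<close>

lemma F_star_section:
  assumes u: "u \<in> topspace (tot_space F)" and a: "a \<in> supp (proj F u)"
  obtains g where "g \<in> carrier G" "u = star_section a (proj F u) g"
proof -
  obtain p \<sigma> t h where *: "u = fclass ((p, \<sigma>), t, h)" "\<sigma> \<in> S p" "t \<in> standard_simplex p" "h \<in> carrier G"
    using F_cases[OF u] .
  let ?x = "barycentric \<sigma> t"
  have x: "proj F u = ?x" "?x \<in> topspace Ksp" using * proj_F proj_F_in[OF u] by auto
  have \<rho>: "set \<sigma> \<in> K" "supp ?x \<subseteq> set \<sigma>" using *(2) supp_barycentric[of \<sigma> t] by (auto simp: simplices_complex_iff)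
  let ?c = "star_coef (set \<sigma>) a ?x"
  have c: "?c \<in> carrier G" using star_coef_carrier[OF x(2) \<rho>] .
  have "star_section a ?x (?c \<otimes> h) = frame (set \<sigma>) ?x (inv ?c \<otimes> (?c \<otimes> h))"
    using star_section_eq[OF x(2) _ _ \<rho>, of a "?c \<otimes> h"] a x(1) c *(4) by simp
  also have "inv ?c \<otimes> (?c \<otimes> h) = h" using c *(4) by (simp flip: m_assoc)
  also have "frame (set \<sigma>) ?x h = u" using fclass_eq_frame[OF *(2-4)] *(1) by simp
  finally show ?thesis using that[of "?c \<otimes> h"] c *(4) x(1) by simp
qed

lemma continuous_map_coords:
  assumes "\<rho> \<in> K"
  shows "continuous_map (subtopology Ksp {x. supp x \<subseteq> \<rho>}) (simplex_top (card \<rho> - 1)) (coords \<rho>)"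
  unfolding continuous_map_into_simplex
proof (intro conjI allI)
  show "continuous_map (subtopology Ksp {x. supp x \<subseteq> \<rho>}) euclideanreal (\<lambda>x. coords \<rho> x i)" for i
    unfolding coords_def using continuous_map_from_subtopology[OF continuous_map_complex_coord]
    by (cases "i < card \<rho>") simp_all
  show "coords \<rho> \<in> topspace (subtopology Ksp {x. supp x \<subseteq> \<rho>}) \<rightarrow> standard_simplex (card \<rho> - 1)"
    using coords_in[OF _ assms] by auto
qed

lemma closedin_face: "closedin Ksp {x \<in> topspace Ksp. supp x \<subseteq> \<rho>}"
proof -
  have "closedin Ksp {x \<in> topspace Ksp. \<forall>a\<in>- \<rho>. x a \<in> {0}}"
  \<comment> \<open>Closedness of an intersection is available for nonempty families only. For the
    full vertex type there is no condition left and the set is the whole space.\<close>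
  proof (cases "\<rho> = UNIV")
    case False
    then have eq: "{x \<in> topspace Ksp. \<forall>a\<in>- \<rho>. x a \<in> {0}} = (\<Inter>a\<in>- \<rho>. {x \<in> topspace Ksp. x a \<in> {0}})" by auto
    show ?thesis unfolding eq using False
      by (intro closedin_INT closedin_continuous_map_preimage[OF continuous_map_complex_coord]) auto
  qed auto
  moreover have "{x \<in> topspace Ksp. \<forall>a\<in>- \<rho>. x a \<in> {0}} = {x \<in> topspace Ksp. supp x \<subseteq> \<rho>}"
    by (auto simp: supp_def)
  ultimately show ?thesis by simp
qed

definition open_star :: "'a \<Rightarrow> ('a \<Rightarrow> real) set" where
  "open_star a = {x \<in> topspace Ksp. x a > 0}"

lemma in_open_star_iff: "x \<in> open_star a \<longleftrightarrow> x \<in> topspace Ksp \<and> a \<in> supp x"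
  unfolding open_star_def supp_def topspace_complex_space by (auto simp: order_less_le)

lemma openin_open_star: "openin Ksp (open_star a)"
proof -
  have "openin Ksp {x \<in> topspace Ksp. x a \<in> {0<..}}"
    by (rule openin_continuous_map_preimage[OF continuous_map_complex_coord]) simp
  then show ?thesis by (simp add: open_star_def)
qed

text \<open>The faces of \<open>K\<close> form a finite closed cover, and on each of them
  \<open>star_section_eq\<close> replaces the varying support by one fixed simplex. Being the same
  function throughout, the pieces agree on overlaps.\<close>

lemma continuous_map_star_section:
  "continuous_map (prod_topology (subtopology Ksp (open_star a)) T) (tot_space F) (\<lambda>(x, g). star_section a x g)"
    (is "continuous_map ?X _ _")
proof (rule pasting_lemma_closed[where I = K and T = "\<lambda>\<rho>. {z \<in> topspace ?X. supp (fst z) \<subseteq> \<rho>}"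
      and f = "\<lambda>\<rho>. \<lambda>(x, g). star_section a x g"])
  show "finite K" using finite_vertices by (meson finite_UnionD)
  fix \<rho> assume \<rho>: "\<rho> \<in> K"
  have fst: "continuous_map ?X Ksp fst"
    using continuous_map_compose[OF continuous_map_fst continuous_map_from_subtopology[OF continuous_map_id]]
    by (simp add: o_def)
  have "closedin ?X {z \<in> topspace ?X. fst z \<in> {x \<in> topspace Ksp. supp x \<subseteq> \<rho>}}"
    by (rule closedin_continuous_map_preimage[OF fst closedin_face])
  moreover have "{z \<in> topspace ?X. fst z \<in> {x \<in> topspace Ksp. supp x \<subseteq> \<rho>}} = {z \<in> topspace ?X. supp (fst z) \<subseteq> \<rho>}"
    by auto
  ultimately show "closedin ?X {z \<in> topspace ?X. supp (fst z) \<subseteq> \<rho>}" by simp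
  let ?Y = "subtopology ?X {z \<in> topspace ?X. supp (fst z) \<subseteq> \<rho>}"
  have Yin: "x \<in> topspace Ksp" "a \<in> supp x" "supp x \<subseteq> \<rho>" "g \<in> carrier G" if "(x, g) \<in> topspace ?Y" for x g
    using that by (auto simp: in_open_star_iff topspace_T)
  have fstY: "continuous_map ?Y (subtopology Ksp {x. supp x \<subseteq> \<rho>}) fst"
    using continuous_map_from_subtopology[OF fst] by (auto simp: continuous_map_in_subtopology)
  have sndY: "continuous_map ?Y T snd"
    by (rule continuous_map_from_subtopology[OF continuous_map_snd])
  have co: "continuous_map ?Y (simplex_top (card \<rho> - 1)) (\<lambda>z. coords \<rho> (fst z))"
    using continuous_map_compose[OF fstY continuous_map_coords[OF \<rho>]] by (simp add: o_def)
  have "continuous_map ?Y T (\<lambda>z. star_coef \<rho> a (fst z))"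
    using continuous_map_compose[OF co continuous_map_coef[OF verts_simplex[OF \<rho>]]]
    by (simp add: o_def star_coef_def)
  then have "continuous_map ?Y T (\<lambda>z. inv star_coef \<rho> a (fst z) \<otimes> snd z)"
    using sndY by (intro continuous_map_mult continuous_map_inverse)
  with co have "continuous_map ?Y (prod_topology (simplex_top (card \<rho> - 1)) T)
      (\<lambda>z. (coords \<rho> (fst z), inv star_coef \<rho> a (fst z) \<otimes> snd z))"
    by (simp add: continuous_map_pairwise o_def)
  from continuous_map_compose[OF this continuous_map_fclass[OF verts_simplex[OF \<rho>]]]
  have "continuous_map ?Y (tot_space F) (\<lambda>z. frame \<rho> (fst z) (inv star_coef \<rho> a (fst z) \<otimes> snd z))"
    by (simp add: o_def frame_def)
  then show "continuous_map ?Y (tot_space F) (\<lambda>(x, g). star_section a x g)"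
  proof (rule continuous_map_eq)
    fix z assume z: "z \<in> topspace ?Y"
    obtain x g where xg: "z = (x, g)" by (cases z)
    note Y = Yin[OF z[unfolded xg]]
    show "frame \<rho> (fst z) (inv star_coef \<rho> a (fst z) \<otimes> snd z) = (\<lambda>(x, g). star_section a x g) z"
      using star_section_eq[OF Y(1,2,4) \<rho> Y(3)] by (simp add: xg)
  qed
next
  fix z assume z: "z \<in> topspace ?X"
  then have "supp (fst z) \<in> K" by (auto simp: topspace_complex_space)
  then show "\<exists>\<rho>. \<rho> \<in> K \<and> z \<in> {z \<in> topspace ?X. supp (fst z) \<subseteq> \<rho>} \<and>
      (\<lambda>(x, g). star_section a x g) z = (\<lambda>(x, g). star_section a x g) z" using z by blast
qed auto

end

section \<open>The classifying map of the bundle\<close>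

context transitions
begin

abbreviation EG :: "'g EG_point set topology" where
  "EG \<equiv> EG_space G T"

text \<open>The map \<open>f\<^sub>0\<close> of the overview. Any point of the fibre over
  \<open>x\<close> would give the same value, by \<open>class_map_proj\<close>; the frame of the
  support with unit coordinate is just a definite one.\<close>

definition class_map :: "('a \<Rightarrow> real) \<Rightarrow> 'g EG_point set set" where
  "class_map x = BG_class G T (frame_map (frame (supp x) x \<one>))"

lemma ex_supp: "x \<in> topspace Ksp \<Longrightarrow> \<exists>a. a \<in> supp x"
  using complex unfolding topspace_complex_space abstract_complex_def by (metis ex_in_conv)

lemma act_F_one: "u \<in> topspace (tot_space F) \<Longrightarrow> act F u \<one> = u"
  by (erule F_cases) (simp add: act_F)

text \<open>Transitivity on fibres: in the trivialisation at any vertex of positive coordinate both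
  points become group elements \<open>g\<close> and \<open>g'\<close>, and
  \<open>inv g \<otimes> g'\<close> carries one to the other.\<close>

lemma F_fibre:
  assumes "u \<in> topspace (tot_space F)" "u' \<in> topspace (tot_space F)" "proj F u = proj F u'"
  obtains h where "h \<in> carrier G" "u' = act F u h"
proof -
  have x: "proj F u \<in> topspace Ksp" using proj_F_in[OF assms(1)] .
  obtain a where a: "a \<in> supp (proj F u)" using ex_supp[OF x] by blast
  obtain g where g: "g \<in> carrier G" "u = star_section a (proj F u) g"
    using F_star_section[OF assms(1) a] .
  obtain g' where g': "g' \<in> carrier G" "u' = star_section a (proj F u) g'"
    using F_star_section[OF assms(2), of a] a unfolding assms(3) by blast
  have "g \<otimes> (inv g \<otimes> g') = g'" using g(1) g'(1) by (simp flip: m_assoc)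
  then have "act F (star_section a (proj F u) g) (inv g \<otimes> g') = star_section a (proj F u) g'"
    using star_section_facts(3)[OF x a g(1), of "inv g \<otimes> g'"] g(1) g'(1) by simp
  then show ?thesis using that[of "inv g \<otimes> g'"] g g' by simp
qed

lemma frame_supp:
  assumes "x \<in> topspace Ksp"
  shows "frame (supp x) x \<one> \<in> topspace (tot_space F)" "proj F (frame (supp x) x \<one>) = x"
  using frame_facts(1,2)[OF assms _ order_refl one_closed] assms by (simp_all add: topspace_complex_space)

lemma class_map_proj:
  assumes "u \<in> topspace (tot_space F)"
  shows "class_map (proj F u) = BG_class G T (frame_map u)"
proof -
  note x = proj_F_in[OF assms] and f = frame_supp[OF proj_F_in[OF assms]]
  obtain h where "h \<in> carrier G" "u = act F (frame (supp (proj F u)) (proj F u) \<one>) h"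
    using F_fibre[OF f(1) assms f(2)] .
  then have "frame_map u = EG_act G T (frame_map (frame (supp (proj F u)) (proj F u) \<one>)) h"
    using frame_map_act[OF f(1)] by metis
  then show ?thesis
    unfolding class_map_def
    using BG_class_eq_iff[OF frame_map_in[OF f(1)] frame_map_in[OF assms]] \<open>h \<in> carrier G\<close> by blast
qed

lemma frame_map_inj:
  assumes "u \<in> topspace (tot_space F)" "u' \<in> topspace (tot_space F)"
    and "proj F u = proj F u'" "frame_map u = frame_map u'"
  shows "u = u'"
proof -
  obtain h where h: "h \<in> carrier G" "u' = act F u h" using F_fibre[OF assms(1-3)] .
  have "EG_act G T (frame_map u) h = EG_act G T (frame_map u) \<one>"
    using frame_map_act[OF assms(1) h(1)] h(2) assms(4) EG_act_one[OF frame_map_in[OF assms(1)]] by simp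
  then have "h = \<one>" using EG_act_free[OF frame_map_in[OF assms(1)] h(1)] by simp
  then show ?thesis using h(2) act_F_one[OF assms(1)] by simp
qed

text \<open>\<open>lift_to a x y e\<close> reads off the coordinate of \<open>e\<close> in the trivialisation over the star of
  \<open>a\<close> at the point \<open>x\<close> and transports it to \<open>y\<close>.\<close>

definition lift_to :: "'a \<Rightarrow> ('a \<Rightarrow> real) \<Rightarrow> ('a \<Rightarrow> real) \<Rightarrow> 'g EG_point set \<Rightarrow>
    ((nat \<times> 'a list) \<times> (nat \<Rightarrow> real) \<times> 'g) set" where
  "lift_to a x y e = star_section a y (transl (frame_map (star_section a x \<one>)) e)"

lemma frame_map_star_section:
  assumes "x \<in> topspace Ksp" "a \<in> supp x" "g \<in> carrier G"
  shows "frame_map (star_section a x g) = EG_act G T (frame_map (star_section a x \<one>)) g"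
  using frame_map_act[OF star_section_facts(1)[OF assms(1,2) one_closed] assms(3)]
    star_section_facts(3)[OF assms(1,2) one_closed assms(3)] assms(3) by simp

lemma lift_to_star_section:
  assumes "x \<in> open_star a" "g \<in> carrier G"
  shows "lift_to a x y (frame_map (star_section a x g)) = star_section a y g"
proof -
  have x: "x \<in> topspace Ksp" "a \<in> supp x" using assms(1) by (auto simp: in_open_star_iff)
  have "frame_map (star_section a x \<one>) \<in> topspace EG"
    using frame_map_in star_section_facts(1)[OF x one_closed] by blast
  from transl_act[OF this assms(2)] show ?thesis
    unfolding lift_to_def frame_map_star_section[OF x assms(2)] by simp
qed

lemma class_map_fibre:
  assumes x: "x \<in> open_star a" and e: "e \<in> topspace EG" "class_map x = BG_class G T e"
  obtains g where "g \<in> carrier G" "e = frame_map (star_section a x g)"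
proof -
  have x': "x \<in> topspace Ksp" "a \<in> supp x" using x by (auto simp: in_open_star_iff)
  note s = star_section_facts[OF x' one_closed]
  have "BG_class G T (frame_map (star_section a x \<one>)) = BG_class G T e"
    using class_map_proj[OF s(1)] s(2) e(2) by simp
  then obtain g where g: "g \<in> carrier G" "e = EG_act G T (frame_map (star_section a x \<one>)) g"
    using BG_class_eq_iff[OF frame_map_in[OF s(1)] e(1)] by blast
  show ?thesis
    by (rule that[OF g(1)]) (simp only: g(2) frame_map_star_section[OF x' g(1)])
qed

lemma continuous_map_star_section_one:
  assumes "continuous_map Z Ksp x" "\<And>z. z \<in> topspace Z \<Longrightarrow> x z \<in> open_star a" "continuous_map Z T g"
  shows "continuous_map Z (tot_space F) (\<lambda>z. star_section a (x z) (g z))"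
proof -
  have "continuous_map Z (prod_topology (subtopology Ksp (open_star a)) T) (\<lambda>z. (x z, g z))"
    using assms by (auto simp: continuous_map_pairwise o_def continuous_map_in_subtopology)
  from continuous_map_compose[OF this continuous_map_star_section] show ?thesis by (simp add: o_def)
qed

text \<open>The hypothesis on classes says that \<open>e z\<close> and the image of the unit section
  lie in one orbit, so the coordinate of \<open>e z\<close> is a value of the translation function,
  composed with continuous maps. This is where its continuity enters.\<close>

lemma continuous_map_lift_to:
  assumes x: "continuous_map Z Ksp x" "\<And>z. z \<in> topspace Z \<Longrightarrow> x z \<in> open_star a"
    and y: "continuous_map Z Ksp y" "\<And>z. z \<in> topspace Z \<Longrightarrow> y z \<in> open_star a"
    and e: "continuous_map Z EG e" "\<And>z. z \<in> topspace Z \<Longrightarrow> class_map (x z) = BG_class G T (e z)"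
  shows "continuous_map Z (tot_space F) (\<lambda>z. lift_to a (x z) (y z) (e z))"
  unfolding lift_to_def
proof (rule continuous_map_star_section_one[OF y])
  let ?m = "\<lambda>z. (frame_map (star_section a (x z) \<one>), e z)"
  have "continuous_map Z (tot_space F) (\<lambda>z. star_section a (x z) \<one>)"
    by (rule continuous_map_star_section_one[OF x]) (simp_all add: topspace_T)
  then have "continuous_map Z EG (\<lambda>z. frame_map (star_section a (x z) \<one>))"
    using continuous_map_compose[OF _ continuous_map_frame_map] by (fastforce simp: o_def)
  then have "continuous_map Z (prod_topology EG EG) ?m"
    using e(1) by (simp add: continuous_map_pairwise o_def)
  moreover have "?m z \<in> same_orbit" if z: "z \<in> topspace Z" for z
  proof -
    have "e z \<in> topspace EG" using e(1) z by (auto simp: continuous_map_def)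
    then obtain g where "g \<in> carrier G" "e z = frame_map (star_section a (x z) g)"
      using class_map_fibre[OF x(2)[OF z] _ e(2)[OF z]] by blast
    then show ?thesis
      using frame_map_star_section[of "x z" a g] x(2)[OF z] by (auto simp: same_orbit_def in_open_star_iff)
  qed
  ultimately have "continuous_map Z (subtopology (prod_topology EG EG) same_orbit) ?m"
    by (auto simp: continuous_map_in_subtopology)
  from continuous_map_compose[OF this continuous_map_transl]
  show "continuous_map Z T (\<lambda>z. transl (frame_map (star_section a (x z) \<one>)) (e z))"
    by (simp add: o_def)
qed

text \<open>Over the star of \<open>a\<close> the map factors through the continuous unit section of
  \<open>F\<close> there, followed by the map to \<open>EG\<close> and the orbit projection.\<close>

lemma continuous_map_class_map: "continuous_map Ksp (BG_space G T) class_map"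
proof (rule pasting_lemma[where I = UNIV and T = open_star and f = "\<lambda>_. class_map"])
  fix a
  show "openin Ksp (open_star a)" by (rule openin_open_star)
  let ?Z = "subtopology Ksp (open_star a)"
  have "continuous_map ?Z (tot_space F) (\<lambda>x. star_section a x \<one>)"
    by (rule continuous_map_star_section_one) (auto simp: topspace_T continuous_map_from_subtopology)
  from continuous_map_compose[OF continuous_map_compose[OF this continuous_map_frame_map]
      continuous_map_qclass[of EG "BG_rel G T"]]
  have "continuous_map ?Z (BG_space G T) (\<lambda>x. BG_class G T (frame_map (star_section a x \<one>)))"
    by (simp add: o_def BG_space_def BG_class_def)
  then show "continuous_map ?Z (BG_space G T) class_map"
  proof (rule continuous_map_eq)
    fix x assume "x \<in> topspace ?Z"
    then have x: "x \<in> topspace Ksp" "a \<in> supp x" by (auto simp: in_open_star_iff)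
    show "BG_class G T (frame_map (star_section a x \<one>)) = class_map x"
      using class_map_proj[OF star_section_facts(1)[OF x one_closed]] star_section_facts(2)[OF x one_closed] by simp
  qed
qed (use ex_supp in \<open>auto simp: in_open_star_iff\<close>)

text \<open>Bijectivity on fibres follows from transitivity on the side of \<open>F\<close> and
  freeness on the side of \<open>EG\<close>. Continuity of the inverse is local on the base and over
  each star is that of \<open>lift_to\<close>.\<close>

lemma F_isomorphic_pullback:
  "bundle_isomorphic G F (pullback_bundle Ksp class_map (EG_bundle G T))"
proof -
  let ?P = "pullback_bundle Ksp class_map (EG_bundle G T)"
  let ?h = "\<lambda>u. (proj F u, frame_map u)"
  \<comment> \<open>The vertex is picked arbitrarily and not continuously in \<open>x\<close>. By
    \<open>lift_eq\<close> the result does not depend on it, so near a given point \<open>k\<close>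
    may be read with a constant vertex.\<close>
  define k where "k = (\<lambda>(x, e). lift_to (SOME a. a \<in> supp x) x x e)"
  have P: "(x, e) \<in> topspace (tot_space ?P) \<longleftrightarrow> x \<in> topspace Ksp \<and> e \<in> topspace EG \<and> class_map x = BG_class G T e" for x e
    by (simp add: topspace_pullback EG_bundle_def)
  have lift: "lift_to a x x e \<in> topspace (tot_space F) \<and> ?h (lift_to a x x e) = (x, e)"
    if xe: "(x, e) \<in> topspace (tot_space ?P)" and a: "a \<in> supp x" for x e a
  proof -
    have x: "x \<in> topspace Ksp" "x \<in> open_star a" using xe a P in_open_star_iff by auto
    obtain g where g: "g \<in> carrier G" "e = frame_map (star_section a x g)"
      using class_map_fibre[OF x(2)] xe P by blast
    then show ?thesis
      using lift_to_star_section[OF x(2) g(1)] star_section_facts(1,2)[OF x(1) a g(1)] by simp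
  qed
  have h_in: "?h u \<in> topspace (tot_space ?P)" if "u \<in> topspace (tot_space F)" for u
    using that P proj_F_in frame_map_in class_map_proj by simp
  have lift_eq: "lift_to a x x e = lift_to b x x e"
    if "(x, e) \<in> topspace (tot_space ?P)" "a \<in> supp x" "b \<in> supp x" for x e a b
    using lift[OF that(1,2)] lift[OF that(1,3)] by (intro frame_map_inj) auto
  have some: "(SOME a. a \<in> supp x) \<in> supp x" if "x \<in> topspace Ksp" for x
    using ex_supp[OF that] by (rule someI_ex)
  have hk: "k (?h u) = u" if u: "u \<in> topspace (tot_space F)" for u
  proof (rule frame_map_inj)
    note l = lift[OF h_in[OF u] some[OF proj_F_in[OF u]]]
    show "k (?h u) \<in> topspace (tot_space F)" "proj F (k (?h u)) = proj F u"
      "frame_map (k (?h u)) = frame_map u" using l by (simp_all add: k_def)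
  qed (rule u)
  have kh: "?h (k z) = z" if "z \<in> topspace (tot_space ?P)" for z
    using that lift some P unfolding k_def by (cases z) auto
  have "continuous_map (tot_space F) (tot_space ?P) ?h"
    unfolding continuous_map_into_pullback
    using continuous_map_proj_F continuous_map_frame_map class_map_proj by (simp add: EG_bundle_def)
  moreover have "continuous_map (tot_space ?P) (tot_space F) k"
  proof (rule pasting_lemma[where I = UNIV and T = "\<lambda>a. {z \<in> topspace (tot_space ?P). fst z \<in> open_star a}"
        and f = "\<lambda>a (x, e). lift_to a x x e"])
    fix a
    let ?U = "{z \<in> topspace (tot_space ?P). fst z \<in> open_star a}"
    show "openin (tot_space ?P) ?U"
      by (rule openin_continuous_map_preimage[OF continuous_map_pullback_fst openin_open_star])
    have "continuous_map (tot_space ?P) EG snd"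
      using continuous_map_pullback_snd[of Ksp class_map "EG_bundle G T"] by (simp add: EG_bundle_def)
    then have "continuous_map (subtopology (tot_space ?P) ?U) (tot_space F) (\<lambda>z. lift_to a (fst z) (fst z) (snd z))"
      using P by (intro continuous_map_lift_to)
        (auto intro: continuous_map_from_subtopology continuous_map_pullback_fst)
    then show "continuous_map (subtopology (tot_space ?P) ?U) (tot_space F) (\<lambda>(x, e). lift_to a x x e)"
      by (simp add: case_prod_beta')
  next
    fix z assume z: "z \<in> topspace (tot_space ?P)"
    obtain x e where xe: "z = (x, e)" by (cases z)
    have "x \<in> topspace Ksp" using z xe P by simp
    then show "\<exists>a. a \<in> UNIV \<and> z \<in> {z \<in> topspace (tot_space ?P). fst z \<in> open_star a} \<and>
        k z = (case z of (x, e) \<Rightarrow> lift_to a x x e)"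
      using some[of x] z xe by (intro exI[of _ "SOME a. a \<in> supp x"]) (simp add: k_def in_open_star_iff)
  next
    fix a b z assume z: "z \<in> topspace (tot_space ?P) \<inter> {z \<in> topspace (tot_space ?P). fst z \<in> open_star a}
      \<inter> {z \<in> topspace (tot_space ?P). fst z \<in> open_star b}"
    then show "(case z of (x, e) \<Rightarrow> lift_to a x x e) = (case z of (x, e) \<Rightarrow> lift_to b x x e)"
      using lift_eq by (cases z) (simp add: in_open_star_iff)
  qed
  ultimately have "isom_over G F ?P ?h k"
    unfolding isom_over_def homeomorphic_maps_def
    using hk kh act_closed_F frame_map_act
    by (auto simp: proj_pullback act_pullback EG_bundle_def act_closed_def)
  then show ?thesis by (auto simp: bundle_isomorphic_iff)
qed

section \<open>Homotopy invariance\<close>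

text \<open>Over \<open>O1\<close> both maps stay in the star of one vertex, so fibres are
  identified by equal coordinates in the trivialisation there. Over \<open>O2\<close> the maps
  coincide and the identity is used. On the overlap the two prescriptions agree, because transport
  from a point to itself preserves every coordinate.\<close>

lemma pullback_F_step:
  fixes Y :: "'y topology"
  assumes h: "continuous_map Y Ksp h" "continuous_map Y Ksp h'"
    and O: "openin Y O1" "openin Y O2" "topspace Y \<subseteq> O1 \<union> O2"
    and star: "\<And>y. y \<in> O1 \<Longrightarrow> h y \<in> open_star a \<and> h' y \<in> open_star a"
    and eq: "\<And>y. y \<in> O2 \<Longrightarrow> h y = h' y"
  shows "bundle_isomorphic G (pullback_bundle Y h F) (pullback_bundle Y h' F)"
proof -
  \<comment> \<open>The two maps are arguments here because the inverse is the same construction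
    with \<open>h\<close> and \<open>h'\<close> exchanged; the facts below are proved for arbitrary
    such pairs and used both ways.\<close>
  define m where "m = (\<lambda>h h' (y, u). (y :: 'y, if y \<in> O1 then lift_to a (h y) (h' y) (frame_map u) else u))"
  have sec: "\<exists>g\<in>carrier G. u = star_section a (h y) g \<and> m h h' (y, u) = (y, star_section a (h' y) g)"
    if "y \<in> O1" "h y \<in> open_star a" "u \<in> topspace (tot_space F)" "h y = proj F u" for h h' y u
  proof -
    have a: "a \<in> supp (proj F u)" using that(2,4) by (simp add: in_open_star_iff)
    obtain g where g: "g \<in> carrier G" "u = star_section a (proj F u) g"
      by (rule F_star_section[OF \<open>u \<in> topspace (tot_space F)\<close> a])
    then have g': "u = star_section a (h y) g" using that(4) by simp
    have "lift_to a (h y) (h' y) (frame_map u) = star_section a (h' y) g"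
      unfolding g' by (rule lift_to_star_section[OF that(2) g(1)])
    then show ?thesis using g(1) g' that(1) by (auto simp: m_def)
  qed
  have cont: "continuous_map (tot_space (pullback_bundle Y h F)) (tot_space (pullback_bundle Y h' F)) (m h h')"
    and inv: "\<And>z. z \<in> topspace (tot_space (pullback_bundle Y h F)) \<Longrightarrow> m h' h (m h h' z) = z"
    and act: "\<And>z g. z \<in> topspace (tot_space (pullback_bundle Y h F)) \<Longrightarrow> g \<in> carrier G \<Longrightarrow>
      m h h' (act (pullback_bundle Y h F) z g) = act (pullback_bundle Y h' F) (m h h' z) g"
    if h: "continuous_map Y Ksp h" "continuous_map Y Ksp h'"
      and star: "\<And>y. y \<in> O1 \<Longrightarrow> h y \<in> open_star a \<and> h' y \<in> open_star a"
      and eq: "\<And>y. y \<in> O2 \<Longrightarrow> h y = h' y" for h h'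
  proof -
    let ?P = "pullback_bundle Y h F"
    have P: "y \<in> topspace Y" "u \<in> topspace (tot_space F)" "h y = proj F u"
      if "(y, u) \<in> topspace (tot_space ?P)" for y u
      using that by (auto simp: topspace_pullback)
    have m_sec: "\<exists>g\<in>carrier G. u = star_section a (h y) g \<and> m h h' (y, u) = (y, star_section a (h' y) g)"
      if yu: "(y, u) \<in> topspace (tot_space ?P)" and y: "y \<in> O1" for y u
      by (rule sec[where h = h and h' = h', OF y star[OF y, THEN conjunct1] P(2,3)[OF yu]])
    have m_id: "m h h' (y, u) = (y, u)" if yu: "(y, u) \<in> topspace (tot_space ?P)" and y: "y \<in> O2" for y u
    proof (cases "y \<in> O1")
      case True
      obtain g where "u = star_section a (h y) g" "m h h' (y, u) = (y, star_section a (h' y) g)"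
        using m_sec[OF yu True] by blast
      then show ?thesis using eq[OF y] by simp
    qed (simp add: m_def)
    have st: "h y \<in> topspace Ksp" "a \<in> supp (h y)" "h' y \<in> topspace Ksp" "a \<in> supp (h' y)" if "y \<in> O1" for y
      using star[OF that] by (auto simp: in_open_star_iff)
    have proj: "h' (fst (m h h' z)) = proj F (snd (m h h' z))" if z: "z \<in> topspace (tot_space ?P)" for z
    proof -
      obtain y u where yu: "z = (y, u)" by (cases z)
      show ?thesis
      proof (cases "y \<in> O1")
        case True
        then obtain g where "g \<in> carrier G" "m h h' (y, u) = (y, star_section a (h' y) g)"
          using m_sec z yu by blast
        then show ?thesis using star_section_facts(2)[OF st(3,4)[OF True]] by (simp add: yu)
      next
        case False
        then have "y \<in> O2" using P(1)[of y u] z yu O(3) by auto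
        then have "h' y = proj F u" using P(3)[of y u] z yu eq[of y] by simp
        then show ?thesis using False by (simp add: yu m_def)
      qed
    qed
    have fst: "continuous_map (tot_space ?P) Y fst" by (rule continuous_map_pullback_fst)
    have "continuous_map (tot_space ?P) (tot_space F) (\<lambda>z. snd (m h h' z))"
    proof (rule pasting_lemma[where I = UNIV
          and T = "\<lambda>b. {z \<in> topspace (tot_space ?P). fst z \<in> (if b then O1 else O2)}"
          and f = "\<lambda>b z. if b then lift_to a (h (fst z)) (h' (fst z)) (frame_map (snd z)) else snd z"])
      fix b :: bool
      let ?U = "{z \<in> topspace (tot_space ?P). fst z \<in> (if b then O1 else O2)}"
      show "openin (tot_space ?P) ?U"
        by (rule openin_continuous_map_preimage[OF fst]) (simp add: O)
      let ?Z = "subtopology (tot_space ?P) ?U"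
      have snd: "continuous_map ?Z (tot_space F) snd"
        by (rule continuous_map_from_subtopology[OF continuous_map_pullback_snd])
      show "continuous_map ?Z (tot_space F)
         (\<lambda>z. if b then lift_to a (h (fst z)) (h' (fst z)) (frame_map (snd z)) else snd z)"
      proof (cases b)
        case True
        have "continuous_map ?Z (tot_space F) (\<lambda>z. lift_to a (h (fst z)) (h' (fst z)) (frame_map (snd z)))"
        proof (rule continuous_map_lift_to)
          show "continuous_map ?Z Ksp (\<lambda>z. h (fst z))" "continuous_map ?Z Ksp (\<lambda>z. h' (fst z))"
            using continuous_map_compose[OF continuous_map_from_subtopology[OF fst] h(1)]
              continuous_map_compose[OF continuous_map_from_subtopology[OF fst] h(2)] by (simp_all add: o_def)
          show "continuous_map ?Z EG (\<lambda>z. frame_map (snd z))"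
            using continuous_map_compose[OF snd continuous_map_frame_map] by (simp add: o_def)
          fix z assume z: "z \<in> topspace ?Z"
          show "h (fst z) \<in> open_star a" "h' (fst z) \<in> open_star a" using z star True by auto
          show "class_map (h (fst z)) = BG_class G T (frame_map (snd z))"
            using P[of "fst z" "snd z"] z class_map_proj by simp
        qed
        then show ?thesis using True by simp
      next
        case False
        then show ?thesis using snd by simp
      qed
    next
      fix b c z assume z: "z \<in> topspace (tot_space ?P) \<inter> {z \<in> topspace (tot_space ?P). fst z \<in> (if b then O1 else O2)}
         \<inter> {z \<in> topspace (tot_space ?P). fst z \<in> (if c then O1 else O2)}"
      obtain y u where yu: "z = (y, u)" by (cases z)
      have "lift_to a (h y) (h' y) (frame_map u) = u" if "y \<in> O1" "y \<in> O2"
        using m_id[of y u] that z yu by (simp add: m_def)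
      then show "(if b then lift_to a (h (fst z)) (h' (fst z)) (frame_map (snd z)) else snd z)
          = (if c then lift_to a (h (fst z)) (h' (fst z)) (frame_map (snd z)) else snd z)"
        using z yu by (cases b; cases c) auto
    next
      fix z assume z: "z \<in> topspace (tot_space ?P)"
      obtain y u where yu: "z = (y, u)" by (cases z)
      have "y \<in> O1 \<or> y \<in> O2" using P(1)[of y u] z yu O(3) by auto
      then show "\<exists>b. b \<in> UNIV \<and> z \<in> {z \<in> topspace (tot_space ?P). fst z \<in> (if b then O1 else O2)} \<and>
          snd (m h h' z) = (if b then lift_to a (h (fst z)) (h' (fst z)) (frame_map (snd z)) else snd z)"
        using z yu by (intro exI[of _ "y \<in> O1"]) (auto simp: m_def)
    qed
    moreover have "(\<lambda>z. fst (m h h' z)) = fst" by (auto simp: m_def)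
    ultimately show "continuous_map (tot_space ?P) (tot_space (pullback_bundle Y h' F)) (m h h')"
      unfolding continuous_map_into_pullback using fst proj by simp
    fix z assume z: "z \<in> topspace (tot_space ?P)"
    obtain y u where yu: "z = (y, u)" by (cases z)
    show "m h' h (m h h' z) = z"
    proof (cases "y \<in> O1")
      case True
      then obtain g where g: "g \<in> carrier G" "u = star_section a (h y) g" "m h h' (y, u) = (y, star_section a (h' y) g)"
        using m_sec z yu by blast
      have "lift_to a (h' y) (h y) (frame_map (star_section a (h' y) g)) = u"
        using lift_to_star_section[of "h' y" a g] star[OF True] g by simp
      then show ?thesis using g True by (simp add: yu m_def)
    qed (simp add: yu m_def)
    fix g assume g: "g \<in> carrier G"
    show "m h h' (act ?P z g) = act (pullback_bundle Y h' F) (m h h' z) g"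
    proof (cases "y \<in> O1")
      case True
      then obtain k where k: "k \<in> carrier G" "u = star_section a (h y) k" "m h h' (y, u) = (y, star_section a (h' y) k)"
        using m_sec z yu by blast
      have "act F u g = star_section a (h y) (k \<otimes> g)"
        using star_section_facts(3)[OF st(1,2)[OF True] k(1) g] k(2) by simp
      then have "m h h' (y, act F u g) = (y, star_section a (h' y) (k \<otimes> g))"
        using lift_to_star_section[of "h y" a "k \<otimes> g"] star[OF True] k(1) g True by (simp add: m_def)
      then show ?thesis
        using k star_section_facts(3)[OF st(3,4)[OF True] k(1) g] by (simp add: yu act_pullback)
    qed (simp add: yu act_pullback m_def)
  qed
  have fst_m: "fst (m h h' z) = fst z" for z by (cases z) (simp add: m_def)
  have "isom_over G (pullback_bundle Y h F) (pullback_bundle Y h' F) (m h h') (m h' h)"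
    unfolding isom_over_def homeomorphic_maps_def
    using cont[OF h star eq] cont[OF h(2,1)] inv[OF h star eq] inv[OF h(2,1)] act[OF h star eq] star eq fst_m
    by (simp add: proj_pullback)
  then show ?thesis by (auto simp: bundle_isomorphic_iff)
qed

end

section \<open>From small homotopies to homotopies over a compact space\<close>

context transitions
begin

text \<open>With \<open>N\<close> vertices the coordinates sum to \<open>1\<close>, whereas
  coordinates all at most \<open>1 / (2 * (N + 1))\<close> would sum to less. The bound is
  \<open>2 * \<epsilon>\<close> for the \<open>\<epsilon>\<close> used below; \<open>N + 1\<close>
  keeps it meaningful for the empty complex.\<close>

lemma large_coordinate:
  assumes "x \<in> topspace Ksp"
  obtains a where "a \<in> \<Union>K" "x a > 2 / (4 * (real (card (\<Union>K)) + 1))"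
proof -
  let ?N = "real (card (\<Union>K))"
  have "\<exists>a\<in>\<Union>K. x a > 2 / (4 * (?N + 1))"
  proof (rule ccontr)
    assume "\<not> ?thesis"
    then have "(\<Sum>a\<in>\<Union>K. x a) \<le> (\<Sum>a\<in>\<Union>K. 2 / (4 * (?N + 1)))" by (intro sum_mono) (meson not_less)
    also have "\<dots> = ?N * (2 / (4 * (?N + 1)))" by simp
    also have "\<dots> < 1" by (simp add: field_simps)
    finally show False using assms by (simp add: topspace_complex_space)
  qed
  then show ?thesis using that by blast
qed

text \<open>If \<open>H\<^sub>s\<close> is uniformly close to \<open>H\<^sub>0\<close>, one moves from \<open>H\<^sub>0\<close> to \<open>H\<^sub>s\<close> in one step per vertex
  \<open>a\<close>, moving only at points where the \<open>a\<close>-th coordinate is bounded away from \<open>0\<close>.\<close>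

lemma pullback_F_close:
  fixes Y :: "'y topology" and H :: "real \<times> 'y \<Rightarrow> 'a \<Rightarrow> real"
  assumes H: "continuous_map (prod_topology (top_of_set {0..1}) Y) Ksp H"
    and s: "s0 \<in> {0..1}" "s \<in> {0..1}"
    and \<epsilon>: "\<epsilon> = 1 / (4 * (real (card (\<Union>K)) + 1))"
    and close: "\<And>r y a. r \<in> {0..1} \<Longrightarrow> y \<in> topspace Y \<Longrightarrow> a \<in> \<Union>K \<Longrightarrow>
      \<bar>H (s0 + r * (s - s0), y) a - H (s0, y) a\<bar> < \<epsilon>"
  shows "bundle_isomorphic G (pullback_bundle Y (\<lambda>y. H (s0, y)) F) (pullback_bundle Y (\<lambda>y. H (s, y)) F)"
proof -
  obtain xs where xs: "set xs = \<Union>K" using finite_vertices finite_list by blast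
  \<comment> \<open>The \<open>w a\<close> are unnormalised weights supported where the
    \<open>a\<close>-th coordinate of \<open>H (s0, y)\<close> exceeds
    \<open>2 * \<epsilon>\<close>; by \<open>large_coordinate\<close> some weight is positive at
    every \<open>y\<close>. The normalised partial sums \<open>r k\<close> climb from
    \<open>0\<close> to \<open>1\<close>, so \<open>z k\<close> moves from \<open>H (s0, y)\<close>
    to \<open>H (s, y)\<close>, and its \<open>k\<close>-th step happens only on the support of the
    \<open>k\<close>-th weight.\<close>
  define w where "w = (\<lambda>a y. max 0 (H (s0, y) a - 2 * \<epsilon>))"
  define W where "W = (\<lambda>k y. \<Sum>i<k. w (xs ! i) y)"
  define r where "r = (\<lambda>k y. W k y / W (length xs) y)"
  define z where "z = (\<lambda>k y. H (s0 + r k y * (s - s0), y))"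
  have slice: "continuous_map Y Ksp (\<lambda>y. H (g y, y))"
    if "continuous_map Y euclideanreal g" "\<And>y. y \<in> topspace Y \<Longrightarrow> g y \<in> {0..1}" for g
  proof -
    have "continuous_map Y (prod_topology (top_of_set {0..1}) Y) (\<lambda>y. (g y, y))"
      using that by (auto simp: continuous_map_pairwise o_def continuous_map_in_subtopology)
    from continuous_map_compose[OF this H] show ?thesis by (simp add: o_def)
  qed
  have H0: "continuous_map Y Ksp (\<lambda>y. H (s0, y))" by (rule slice) (use s in auto)
  then have H0a: "continuous_map Y euclideanreal (\<lambda>y. H (s0, y) a)" for a
    by (simp add: continuous_map_into_complex_space)
  have w0: "0 \<le> w a y" for a y by (simp add: w_def)
  have W_cont: "continuous_map Y euclideanreal (W k)" for k
    unfolding W_def w_def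
    by (intro continuous_map_sum continuous_map_real_max continuous_map_diff H0a) auto
  have W_mono: "W k y \<le> W l y" if "k \<le> l" for k l y
    unfolding W_def using w0 that by (intro sum_mono2) auto
  have W_pos: "W (length xs) y > 0" if y: "y \<in> topspace Y" for y
  proof -
    have "H (s0, y) \<in> topspace Ksp" using H0 y by (auto simp: continuous_map_def)
    then obtain a where a: "a \<in> \<Union>K" "H (s0, y) a > 2 * \<epsilon>"
      using large_coordinate unfolding \<epsilon> by (metis times_divide_eq_right mult.right_neutral)
    obtain i where i: "i < length xs" "xs ! i = a" using a(1) xs by (metis in_set_conv_nth)
    have "0 < w a y" using a(2) by (simp add: w_def)
    also have "w a y \<le> W (length xs) y"
      unfolding W_def using i w0 member_le_sum[of i "{..<length xs}" "\<lambda>i. w (xs ! i) y"] by simp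
    finally show ?thesis .
  qed
  have r01: "r k y \<in> {0..1}" if "y \<in> topspace Y" "k \<le> length xs" for k y
    using W_pos[OF that(1)] W_mono[OF that(2), of y] W_mono[of 0 k y]
    by (auto simp: r_def W_def divide_le_eq_1)
  have r_cont: "continuous_map Y euclideanreal (r k)" for k
    unfolding r_def using W_pos by (intro continuous_map_real_divide W_cont) force
  have conv: "s0 + t * (s - s0) \<in> {0..1}" if "t \<in> {0..1}" for t
  proof -
    have "s0 + t * (s - s0) = (1 - t) * s0 + t * s" by (simp add: algebra_simps)
    then show ?thesis using that s convexD_alt[of "{0..1::real}" s0 s t] by simp
  qed
  have z_cont: "continuous_map Y Ksp (z k)" if "k \<le> length xs" for k
    unfolding z_def
  proof (rule slice)
    show "continuous_map Y euclideanreal (\<lambda>y. s0 + r k y * (s - s0))"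
      by (intro continuous_map_add continuous_map_real_mult r_cont) auto
    show "s0 + r k y * (s - s0) \<in> {0..1}" if "y \<in> topspace Y" for y
      by (rule conv[OF r01[OF that \<open>k \<le> length xs\<close>]])
  qed
  have "k \<le> length xs \<Longrightarrow> bundle_isomorphic G (pullback_bundle Y (z 0) F) (pullback_bundle Y (z k) F)" for k
  proof (induction k)
    case 0
    show ?case by (rule bundle_isomorphic_refl)
  next
    case (Suc k)
    let ?a = "xs ! k"
    have a: "?a \<in> \<Union>K" using Suc.prems xs nth_mem[of k xs] by simp
    have "bundle_isomorphic G (pullback_bundle Y (z k) F) (pullback_bundle Y (z (Suc k)) F)"
    proof (rule pullback_F_step[where a = ?a])
      show "continuous_map Y Ksp (z k)" "continuous_map Y Ksp (z (Suc k))"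
        using z_cont Suc.prems by auto
      \<comment> \<open>The gap between the thresholds \<open>\<epsilon>\<close> and
        \<open>2 * \<epsilon>\<close> makes the two open sets cover \<open>Y\<close>. Above
        \<open>\<epsilon>\<close> the coordinate stays positive during the whole motion, since it
        changes by less than \<open>\<epsilon>\<close>. Below \<open>2 * \<epsilon>\<close> the
        weight is zero and the step does not move the point.\<close>
      let ?O1 = "{y \<in> topspace Y. H (s0, y) ?a \<in> {\<epsilon><..}}" and ?O2 = "{y \<in> topspace Y. H (s0, y) ?a \<in> {..<2 * \<epsilon>}}"
      show "openin Y ?O1" "openin Y ?O2"
        by (rule openin_continuous_map_preimage[OF H0a], simp)+
      have "\<epsilon> > 0" by (simp add: \<epsilon>)
      then show "topspace Y \<subseteq> ?O1 \<union> ?O2" by auto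
      show "z k y \<in> open_star ?a \<and> z (Suc k) y \<in> open_star ?a" if y: "y \<in> ?O1" for y
      proof -
        have yY: "y \<in> topspace Y" and e: "H (s0, y) ?a > \<epsilon>" using y by auto
        have "z l y ?a > 0" if "l \<le> length xs" for l
          using close[OF r01[OF yY that] yY a] e by (simp add: z_def)
        moreover have "z l y \<in> topspace Ksp" if "l \<le> length xs" for l
          using z_cont[OF that] yY by (auto simp: continuous_map_def)
        ultimately show ?thesis using Suc.prems by (simp add: open_star_def)
      qed
      show "z k y = z (Suc k) y" if y: "y \<in> ?O2" for y
      proof -
        have "w ?a y = 0" using y by (simp add: w_def)
        then show ?thesis by (simp add: z_def r_def W_def)
      qed
    qed
    then show ?case using Suc bundle_isomorphic_trans Suc_leD by blast
  qed
  from this[of "length xs"]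
  have "bundle_isomorphic G (pullback_bundle Y (z 0) F) (pullback_bundle Y (z (length xs)) F)" by simp
  moreover have "z 0 = (\<lambda>y. H (s0, y))" by (simp add: z_def r_def W_def)
  moreover have "z (length xs) y = H (s, y)" if "y \<in> topspace Y" for y
    using W_pos[OF that] by (simp add: z_def r_def)
  ultimately show ?thesis
    using bundle_isomorphic_trans pullback_bundle_cong[of Y "z (length xs)" "\<lambda>y. H (s, y)"] by fastforce
qed

text \<open>Being isomorphic after pullback is an equivalence relation on the parameters
  \<open>s\<close>. By \<open>pullback_F_close\<close> it is locally constant, provided closeness to
  the map at \<open>s0\<close> is uniform in \<open>y\<close>, and the unit interval is connected.
  Compactness of \<open>Y\<close> supplies the uniformity.\<close>

lemma pullback_F_homotopic:
  fixes Y :: "'y topology"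
  assumes Y: "compact_space Y" and fg: "homotopic_with (\<lambda>_. True) Y Ksp f g"
  shows "bundle_isomorphic G (pullback_bundle Y f F) (pullback_bundle Y g F)"
proof -
  let ?I = "top_of_set {0..1::real}"
  obtain H where H: "continuous_map (prod_topology ?I Y) Ksp H"
    and H0: "\<And>y. H (0, y) = f y" and H1: "\<And>y. H (1, y) = g y"
    using fg unfolding homotopic_with_def by blast
  let ?R = "\<lambda>s s'. bundle_isomorphic G (pullback_bundle Y (\<lambda>y. H (s, y)) F) (pullback_bundle Y (\<lambda>y. H (s', y)) F)"
  have "?R 0 1"
  proof (rule connected_equivalence_relation[where S = "{0..1::real}"])
    show "?R s' s" if "?R s s'" for s s'
      using bundle_isomorphic_sym[OF act_closed_pullback[OF act_closed_F] that] .
    show "?R s s''" if "?R s s'" "?R s' s''" for s s' s''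
      using bundle_isomorphic_trans[OF that] .
    fix s0 :: real assume s0: "s0 \<in> {0..1}"
    define \<epsilon> where "\<epsilon> = 1 / (4 * (real (card (\<Union>K)) + 1))"
    have \<epsilon>: "\<epsilon> > 0" by (simp add: \<epsilon>_def)
    let ?d = "\<lambda>a p. \<bar>H p a - H (s0, snd p) a\<bar>"
    let ?V = "(\<Inter>a\<in>\<Union>K. {p \<in> topspace (prod_topology ?I Y). ?d a p \<in> {..<\<epsilon>}}) \<inter> topspace (prod_topology ?I Y)"
    have "openin (prod_topology ?I Y) {p \<in> topspace (prod_topology ?I Y). ?d a p \<in> {..<\<epsilon>}}" for a
    proof (rule openin_continuous_map_preimage)
      have "continuous_map (prod_topology ?I Y) (prod_topology ?I Y) (\<lambda>p. (s0, snd p))"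
        using s0 by (simp add: continuous_map_pairwise o_def continuous_map_snd)
      from continuous_map_compose[OF this H]
      have "continuous_map (prod_topology ?I Y) euclideanreal (\<lambda>p. H (s0, snd p) a)"
        by (simp add: o_def continuous_map_into_complex_space)
      moreover have "continuous_map (prod_topology ?I Y) euclideanreal (\<lambda>p. H p a)"
        using H by (simp add: continuous_map_into_complex_space)
      ultimately show "continuous_map (prod_topology ?I Y) euclideanreal (?d a)"
        by (intro continuous_map_real_abs continuous_map_diff)
    qed simp
    then have V: "openin (prod_topology ?I Y) ?V"
      by (rule openin_INT[OF finite_vertices])
    \<comment> \<open>The parameters whose entire slice lies in \<open>?V\<close>. The complement is
      the image of a closed set under the projection along \<open>Y\<close>, which is a closed map
      because \<open>Y\<close> is compact (the tube lemma).\<close>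
    define A where "A = {0..1} - fst ` (topspace (prod_topology ?I Y) - ?V)"
    have "closedin ?I (fst ` (topspace (prod_topology ?I Y) - ?V))"
      using closed_map_fst[OF Y, of ?I] V unfolding closed_map_def by blast
    then have A: "openin ?I A" by (auto simp: A_def intro: openin_diff)
    have A_iff: "s \<in> A \<longleftrightarrow> s \<in> {0..1} \<and> (\<forall>y\<in>topspace Y. (s, y) \<in> ?V)" for s
      by (force simp: A_def)
    have "s0 \<in> A" using s0 \<epsilon> by (simp add: A_iff)
    then obtain \<delta> where \<delta>: "\<delta> > 0" "ball s0 \<delta> \<inter> {0..1} \<subseteq> A"
      using A unfolding openin_contains_ball by blast
    have "?R s0 s" if s: "s \<in> ball s0 \<delta> \<inter> {0..1}" for s
    proof (rule pullback_F_close[OF H s0 _ \<epsilon>_def])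
      show "s \<in> {0..1}" using s by simp
      fix r y a assume r: "r \<in> {0..1::real}" and y: "y \<in> topspace Y" and a: "a \<in> \<Union>K"
      have "s0 + r * (s - s0) = (1 - r) * s0 + r * s" by (simp add: algebra_simps)
      \<comment> \<open>Closeness is required at all parameters between \<open>s0\<close> and
        \<open>s\<close>, not only at \<open>s\<close>, so the neighbourhood has to be
        convex.\<close>
      moreover have "convex (ball s0 \<delta> \<inter> {0..1})" by (intro convex_Int) auto
      ultimately have "s0 + r * (s - s0) \<in> ball s0 \<delta> \<inter> {0..1}"
        using convexD_alt[of "ball s0 \<delta> \<inter> {0..1}" s0 s r] s s0 r \<delta>(1) by simp
      then have "(s0 + r * (s - s0), y) \<in> ?V" using \<delta>(2) A_iff y by blast
      then show "\<bar>H (s0 + r * (s - s0), y) a - H (s0, y) a\<bar> < \<epsilon>" using a by auto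
    qed
    moreover have "openin ?I (ball s0 \<delta> \<inter> {0..1})"
      by (metis inf_commute open_ball openin_open_Int)
    ultimately show "\<exists>T. openin ?I T \<and> s0 \<in> T \<and> (\<forall>s\<in>T. ?R s0 s)"
      using s0 \<delta>(1) by (intro exI[of _ "ball s0 \<delta> \<inter> {0..1}"]) auto
  qed auto
  then show ?thesis by (simp add: H0 H1)
qed

end

subsection \<open>The star of the diagonal\<close>

context
  fixes K :: "'a::linorder set set"
  assumes K: "abstract_complex K"
begin

lemma topspace_complex_star:
  "topspace (complex_star_space K) = {(x, y). x \<in> topspace (complex_space K) \<and> y \<in> topspace (complex_space K) \<and>
     (\<exists>\<rho>\<in>K. supp x \<union> supp y \<subseteq> \<rho>)}"
  by (auto simp: complex_star_space_def supp_def)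

lemma continuous_map_star_proj:
  "continuous_map (complex_star_space K) (complex_space K) fst"
  "continuous_map (complex_star_space K) (complex_space K) snd"
  unfolding complex_star_space_def
  by (auto intro: continuous_map_from_subtopology continuous_map_fst continuous_map_snd)

lemma finite_K: "finite K"
  using K unfolding abstract_complex_def by (meson finite_UnionD)

text \<open>A closed simplex is cut out of the cube of all functions from the vertex type to
  \<open>[0, 1]\<close> by closed conditions on coordinates and by one finite sum. The cube is
  compact by Tychonoff even if the vertex type is infinite. A function satisfying the conditions has
  nonempty support inside \<open>\<rho>\<close>, so its support is a simplex.\<close>

lemma compactin_face: "compactin (complex_space K) {x \<in> topspace (complex_space K). supp x \<subseteq> \<rho>}" if \<rho>: "\<rho> \<in> K"
proof -
  have fin: "finite (\<Union>K)" using K by (simp add: abstract_complex_def)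
  let ?P = "powertop_real (UNIV :: 'a set)"
  let ?C = "{x \<in> topspace (complex_space K). supp x \<subseteq> \<rho>}"
  have eq: "?C = (\<Inter>a. {x \<in> topspace ?P. x a \<in> {0..1}}) \<inter> {x \<in> topspace ?P. (\<Sum>a\<in>\<Union>K. x a) \<in> {1}} \<inter>
     (\<Inter>a. {x \<in> topspace ?P. a \<notin> \<rho> \<longrightarrow> x a \<in> {0}})" (is "_ = ?D")
  proof (intro equalityI subsetI)
    fix x assume x: "x \<in> ?C"
    then have *: "\<And>a. 0 \<le> x a" "(\<Sum>a\<in>\<Union>K. x a) = 1" "supp x \<subseteq> \<rho>"
      by (auto simp: topspace_complex_space)
    have "x a \<le> 1" for a
    proof (cases "a \<in> \<rho>")
      case True
      then have "x a \<le> (\<Sum>a\<in>\<Union>K. x a)" using \<rho> fin *(1) by (intro member_le_sum) auto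
      then show ?thesis using *(2) by simp
    next
      case False
      then have "x a = 0" using *(3) by (auto simp: supp_def)
      then show ?thesis by simp
    qed
    then show "x \<in> ?D" using * by (auto simp: supp_def)
  next
    fix x assume x: "x \<in> ?D"
    then have *: "\<And>a. 0 \<le> x a" "(\<Sum>a\<in>\<Union>K. x a) = 1" "supp x \<subseteq> \<rho>"
      by (auto simp: supp_def)
    have "supp x \<noteq> {}"
    proof
      assume "supp x = {}"
      then have "\<And>a. x a = 0" by (auto simp: supp_def)
      then show False using *(2) by simp
    qed
    then have "supp x \<in> K" using complex_face[OF K \<rho> *(3)] by simp
    then show "x \<in> ?C" using * by (simp add: topspace_complex_space)
  qed
  have "closedin ?P {x \<in> topspace ?P. a \<notin> \<rho> \<longrightarrow> x a \<in> {0}}" for a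
  proof (cases "a \<in> \<rho>")
    case True
    then have "{x \<in> topspace ?P. a \<notin> \<rho> \<longrightarrow> x a \<in> {0}} = topspace ?P" by simp
    then show ?thesis by (metis closedin_topspace)
  next
    case False
    then have "{x \<in> topspace ?P. a \<notin> \<rho> \<longrightarrow> x a \<in> {0}} = {x \<in> topspace ?P. x a \<in> {0}}" by simp
    then show ?thesis
      by (simp only:) (rule closedin_continuous_map_preimage[OF continuous_map_product_projection], auto)
  qed
  then have "closedin ?P ?D"
    by (intro closedin_Int closedin_INT closedin_continuous_map_preimage[OF continuous_map_product_projection]
        closedin_continuous_map_preimage[OF continuous_map_sum] continuous_map_product_projection fin) auto
  then have cl: "closedin ?P ?C" by (simp only: eq)
  have "compactin ?P (PiE UNIV (\<lambda>_. {0..1}))" by (simp add: compactin_PiE)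
  moreover have "?C \<subseteq> PiE UNIV (\<lambda>_. {0..1})" unfolding eq by auto
  ultimately have "compactin ?P ?C" using cl by (rule closed_compactin)
  then show ?thesis
    unfolding complex_space_def compactin_subtopology by auto
qed

lemma compact_complex_star: "compact_space (complex_star_space K)"
proof -
  let ?C = "\<lambda>\<rho>. {x \<in> topspace (complex_space K). supp x \<subseteq> \<rho>}"
  have "topspace (complex_star_space K) = (\<Union>\<rho>\<in>K. ?C \<rho> \<times> ?C \<rho>)"
    by (auto simp: topspace_complex_star)
  moreover have "compactin (complex_star_space K) (?C \<rho> \<times> ?C \<rho>)" if "\<rho> \<in> K" for \<rho>
  proof -
    have "compactin (prod_topology (complex_space K) (complex_space K)) (?C \<rho> \<times> ?C \<rho>)"
      using compactin_face[OF that] by (simp add: compactin_Times)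
    then show ?thesis
      unfolding complex_star_space_def compactin_subtopology using that by (auto simp: supp_def)
  qed
  ultimately show ?thesis
    unfolding compact_space_def using finite_K by (auto intro!: compactin_Union)
qed

lemma homotopic_star_proj:
  "homotopic_with (\<lambda>_. True) (complex_star_space K) (complex_space K) fst snd"
proof -
  let ?I = "top_of_set {0..1::real}" and ?Y = "complex_star_space K"
  define H where "H = (\<lambda>(r::real, (x, y)). \<lambda>a::'a. (1 - r) * x a + r * y a)"
  have "continuous_map (prod_topology ?I ?Y) (complex_space K) H"
    unfolding continuous_map_into_complex_space
  proof (intro conjI allI)
    fix a
    have r: "continuous_map (prod_topology ?I ?Y) euclideanreal (\<lambda>p. fst p)"
      using continuous_map_compose[OF continuous_map_fst continuous_map_from_subtopology[OF continuous_map_id]]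
      by (simp add: o_def)
    have "continuous_map (prod_topology ?I ?Y) euclideanreal (\<lambda>p. fst (snd p) a)"
      "continuous_map (prod_topology ?I ?Y) euclideanreal (\<lambda>p. snd (snd p) a)"
      using continuous_map_compose[OF continuous_map_compose[OF continuous_map_snd continuous_map_star_proj(1)] continuous_map_complex_coord]
        continuous_map_compose[OF continuous_map_compose[OF continuous_map_snd continuous_map_star_proj(2)] continuous_map_complex_coord]
      by (simp_all add: o_def)
    then have "continuous_map (prod_topology ?I ?Y) euclideanreal
        (\<lambda>p. (1 - fst p) * fst (snd p) a + fst p * snd (snd p) a)"
      using r by (intro continuous_map_add continuous_map_real_mult continuous_map_diff) auto
    then show "continuous_map (prod_topology ?I ?Y) euclideanreal (\<lambda>p. H p a)"
      by (simp add: H_def case_prod_beta')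
  next
    show "H \<in> topspace (prod_topology ?I ?Y) \<rightarrow> topspace (complex_space K)"
    proof
      fix p assume p: "p \<in> topspace (prod_topology ?I ?Y)"
      then obtain r x y where rxy: "p = (r, (x, y))" "r \<in> {0..1}" "(x, y) \<in> topspace ?Y" by (cases p) auto
      then obtain \<rho> where \<rho>: "\<rho> \<in> K" "supp x \<union> supp y \<subseteq> \<rho>" by (auto simp: topspace_complex_star)
      have xy: "\<And>a. 0 \<le> x a" "(\<Sum>a\<in>\<Union>K. x a) = 1" "\<And>a. 0 \<le> y a" "(\<Sum>a\<in>\<Union>K. y a) = 1"
        using rxy(3) by (auto simp: topspace_complex_star topspace_complex_space)
      have 1: "(\<Sum>a\<in>\<Union>K. H p a) = 1"
        by (simp add: H_def rxy(1) sum.distrib xy flip: sum_distrib_left)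
      have "supp (H p) \<subseteq> \<rho>"
      proof
        fix a assume "a \<in> supp (H p)"
        then have "x a \<noteq> 0 \<or> y a \<noteq> 0" by (auto simp: supp_def H_def rxy(1))
        then show "a \<in> \<rho>" using \<rho>(2) by (auto simp: supp_def)
      qed
      moreover have "supp (H p) \<noteq> {}"
      proof
        assume "supp (H p) = {}"
        then have "\<And>a. H p a = 0" by (auto simp: supp_def)
        then show False using 1 by simp
      qed
      ultimately have "supp (H p) \<in> K" using complex_face[OF K \<rho>(1)] by simp
      moreover have "0 \<le> H p a" for a using xy rxy(2) by (simp add: H_def rxy(1))
      ultimately show "H p \<in> topspace (complex_space K)" using 1 by (simp add: topspace_complex_space)
    qed
  qed
  then show ?thesis
    unfolding homotopic_with_def by (intro exI[of _ H]) (auto simp: H_def)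
qed

end

section \<open>Realization of prismatic sets\<close>

lemma slice_cells_iff:
  "((qs, x), s) \<in> topspace (slice_cells P p) \<longleftrightarrow> length qs = Suc p \<and> x \<in> cells P qs \<and> s \<in> topspace (prism_top qs)"
  by (auto simp: slice_cells_def simp del: topspace_product_topology)

lemma topspace_slice: "topspace (slice P p) = slice_class P p ` topspace (slice_cells P p)"
  by (simp add: slice_def slice_class_def topspace_quot_space)

lemma preal_cells_iff:
  "(p, t, C) \<in> topspace (preal_cells P) \<longleftrightarrow> t \<in> standard_simplex p \<and> C \<in> topspace (slice P p)"
  by (auto simp: preal_cells_def)

definition preal_point :: "'x prismatic \<Rightarrow> nat \<Rightarrow> (nat \<Rightarrow> real) \<Rightarrow> 'x prism_point \<Rightarrow> 'x preal_point set" where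
  "preal_point P p t z = preal_class P (p, t, slice_class P p z)"

lemma preal_cases:
  assumes "X \<in> topspace (preal P)"
  obtains p t qs x s where "X = preal_point P p t ((qs, x), s)" "t \<in> standard_simplex p"
    "((qs, x), s) \<in> topspace (slice_cells P p)"
proof -
  obtain y where y: "X = preal_class P y" "y \<in> topspace (preal_cells P)"
    using assms unfolding preal_def preal_class_def topspace_quot_space by (rule imageE)
  obtain p t C where ptC: "y = (p, t, C)" by (rule prod_cases3)
  have t: "t \<in> standard_simplex p" and C: "C \<in> topspace (slice P p)"
    using y(2) by (simp_all add: ptC preal_cells_iff)
  obtain z where z: "C = slice_class P p z" "z \<in> topspace (slice_cells P p)"
    using C unfolding topspace_slice by (rule imageE)
  obtain qs x s where qxs: "z = ((qs, x), s)" by (metis surj_pair)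
  show ?thesis
    by (rule that[of p t qs x s]) (use y z t in \<open>simp_all add: ptC qxs preal_point_def\<close>)
qed

lemma qlift_slice_class:
  assumes "z \<in> topspace (slice_cells P p)"
    and "\<And>z z'. z \<in> topspace (slice_cells P p) \<Longrightarrow> z' \<in> topspace (slice_cells P p) \<Longrightarrow> slice_rel P z z' \<Longrightarrow> f z = f z'"
  shows "qlift f (slice_class P p z) = f z"
  unfolding slice_class_def by (rule qlift_qclass[OF assms])

text \<open>The base faces need not be known to be cells: a pair in the relation \<^const>\<open>preal_rel\<close> counts
  only if both of its members are points of \<^const>\<open>preal_cells\<close>, and the class of a non-cell is empty.\<close>

lemma qlift_preal_point_gen:
  assumes z: "t \<in> standard_simplex p" "z \<in> topspace (slice_cells P p)"
    and F: "\<And>p t z. t \<in> standard_simplex p \<Longrightarrow> z \<in> topspace (slice_cells P p) \<Longrightarrow> F (p, t, slice_class P p z) = f p t z"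
    and base: "\<And>p t qs k x s. length qs = Suc (Suc p) \<Longrightarrow> k \<le> Suc p \<Longrightarrow> x \<in> cells P qs \<Longrightarrow>
      t \<in> standard_simplex p \<Longrightarrow> s \<in> topspace (prism_top qs) \<Longrightarrow>
      ((omit_nth k qs, base_face P qs k x), omit k s) \<in> topspace (slice_cells P p) \<Longrightarrow>
      f (Suc p) (simplical_face k t) ((qs, x), s) = f p t ((omit_nth k qs, base_face P qs k x), omit k s)"
  shows "qlift F (preal_point P p t z) = f p t z"
proof -
  have inv: "F A = F B" if AB: "A \<in> topspace (preal_cells P)" "B \<in> topspace (preal_cells P)" "preal_rel P A B" for A B
    using AB(3)
  proof cases
    case (1 qs p k x t s)
    let ?z = "((omit_nth k qs, base_face P qs k x), omit k s)"
    have "slice_class P p ?z \<in> topspace (slice P p)" using AB(2) 1 by (simp add: preal_cells_iff)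
    then have z: "?z \<in> topspace (slice_cells P p)"
      unfolding topspace_slice slice_class_def by (rule topspace_if_qclass_in)
    have "((qs, x), s) \<in> topspace (slice_cells P (Suc p))" using 1 by (simp only: slice_cells_iff simp_thms)
    from F[OF simplical_face_in[OF 1(6,4)] this] F[OF 1(6) z] base[OF 1(3-7) z]
    show ?thesis by (simp only: 1(1,2))
  qed
  have "(p, t, slice_class P p z) \<in> topspace (preal_cells P)"
    using z by (simp add: preal_cells_iff topspace_slice)
  from qlift_qclass[where f = F, OF this inv] show ?thesis
    unfolding preal_point_def preal_class_def using F[OF z] by simp
qed

lemma qlift_preal_point:
  assumes z: "t \<in> standard_simplex p" "z \<in> topspace (slice_cells P p)"
    and slice: "\<And>p t z z'. t \<in> standard_simplex p \<Longrightarrow> z \<in> topspace (slice_cells P p) \<Longrightarrow>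
      z' \<in> topspace (slice_cells P p) \<Longrightarrow> slice_rel P z z' \<Longrightarrow> f p t z = f p t z'"
    and base: "\<And>p t qs k x s. length qs = Suc (Suc p) \<Longrightarrow> k \<le> Suc p \<Longrightarrow> x \<in> cells P qs \<Longrightarrow>
      t \<in> standard_simplex p \<Longrightarrow> s \<in> topspace (prism_top qs) \<Longrightarrow>
      ((omit_nth k qs, base_face P qs k x), omit k s) \<in> topspace (slice_cells P p) \<Longrightarrow>
      f (Suc p) (simplical_face k t) ((qs, x), s) = f p t ((omit_nth k qs, base_face P qs k x), omit k s)"
  shows "qlift (\<lambda>(p, t, C). qlift (f p t) C) (preal_point P p t z) = f p t z"
proof (rule qlift_preal_point_gen[OF z])
  show "(\<lambda>(p, t, C). qlift (f p t) C) (p, t, slice_class P p z) = f p t z"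
    if "t \<in> standard_simplex p" "z \<in> topspace (slice_cells P p)" for p t z
    using qlift_slice_class[OF that(2), of "f p t"] slice[OF that(1)] by simp
qed (rule base)

text \<open>The summands are open in the disjoint sum, so a product neighbourhood inside one summand
  is a neighbourhood in the whole product.\<close>

lemma continuous_map_prod_sum_topology:
  assumes "\<And>i. i \<in> I \<Longrightarrow> continuous_map (prod_topology X (Y i)) Z (\<lambda>(x, y). g (x, (i, y)))"
  shows "continuous_map (prod_topology X (sum_topology Y I)) Z g"
  unfolding continuous_map_def
proof (intro conjI allI impI)
  show "g \<in> topspace (prod_topology X (sum_topology Y I)) \<rightarrow> topspace Z"
  proof
    fix z assume "z \<in> topspace (prod_topology X (sum_topology Y I))"
    then obtain x i y where "z = (x, (i, y))" "x \<in> topspace X" "i \<in> I" "y \<in> topspace (Y i)" by auto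
    then show "g z \<in> topspace Z" using assms[of i] by (auto simp: continuous_map_def Pi_iff)
  qed
  fix U assume U: "openin Z U"
  let ?W = "{z \<in> topspace (prod_topology X (sum_topology Y I)). g z \<in> U}"
  have "\<exists>V. openin (prod_topology X (sum_topology Y I)) V \<and> z \<in> V \<and> V \<subseteq> ?W" if zW: "z \<in> ?W" for z
  proof -
    obtain x i y where z: "z = (x, (i, y))" "x \<in> topspace X" "i \<in> I" "y \<in> topspace (Y i)" "g z \<in> U"
      using zW by (cases z rule: prod_cases3) auto
    have "openin (prod_topology X (Y i)) {w \<in> topspace (prod_topology X (Y i)). (\<lambda>(x, y). g (x, (i, y))) w \<in> U}"
      by (rule openin_continuous_map_preimage[OF assms[OF z(3)] U])
    then have "\<exists>A B. openin X A \<and> openin (Y i) B \<and> x \<in> A \<and> y \<in> B \<and>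
        A \<times> B \<subseteq> {w \<in> topspace (prod_topology X (Y i)). (\<lambda>(x, y). g (x, (i, y))) w \<in> U}"
      by (rule openin_prod_topology_alt[THEN iffD1, rule_format]) (use z in auto)
    then obtain A B where AB: "openin X A" "openin (Y i) B" "x \<in> A" "y \<in> B"
      "A \<times> B \<subseteq> {w \<in> topspace (prod_topology X (Y i)). (\<lambda>(x, y). g (x, (i, y))) w \<in> U}" by (elim exE conjE)
    have "openin (sum_topology Y I) (Pair i ` B)"
      using open_map_component_injection[OF z(3), of Y] AB(2) by (simp add: open_map_def)
    then have "openin (prod_topology X (sum_topology Y I)) (A \<times> Pair i ` B)"
      using AB(1) by (simp add: openin_prod_Times_iff)
    moreover have "z \<in> A \<times> Pair i ` B" using AB z by auto
    moreover have "A \<times> Pair i ` B \<subseteq> ?W" using AB(5) z(3) by auto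
    ultimately show ?thesis by blast
  qed
  then show "openin (prod_topology X (sum_topology Y I)) ?W" by (subst openin_subopen) blast
qed

lemma compact_simplex_top: "compact_space (simplex_top p)"
  using compactin_standard_simplex by (simp add: compact_space_subtopology)

lemma Hausdorff_simplex_top: "Hausdorff_space (simplex_top p)"
  by (intro Hausdorff_space_subtopology) (simp add: Hausdorff_space_product_topology)

text \<open>The realization is an iterated quotient in which the inner quotient is multiplied by a
  simplex. Since a simplex is compact Hausdorff, the product with the inner quotient map is again a
  quotient map, so continuity may be checked on the products of simplices.\<close>

lemma continuous_map_from_preal:
  assumes "\<And>p qs x. length qs = Suc p \<Longrightarrow> x \<in> cells P qs \<Longrightarrow>
    continuous_map (prod_topology (simplex_top p) (prism_top qs)) Z (\<lambda>(t, s). h (preal_point P p t ((qs, x), s)))"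
  shows "continuous_map (preal P) Z h"
  unfolding preal_def
proof (rule continuous_compose_quotient_map[OF quotient_map_qclass])
  have "continuous_map (prod_topology (simplex_top p) (slice P p)) Z (\<lambda>y. h (preal_class P (p, y)))" for p
  proof (rule continuous_compose_quotient_map)
    show "quotient_map (prod_topology (simplex_top p) (slice_cells P p)) (prod_topology (simplex_top p) (slice P p))
        (\<lambda>(t, z). (t, slice_class P p z))"
      unfolding slice_def slice_class_def
      by (rule quotient_map_prod_right[OF _ _ quotient_map_qclass])
        (use compact_simplex_top Hausdorff_simplex_top in \<open>auto intro: compact_imp_locally_compact_space\<close>)
    show "continuous_map (prod_topology (simplex_top p) (slice_cells P p)) Z
        ((\<lambda>y. h (preal_class P (p, y))) \<circ> (\<lambda>(t, z). (t, slice_class P p z)))"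
      unfolding slice_cells_def
    proof (rule continuous_map_prod_sum_topology)
      fix i assume "i \<in> {(qs, x). length qs = Suc p \<and> x \<in> cells P qs}"
      then obtain qs x where "i = (qs, x)" "length qs = Suc p" "x \<in> cells P qs" by auto
      then show "continuous_map (prod_topology (simplex_top p) ((\<lambda>(qs, x). prism_top qs) i)) Z
         (\<lambda>(t, s). ((\<lambda>y. h (preal_class P (p, y))) \<circ> (\<lambda>(t, z). (t, slice_class P p z))) (t, i, s))"
        using assms[of qs p x] by (simp add: preal_point_def o_def)
    qed
  qed
  then show "continuous_map (preal_cells P) Z (h \<circ> qclass (preal_cells P) (preal_rel P))"
    unfolding preal_cells_def continuous_map_sum_topology preal_class_def by simp
qed

section \<open>Join coordinates\<close>

text \<open>Recursive form of \<open>join_coords\<close>: the scaled block of the first entry,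
  followed by the join of the rest. It turns statements about block positions into inductions on the
  multi-index.\<close>

fun join_rec :: "nat list \<Rightarrow> (nat \<Rightarrow> real) \<Rightarrow> (nat \<Rightarrow> nat \<Rightarrow> real) \<Rightarrow> nat \<Rightarrow> real" where
  "join_rec [] t s k = 0"
| "join_rec (q # qs) t s k =
    (if k \<le> q then t 0 * s 0 k else join_rec qs (\<lambda>i. t (Suc i)) (\<lambda>i. s (Suc i)) (k - Suc q))"

lemma block_start_0 [simp]: "block_start qs 0 = 0"
  and block_start_Suc [simp]: "block_start (q # qs) (Suc i) = Suc q + block_start qs i"
  by (simp_all add: block_start_def)

lemma join_coords_eq: "join_coords qs t s = join_rec qs t s"
proof (induction qs arbitrary: t s)
  case Nil
  show ?case by (simp add: join_coords_def fun_eq_iff)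
next
  case (Cons q qs)
  show ?case
  proof
    fix k
    have "join_coords (q # qs) t s k = (\<Sum>j\<le>q. if j = k then t 0 * s 0 j else 0) +
      (\<Sum>i<length qs. \<Sum>j\<le>qs ! i. if Suc q + block_start qs i + j = k then t (Suc i) * s (Suc i) j else 0)"
      unfolding join_coords_def length_Cons sum.lessThan_Suc_shift by simp
    also have "(\<Sum>j\<le>q. if j = k then t 0 * s 0 j else 0) = (if k \<le> q then t 0 * s 0 k else 0)" by simp
    also have "(\<Sum>i<length qs. \<Sum>j\<le>qs ! i. if Suc q + block_start qs i + j = k then t (Suc i) * s (Suc i) j else 0)
       = (if k \<le> q then 0 else join_coords qs (\<lambda>i. t (Suc i)) (\<lambda>i. s (Suc i)) (k - Suc q))"
    proof (cases "k \<le> q")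
      case False
      then have "Suc q + block_start qs i + j = k \<longleftrightarrow> block_start qs i + j = k - Suc q" for i j by linarith
      then show ?thesis using False by (simp add: join_coords_def)
    qed (auto intro!: sum.neutral)
    finally show "join_coords (q # qs) t s k = join_rec (q # qs) t s k"
      by (simp add: Cons.IH)
  qed
qed

text \<open>A zero inserted at place \<open>j\<close> of the \<open>i\<close>-th factor remains zero
  after scaling by \<open>t i\<close> and sits at place \<open>block_start qs i + j\<close> of the
  concatenation.\<close>

lemma join_rec_face:
  "i < length qs \<Longrightarrow> j \<le> Suc (qs ! i) \<Longrightarrow>
    join_rec (incr qs i) t (s(i := simplical_face j (s i))) = simplical_face (block_start qs i + j) (join_rec qs t s)"
proof (induction qs arbitrary: i t s)
  case (Cons q qs)
  show ?case
  proof (cases i)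
    case 0
    show ?thesis
    proof
      fix k
      show "join_rec (incr (q # qs) i) t (s(i := simplical_face j (s i))) k
          = simplical_face (block_start (q # qs) i + j) (join_rec (q # qs) t s) k"
        using Cons.prems 0 by (cases k j rule: linorder_cases) (auto simp: simplical_face_def)
    qed
  next
    case (Suc m)
    have sh: "(\<lambda>l. (s(i := simplical_face j (s i))) (Suc l)) = (\<lambda>l. s (Suc l))(m := simplical_face j (s (Suc m)))"
      using Suc by (auto simp: fun_eq_iff)
    have IH: "join_rec (incr qs m) (\<lambda>l. t (Suc l)) (\<lambda>l. (s(i := simplical_face j (s i))) (Suc l))
        = simplical_face (block_start qs m + j) (join_rec qs (\<lambda>l. t (Suc l)) (\<lambda>l. s (Suc l)))"
      unfolding sh by (rule Cons.IH) (use Cons.prems Suc in simp_all)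
    show ?thesis
    proof
      fix k
      show "join_rec (incr (q # qs) i) t (s(i := simplical_face j (s i))) k
          = simplical_face (block_start (q # qs) i + j) (join_rec (q # qs) t s) k"
        using Suc IH by (auto simp: simplical_face_def)
    qed
  qed
qed simp

lemma join_rec_degen:
  "i < length qs \<Longrightarrow> j \<le> qs ! i \<Longrightarrow>
    join_rec qs t (s(i := codegen j (s i))) = codegen (block_start qs i + j) (join_rec (incr qs i) t s)"
proof (induction qs arbitrary: i t s)
  case (Cons q qs)
  show ?case
  proof (cases i)
    case 0
    show ?thesis
    proof
      fix k
      show "join_rec (q # qs) t (s(i := codegen j (s i))) k
          = codegen (block_start (q # qs) i + j) (join_rec (incr (q # qs) i) t s) k"
        using Cons.prems 0 by (cases k j rule: linorder_cases) (auto simp: codegen_def algebra_simps)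
    qed
  next
    case (Suc m)
    have sh: "(\<lambda>l. (s(i := codegen j (s i))) (Suc l)) = (\<lambda>l. s (Suc l))(m := codegen j (s (Suc m)))"
      using Suc by (auto simp: fun_eq_iff)
    have IH: "join_rec qs (\<lambda>l. t (Suc l)) (\<lambda>l. (s(i := codegen j (s i))) (Suc l))
        = codegen (block_start qs m + j) (join_rec (incr qs m) (\<lambda>l. t (Suc l)) (\<lambda>l. s (Suc l)))"
      unfolding sh by (rule Cons.IH) (use Cons.prems Suc in simp_all)
    show ?thesis
    proof
      fix k
      show "join_rec (q # qs) t (s(i := codegen j (s i))) k
          = codegen (block_start (q # qs) i + j) (join_rec (incr (q # qs) i) t s) k"
      proof (cases "k \<le> q")
        case False
        then obtain l where l: "k = Suc q + l" using not_less_eq_eq le_Suc_ex by blast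
        then have "join_rec (q # qs) t (s(i := codegen j (s i))) k
            = codegen (block_start qs m + j) (join_rec (incr qs m) (\<lambda>l. t (Suc l)) (\<lambda>l. s (Suc l))) l"
          using IH by simp
        also have "\<dots> = codegen (block_start (q # qs) i + j) (join_rec (incr (q # qs) i) t s) k"
          by (simp add: codegen_def Suc l)
        finally show ?thesis .
      qed (use Suc in \<open>simp add: codegen_def\<close>)
    qed
  qed
qed simp

text \<open>The iterated coface that inserts \<open>m\<close> zeros at position \<open>Q\<close>;
  \<open>gap_Suc\<close> adds them one at a time from left to right.\<close>

definition gap :: "nat \<Rightarrow> nat \<Rightarrow> (nat \<Rightarrow> real) \<Rightarrow> nat \<Rightarrow> real" where
  "gap Q m y = (\<lambda>l. if l < Q then y l else if l < Q + m then 0 else y (l - m))"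

lemma gap_0: "gap Q 0 y = y"
  and gap_Suc: "simplical_face (Q + m) (gap Q m y) = gap Q (Suc m) y"
  by (auto simp: gap_def simplical_face_def fun_eq_iff)

text \<open>When the \<open>k\<close>-th coordinate of the base simplex is zero, the whole
  \<open>k\<close>-th block is scaled to zero, whatever the point in that factor is. What is left is
  the join of the other blocks with \<open>qs ! k + 1\<close> zeros in between.\<close>

lemma join_rec_omit:
  "k < length qs \<Longrightarrow>
    join_rec qs (simplical_face k t) s = gap (block_start qs k) (Suc (qs ! k)) (join_rec (omit_nth k qs) t (omit k s))"
proof (induction qs arbitrary: k t s)
  case (Cons q qs)
  show ?case
  proof (cases k)
    case 0
    have "(\<lambda>i. simplical_face 0 t (Suc i)) = t" "omit 0 s = (\<lambda>i. s (Suc i))"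
      by (auto simp: simplical_face_def omit_def)
    then show ?thesis
      using 0 by (auto simp: fun_eq_iff gap_def omit_nth_def simplical_face_at)
  next
    case (Suc m)
    have sh: "(\<lambda>i. simplical_face (Suc m) t (Suc i)) = simplical_face m (\<lambda>i. t (Suc i))"
      "(\<lambda>i. omit (Suc m) s (Suc i)) = omit m (\<lambda>i. s (Suc i))"
      "simplical_face (Suc m) t 0 = t 0" "omit (Suc m) s 0 = s 0"
      "omit_nth (Suc m) (q # qs) = q # omit_nth m qs"
      by (auto simp: simplical_face_def omit_def omit_nth_def fun_eq_iff) 
    have IH: "join_rec qs (simplical_face m (\<lambda>i. t (Suc i))) (\<lambda>i. s (Suc i))
       = gap (block_start qs m) (Suc (qs ! m)) (join_rec (omit_nth m qs) (\<lambda>i. t (Suc i)) (omit m (\<lambda>i. s (Suc i))))"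
      using Cons Suc by simp
    show ?thesis
    proof
      fix l
      show "join_rec (q # qs) (simplical_face k t) s l =
        gap (block_start (q # qs) k) (Suc ((q # qs) ! k)) (join_rec (omit_nth k (q # qs)) t (omit k s)) l"
      proof (cases "l \<le> q")
        case False
        then obtain r where r: "l = Suc q + r" using not_less_eq_eq le_Suc_ex by blast
        have "join_rec (q # qs) (simplical_face k t) s l
            = gap (block_start qs m) (Suc (qs ! m)) (join_rec (omit_nth m qs) (\<lambda>i. t (Suc i)) (omit m (\<lambda>i. s (Suc i)))) r"
          using IH by (simp add: r Suc sh)
        also have "\<dots> = gap (Suc q + block_start qs m) (Suc (qs ! m)) (join_rec (q # omit_nth m qs) t (omit k s)) (Suc q + r)"
        proof (cases "r < block_start qs m + Suc (qs ! m)")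
          case False
          then obtain w where w: "r = Suc (qs ! m) + w" using le_Suc_ex[of "Suc (qs ! m)" r] by auto
          have "Suc q + r - Suc (qs ! m) = Suc q + w" "r - Suc (qs ! m) = w" by (simp_all add: w)
          moreover have "join_rec (q # omit_nth m qs) t (omit k s) (Suc q + w)
              = join_rec (omit_nth m qs) (\<lambda>i. t (Suc i)) (omit m (\<lambda>i. s (Suc i))) w" by (simp add: Suc sh)
          ultimately show ?thesis using False by (simp only: gap_def) (simp del: join_rec.simps)
        qed (simp add: gap_def Suc sh)
        finally show ?thesis by (simp add: r Suc sh)
      qed (simp add: gap_def Suc sh)
    qed
  qed
qed simp

lemma total_dim_eq: "qs \<noteq> [] \<Longrightarrow> Suc (total_dim qs) = sum_list qs + length qs"
  by (cases qs) (auto simp: total_dim_def)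

lemma join_rec_beyond: "sum_list qs + length qs \<le> k \<Longrightarrow> join_rec qs t s k = 0"
  by (induction qs arbitrary: k t s) auto

lemma sum_lessThan_add:
  "(\<Sum>k<a + b. f k) = (\<Sum>k<a. f k) + (\<Sum>k<b. f (a + k :: nat) :: real)"
  by (induction b) (auto simp: add.assoc)

text \<open>The weight \<open>F\<close> is general for two uses: constant \<open>1\<close> yields
  the total mass of the join, and the indicator of a vertex yields its barycentric
  coordinates.\<close>

lemma sum_join_rec:
  "(\<Sum>k<sum_list qs + length qs. F k * join_rec qs t s k)
    = (\<Sum>i<length qs. t i * (\<Sum>j\<le>qs ! i. F (block_start qs i + j) * s i j))"
proof (induction qs arbitrary: F t s)
  case (Cons q qs)
  let ?n = "sum_list qs + length qs" and ?t = "\<lambda>i. t (Suc i)" and ?s = "\<lambda>i. s (Suc i)"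
  have "(\<Sum>k<Suc q + ?n. F k * join_rec (q # qs) t s k)
      = (\<Sum>k<Suc q. F k * (t 0 * s 0 k)) + (\<Sum>k<?n. F (Suc q + k) * join_rec qs ?t ?s k)"
    unfolding sum_lessThan_add by (intro arg_cong2[of _ _ _ _ "(+)"] sum.cong) auto
  also have "(\<Sum>k<Suc q. F k * (t 0 * s 0 k)) = t 0 * (\<Sum>j\<le>q. F j * s 0 j)"
    unfolding lessThan_Suc_atMost by (simp add: sum_distrib_left mult_ac)
  also have "(\<Sum>k<?n. F (Suc q + k) * join_rec qs ?t ?s k)
      = (\<Sum>i<length qs. ?t i * (\<Sum>j\<le>qs ! i. F (Suc q + (block_start qs i + j)) * ?s i j))"
    by (rule Cons.IH)
  finally show ?case
    unfolding length_Cons sum.lessThan_Suc_shift by (simp add: add.assoc)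
qed simp

lemma prism_top_at:
  "s \<in> topspace (prism_top qs) \<Longrightarrow> i < length qs \<Longrightarrow> s i \<in> standard_simplex (qs ! i)"
  by (auto simp: PiE_iff)

lemma join_coords_in:
  assumes l: "length qs = Suc p" and t: "t \<in> standard_simplex p" and s: "s \<in> topspace (prism_top qs)"
  shows "join_coords qs t s \<in> standard_simplex (total_dim qs)"
  unfolding join_coords_eq
proof (rule standard_simplexI)
  have ne: "qs \<noteq> []" using l by auto
  show "join_rec qs t s k = 0" if "k > total_dim qs" for k
    using that total_dim_eq[OF ne] by (intro join_rec_beyond) simp
  show "0 \<le> join_rec qs t s k" for k
    unfolding join_coords_eq[symmetric] join_coords_def
    using standard_simplexD(1)[OF t] standard_simplexD(1)[OF prism_top_at[OF s]]
    by (intro sum_nonneg) simp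
  have "(\<Sum>k\<le>total_dim qs. join_rec qs t s k) = (\<Sum>k<sum_list qs + length qs. 1 * join_rec qs t s k)"
    unfolding total_dim_eq[OF ne, symmetric] lessThan_Suc_atMost by simp
  also have "\<dots> = (\<Sum>i<length qs. t i)"
    unfolding sum_join_rec using standard_simplexD(4)[OF prism_top_at[OF s]] by simp
  also have "\<dots> = (\<Sum>i\<le>p. t i)" by (simp add: l lessThan_Suc_atMost)
  finally show "(\<Sum>k\<le>total_dim qs. join_rec qs t s k) = 1" using standard_simplexD(4)[OF t] by simp
qed

fun expand :: "nat list \<Rightarrow> 'a list \<Rightarrow> 'a list" where
  "expand (q # qs) (b # \<beta>) = replicate (Suc q) b @ expand qs \<beta>"
| "expand _ _ = []"

lemma length_expand: "length qs = length \<beta> \<Longrightarrow> length (expand qs \<beta>) = sum_list qs + length qs"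
  by (induction qs \<beta> rule: expand.induct) auto

lemma nth_expand:
  "length qs = length \<beta> \<Longrightarrow> i < length qs \<Longrightarrow> j \<le> qs ! i \<Longrightarrow> expand qs \<beta> ! (block_start qs i + j) = \<beta> ! i"
proof (induction qs \<beta> arbitrary: i rule: expand.induct)
  case (1 q qs b \<beta>)
  show ?case
  proof (cases i)
    case 0
    then show ?thesis using 1 by (simp add: nth_append del: replicate_Suc)
  next
    case (Suc m)
    then show ?thesis using 1 by (simp add: nth_append add.assoc del: replicate_Suc)
  qed
qed auto

lemma repeat_nth_iterate:
  "length xs = i \<Longrightarrow> (repeat_nth i ^^ m) (xs @ b # ys) = xs @ replicate (Suc m) b @ ys"
proof (induction m)
  case (Suc m)
  then have "(repeat_nth i ^^ Suc m) (xs @ b # ys) = repeat_nth i (xs @ b # (replicate m b @ ys))" by simp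
  also have "\<dots> = xs @ b # b # (replicate m b @ ys)" using Suc.prems by (simp add: repeat_nth_def)
  finally show ?case by simp
qed simp

text \<open>The degeneracies are applied from the last vertex downwards. When the
  \<open>i\<close>-th vertex is repeated only later entries have been expanded, so it still stands
  at position \<open>i\<close>.\<close>

lemma repeat_vertices_eq:
  assumes "length \<beta> = length qs"
  shows "repeat_vertices (complex_sset K) qs \<beta> = expand qs \<beta>"
proof -
  let ?f = "\<lambda>i. repeat_nth i ^^ (qs ! i)"
  have "i \<le> length qs \<Longrightarrow> foldr ?f [i..<length qs] \<beta> = take i \<beta> @ expand (drop i qs) (drop i \<beta>)" for i
  proof (induction "length qs - i" arbitrary: i)
    case 0
    then show ?case using assms by simp
  next
    case (Suc n)
    then have i: "i < length qs" "n = length qs - Suc i" "Suc i \<le> length qs" by auto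
    have "foldr ?f [i..<length qs] \<beta> = ?f i (foldr ?f [Suc i..<length qs] \<beta>)"
      using i(1) by (simp add: upt_conv_Cons)
    also have "foldr ?f [Suc i..<length qs] \<beta> = take i \<beta> @ (\<beta> ! i) # expand (drop (Suc i) qs) (drop (Suc i) \<beta>)"
      using Suc.hyps(1)[OF i(2,3)] i(1) assms by (simp add: take_Suc_conv_app_nth)
    also have "?f i \<dots> = take i \<beta> @ replicate (Suc (qs ! i)) (\<beta> ! i) @ expand (drop (Suc i) qs) (drop (Suc i) \<beta>)"
      using i(1) assms by (intro repeat_nth_iterate) simp
    also have "\<dots> = take i \<beta> @ expand (drop i qs) (drop i \<beta>)"
      using i(1) assms Cons_nth_drop_Suc[of i qs] Cons_nth_drop_Suc[of i \<beta>]
      by (metis expand.simps(1))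
    finally show ?case .
  qed
  from this[of 0] show ?thesis by (simp add: repeat_vertices_def)
qed

text \<open>The \<open>i\<close>-th block consists of copies of one vertex and carries the masses
  \<open>t i * s i j\<close>, whose sum over \<open>j\<close> is \<open>t i\<close>. Hence the first
  component of the map to the star does not depend on the prism coordinates.\<close>

lemma barycentric_expand:
  assumes "length \<beta> = length qs" and s: "s \<in> topspace (prism_top qs)"
  shows "barycentric (expand qs \<beta>) (join_coords qs t s) = barycentric \<beta> t"
proof
  fix a
  let ?F = "\<lambda>k. if expand qs \<beta> ! k = a then 1 else (0::real)"
  have bary: "barycentric \<sigma> y a = (\<Sum>k<length \<sigma>. (if \<sigma> ! k = a then 1 else 0) * y k)" for \<sigma> and y :: "nat \<Rightarrow> real"
  proof -
    have "{i. i < length \<sigma> \<and> \<sigma> ! i = a} = {i \<in> {..<length \<sigma>}. \<sigma> ! i = a}" by auto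
    then have "barycentric \<sigma> y a = (\<Sum>k<length \<sigma>. if \<sigma> ! k = a then y k else 0)"
      unfolding barycentric_def by (simp only: sum.inter_filter finite_lessThan)
    also have "\<dots> = (\<Sum>k<length \<sigma>. (if \<sigma> ! k = a then 1 else 0) * y k)" by (intro sum.cong) auto
    finally show ?thesis .
  qed
  have "barycentric (expand qs \<beta>) (join_coords qs t s) a
      = (\<Sum>i<length qs. t i * (\<Sum>j\<le>qs ! i. ?F (block_start qs i + j) * s i j))"
    unfolding bary join_coords_eq using assms(1) by (simp only: length_expand sum_join_rec)
  also have "\<dots> = (\<Sum>i<length qs. t i * (if \<beta> ! i = a then 1 else 0))"
  proof (rule sum.cong)
    fix i assume "i \<in> {..<length qs}"
    then have i: "i < length qs" by simp
    have "(\<Sum>j\<le>qs ! i. ?F (block_start qs i + j) * s i j) = (\<Sum>j\<le>qs ! i. (if \<beta> ! i = a then 1 else 0) * s i j)"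
      using nth_expand[of qs \<beta> i] i assms(1) by (intro sum.cong) auto
    also have "\<dots> = (if \<beta> ! i = a then 1 else 0)"
      using standard_simplexD(4)[OF prism_top_at[OF s i]] by simp
    finally show "t i * (\<Sum>j\<le>qs ! i. ?F (block_start qs i + j) * s i j) = t i * (if \<beta> ! i = a then 1 else 0)" by simp
  qed simp
  finally show "barycentric (expand qs \<beta>) (join_coords qs t s) a = barycentric \<beta> t a"
    unfolding bary using assms(1) by (simp add: mult.commute)
qed

section \<open>The map \<open>\<lambda>\<close>\<close>

lemma set_foldr_omit_nth: "set (foldr omit_nth \<nu> \<sigma>) \<subseteq> set \<sigma>"
  by (induction \<nu>) (use set_omit_nth_subset in fastforce)+

lemma set_fold_repeat_nth: "set (fold repeat_nth \<nu> \<sigma>) = set \<sigma>"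
  by (induction \<nu> arbitrary: \<sigma>) (simp_all add: set_repeat_nth)

text \<open>A strictly increasing list starting at \<open>a\<close> needs room for all its entries
  below \<open>n\<close>. This keeps every index of \<open>collapse\<close> in range; deleting at an
  index beyond the end would leave the length unchanged.\<close>

lemma sorted_wrt_less_bound:
  "sorted_wrt (<) (a # \<nu>) \<Longrightarrow> \<forall>i\<in>set (a # \<nu>). i < n \<Longrightarrow> a + length \<nu> < (n::nat)"
proof (induction \<nu> arbitrary: a)
  case (Cons b \<nu>)
  then have "b + length \<nu> < n" "a < b" by auto
  then show ?case by simp
qed simp

lemma length_foldr_omit_nth:
  "sorted_wrt (<) \<nu> \<Longrightarrow> \<forall>i\<in>set \<nu>. i < n \<Longrightarrow> length \<sigma> = Suc n \<Longrightarrow> length (foldr omit_nth \<nu> \<sigma>) = Suc n - length \<nu>"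
proof (induction \<nu>)
  case (Cons a \<nu>)
  have "a + length \<nu> < n" using sorted_wrt_less_bound Cons.prems(1,2) by blast
  then show ?case using Cons by (simp add: length_omit_nth)
qed simp

lemma length_fold_repeat_nth:
  "sorted_wrt (<) \<nu> \<Longrightarrow> \<forall>i\<in>set \<nu>. i < n \<Longrightarrow> length \<sigma> + length \<nu> = Suc n \<Longrightarrow> length (fold repeat_nth \<nu> \<sigma>) = Suc n"
proof (induction \<nu> arbitrary: \<sigma>)
  case (Cons a \<nu>)
  have "a + length \<nu> < n" using sorted_wrt_less_bound Cons.prems(1,2) by blast
  then have "a < length \<sigma>" using Cons.prems(3) by simp
  then show ?case using Cons by (simp add: length_repeat_nth)
qed simp

lemma collapse_complex:
  assumes "sorted_wrt (<) \<nu>" "\<forall>i\<in>set \<nu>. i < n" "length \<nu> \<le> n" "length \<sigma> = Suc n"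
  shows "length (collapse (complex_sset K) \<nu> \<sigma>) = Suc n" "set (collapse (complex_sset K) \<nu> \<sigma>) \<subseteq> set \<sigma>"
proof -
  have "length (foldr omit_nth \<nu> \<sigma>) + length \<nu> = Suc n"
    using length_foldr_omit_nth[OF assms(1,2,4)] assms(3) by simp
  from length_fold_repeat_nth[OF assms(1,2) this]
  show "length (collapse (complex_sset K) \<nu> \<sigma>) = Suc n" by (simp add: collapse_def)
  show "set (collapse (complex_sset K) \<nu> \<sigma>) \<subseteq> set \<sigma>"
    by (simp add: collapse_def set_fold_repeat_nth set_foldr_omit_nth)
qed

text \<open>For a generator both components are spanned by vertices of the one simplex
  \<open>\<sigma>'\<close>. Faces and degeneracies applied to both components add no vertices, so
  the common simplex persists.\<close>

lemma in_star_complex: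
  assumes "in_star (complex_sset K) n \<sigma> \<tau>"
  shows "length \<sigma> = Suc n \<and> length \<tau> = Suc n \<and> (\<exists>\<rho>\<in>K. set \<sigma> \<union> set \<tau> \<subseteq> \<rho>)"
  using assms
proof induction
  case (generator \<sigma>' n \<mu> \<nu>)
  then have \<sigma>': "length \<sigma>' = Suc n" "set \<sigma>' \<in> K" by (simp_all add: simplices_complex_iff)
  have "length \<nu> \<le> n" "length \<mu> \<le> n" using generator(2) by auto
  note c = collapse_complex[OF generator(3,5) this(1) \<sigma>'(1), of K]
    collapse_complex[OF generator(4,6) this(2) \<sigma>'(1), of K]
  have "set (collapse (complex_sset K) \<nu> \<sigma>') \<union> set (collapse (complex_sset K) \<mu> \<sigma>') \<subseteq> set \<sigma>'"
    using c(2,4) by simp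
  with c(1,3) \<sigma>'(2) show ?case by blast
next
  case (face n \<sigma> \<tau> i)
  have "set (omit_nth i \<sigma>) \<union> set (omit_nth i \<tau>) \<subseteq> set \<sigma> \<union> set \<tau>"
    using set_omit_nth_subset[of i \<sigma>] set_omit_nth_subset[of i \<tau>] by blast
  moreover obtain \<rho> where "\<rho> \<in> K" "set \<sigma> \<union> set \<tau> \<subseteq> \<rho>" using face.IH by blast
  ultimately have "\<exists>\<rho>\<in>K. set (omit_nth i \<sigma>) \<union> set (omit_nth i \<tau>) \<subseteq> \<rho>" by (meson order_trans)
  then show ?case using face by (simp add: length_omit_nth)
next
  case (degen n \<sigma> \<tau> i)
  then show ?case by (simp add: length_repeat_nth set_repeat_nth)
qed

lemma star_cells_iff:
  "((n, \<sigma>, \<tau>), t) \<in> topspace (sreal_cells (star_sset S)) \<longleftrightarrow> in_star S n \<sigma> \<tau> \<and> t \<in> standard_simplex n"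
  by (simp add: sreal_cells_iff star_sset_def)

abbreviation star_class where
  "star_class K \<equiv> sreal_class (star_sset (complex_sset K))"

lemma star_class_face:
  assumes "in_star (complex_sset K) (Suc n) \<sigma> \<tau>" "i \<le> Suc n" "t \<in> standard_simplex n"
  shows "star_class K ((n, omit_nth i \<sigma>, omit_nth i \<tau>), t) = star_class K ((Suc n, \<sigma>, \<tau>), simplical_face i t)"
  unfolding sreal_class_def
proof (rule qclass_eqI)
  show "((n, omit_nth i \<sigma>, omit_nth i \<tau>), t) \<in> topspace (sreal_cells (star_sset (complex_sset K)))"
    using in_star.face[OF assms(1,2)] assms(3) by (simp add: star_cells_iff)
  show "sreal_rel (star_sset (complex_sset K)) ((n, omit_nth i \<sigma>, omit_nth i \<tau>), t) ((Suc n, \<sigma>, \<tau>), simplical_face i t)"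
    using sreal_rel.intros(1)[of "(\<sigma>, \<tau>)" "star_sset (complex_sset K)" n i t] assms by (simp add: star_sset_def)
qed (use assms in \<open>simp add: star_cells_iff simplical_face_in\<close>)

lemma star_class_degen:
  assumes "in_star (complex_sset K) n \<sigma> \<tau>" "i \<le> n" "t \<in> standard_simplex (Suc n)"
  shows "star_class K ((Suc n, repeat_nth i \<sigma>, repeat_nth i \<tau>), t) = star_class K ((n, \<sigma>, \<tau>), codegen i t)"
  unfolding sreal_class_def
proof (rule qclass_eqI)
  show "((Suc n, repeat_nth i \<sigma>, repeat_nth i \<tau>), t) \<in> topspace (sreal_cells (star_sset (complex_sset K)))"
    using in_star.degen[OF assms(1,2)] assms(3) by (simp add: star_cells_iff)
  show "sreal_rel (star_sset (complex_sset K)) ((Suc n, repeat_nth i \<sigma>, repeat_nth i \<tau>), t) ((n, \<sigma>, \<tau>), codegen i t)"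
    using sreal_rel.intros(2)[of "(\<sigma>, \<tau>)" "star_sset (complex_sset K)" n i t] assms by (simp add: star_sset_def)
qed (use assms in \<open>simp add: star_cells_iff codegen_in\<close>)

lemma sreal_star_to_complex_class:
  assumes "in_star (complex_sset K) n \<sigma> \<tau>" "t \<in> standard_simplex n"
  shows "sreal_star_to_complex (star_class K ((n, \<sigma>, \<tau>), t)) = (barycentric \<sigma> t, barycentric \<tau> t)"
proof -
  let ?f = "\<lambda>((n::nat, \<sigma>, \<tau>), t). (barycentric \<sigma> t, barycentric \<tau> t)"
  have "?f a = ?f b" if "sreal_rel (star_sset (complex_sset K)) a b" for a b
    using that
  proof cases
    case (1 \<sigma>\<tau> n i t)
    obtain \<sigma> \<tau> where "\<sigma>\<tau> = (\<sigma>, \<tau>)" by (cases \<sigma>\<tau>)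
    moreover have "length \<sigma> = Suc (Suc n) \<and> length \<tau> = Suc (Suc n)"
      using 1(3) in_star_complex[of K "Suc n" \<sigma> \<tau>] calculation by (simp add: star_sset_def)
    ultimately show ?thesis using 1 by (simp add: star_sset_def barycentric_face)
  next
    case (2 \<sigma>\<tau> n i t)
    obtain \<sigma> \<tau> where "\<sigma>\<tau> = (\<sigma>, \<tau>)" by (cases \<sigma>\<tau>)
    moreover have "length \<sigma> = Suc n \<and> length \<tau> = Suc n"
      using 2(3) in_star_complex[of K n \<sigma> \<tau>] calculation by (simp add: star_sset_def)
    ultimately show ?thesis using 2 by (simp add: star_sset_def barycentric_degen)
  qed
  then have "qlift ?f (star_class K ((n, \<sigma>, \<tau>), t)) = ?f ((n, \<sigma>, \<tau>), t)"
    unfolding sreal_class_def by (intro qlift_qclass) (simp_all add: star_cells_iff assms)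
  then show ?thesis by (simp add: sreal_star_to_complex_def)
qed

text \<open>The fold deletes the largest index first, so the last vertex of the block goes in a
  single face step and the others by induction. On coordinates this inserts the zeros of the gap in
  the opposite order. Membership in the simplex is carried along because each face step requires
  it.\<close>

lemma star_class_iterated_face:
  "in_star (complex_sset K) (n + m) \<sigma> \<tau> \<Longrightarrow> Q \<le> Suc n \<Longrightarrow> y \<in> standard_simplex n \<Longrightarrow>
    star_class K ((n, foldr omit_nth [Q..<Q + m] \<sigma>, foldr omit_nth [Q..<Q + m] \<tau>), y)
      = star_class K ((n + m, \<sigma>, \<tau>), gap Q m y) \<and> gap Q m y \<in> standard_simplex (n + m)"
proof (induction m arbitrary: \<sigma> \<tau>)
  case 0
  then show ?case by (simp add: gap_0)
next
  case (Suc m)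
  have s: "in_star (complex_sset K) (Suc (n + m)) \<sigma> \<tau>" and Q: "Q + m \<le> Suc (n + m)" using Suc.prems by auto
  have "in_star (complex_sset K) (n + m) (omit_nth (Q + m) \<sigma>) (omit_nth (Q + m) \<tau>)"
    using in_star.face[OF s Q] by simp
  note IH = Suc.IH[OF this Suc.prems(2,3)]
  have "gap Q (Suc m) y \<in> standard_simplex (n + Suc m)"
    using simplical_face_in[of "gap Q m y" "n + m" "Q + m"] IH Q by (simp add: gap_Suc)
  moreover have "star_class K ((n + m, omit_nth (Q + m) \<sigma>, omit_nth (Q + m) \<tau>), gap Q m y)
      = star_class K ((n + Suc m, \<sigma>, \<tau>), gap Q (Suc m) y)"
    using star_class_face[OF s Q, of "gap Q m y"] IH by (simp add: gap_Suc)
  ultimately show ?case using IH by simp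
qed

section \<open>Dimensions of blocks and points of prisms\<close>

lemma sum_list_incr: "i < length qs \<Longrightarrow> sum_list (incr qs i) = Suc (sum_list qs)"
  by (induction qs arbitrary: i) (auto split: nat.split)

lemma total_dim_incr: "i < length qs \<Longrightarrow> total_dim (incr qs i) = Suc (total_dim qs)"
  by (simp add: total_dim_def sum_list_incr)

lemma block_start_incr: "block_start (incr qs i) i = block_start qs i"
  by (simp add: block_start_def)

lemma sum_list_split: "k < length qs \<Longrightarrow> sum_list (take k qs) + (qs ! k + sum_list (drop (Suc k) qs)) = sum_list (qs :: nat list)"
  by (metis id_take_nth_drop sum_list.Cons sum_list_append)

lemma sum_list_omit_nth: "k < length qs \<Longrightarrow> sum_list (omit_nth k qs) + qs ! k = sum_list (qs :: nat list)"
  using sum_list_split[of k qs] by (simp add: omit_nth_def)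

lemma block_start_le:
  assumes "i < length qs" shows "block_start qs i + qs ! i \<le> total_dim qs"
  using sum_list_split[OF assms] assms by (simp add: block_start_def total_dim_def)

lemma total_dim_omit_nth:
  assumes "2 \<le> length qs" "k < length qs"
  shows "total_dim (omit_nth k qs) + Suc (qs ! k) = total_dim qs" "block_start qs k \<le> Suc (total_dim (omit_nth k qs))"
proof -
  show 1: "total_dim (omit_nth k qs) + Suc (qs ! k) = total_dim qs"
    using sum_list_omit_nth[OF assms(2)] assms by (simp add: total_dim_def length_omit_nth)
  show "block_start qs k \<le> Suc (total_dim (omit_nth k qs))"
    using block_start_le[OF assms(2)] 1 by linarith
qed

lemma prism_top_update:
  assumes "s \<in> topspace (prism_top qs)" "i < length qs" "y \<in> standard_simplex q"
  shows "s(i := y) \<in> topspace (prism_top (qs[i := q]))"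
  using assms by (auto simp: PiE_iff extensional_def nth_list_update)

lemma prism_top_omit:
  assumes "s \<in> topspace (prism_top qs)" "k < length qs"
  shows "omit k s \<in> topspace (prism_top (omit_nth k qs))"
  using assms
  by (auto simp: PiE_iff extensional_def omit_skip length_omit_nth nth_omit_nth skip_def)

abbreviation star_point where
  "star_point K \<equiv> preal_point (prismatic_star (complex_sset K))"

abbreviation star_cells where
  "star_cells K \<equiv> cells (prismatic_star (complex_sset K))"

lemma star_cells_prism_iff:
  "(\<sigma>, \<tau>, \<beta>) \<in> star_cells K qs \<longleftrightarrow> in_star (complex_sset K) (total_dim qs) \<sigma> \<tau> \<and>
     \<beta> \<in> simplices (complex_sset K) (length qs - 1) \<and> \<sigma> = repeat_vertices (complex_sset K) qs \<beta>"
  by (simp add: prismatic_star_def star_sset_def)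

text \<open>Each relation of the double realization becomes a relation in the realized star: prism
  cofaces and codegeneracies by the join formulas at \<open>block_start qs i + j\<close>, and a base
  face by the deletion of an entire block against a gap of zeros.\<close>

lemma star_lambda_point:
  assumes "t \<in> standard_simplex p" "((qs, \<sigma>, \<tau>, \<beta>), s) \<in> topspace (slice_cells (prismatic_star (complex_sset K)) p)"
  shows "star_lambda (complex_sset K) (star_point K p t ((qs, \<sigma>, \<tau>, \<beta>), s))
    = star_class K ((total_dim qs, \<sigma>, \<tau>), join_coords qs t s)"
proof -
  let ?P = "prismatic_star (complex_sset K)"
  define f where "f = (\<lambda>(p::nat) t ((qs, \<sigma>, \<tau>, \<beta> :: 'a list), s). star_class K ((total_dim qs, \<sigma>, \<tau>), join_coords qs t s))"
  have slice: "f p t z = f p t z'"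
    if t: "t \<in> standard_simplex p" and z: "z \<in> topspace (slice_cells ?P p)" and z': "z' \<in> topspace (slice_cells ?P p)"
      and r: "slice_rel ?P z z'" for p t z z'
    using r
  proof cases
    case (1 i qs x j s)
    obtain \<sigma> \<tau> \<beta> where x: "x = (\<sigma>, \<tau>, \<beta>)" by (cases x rule: prod_cases3)
    have l: "length qs = Suc p" using z by (simp add: 1(1) slice_cells_iff del: topspace_product_topology)
    have star: "in_star (complex_sset K) (Suc (total_dim qs)) \<sigma> \<tau>"
      using 1(4) unfolding x star_cells_prism_iff total_dim_incr[OF 1(3)] by blast
    have y: "join_coords qs t s \<in> standard_simplex (total_dim qs)"
      by (rule join_coords_in[OF l t 1(6)])
    have b: "block_start qs i + j \<le> Suc (total_dim qs)" using block_start_le[OF 1(3)] 1(5) by linarith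
    show ?thesis
      using star_class_face[OF star b y] join_rec_face[OF 1(3,5), of t s]
      by (simp add: 1(1,2) f_def x prismatic_star_def block_start_incr join_coords_eq total_dim_incr[OF 1(3)])
  next
    case (2 i qs x j s)
    obtain \<sigma> \<tau> \<beta> where x: "x = (\<sigma>, \<tau>, \<beta>)" by (cases x rule: prod_cases3)
    have l: "length qs = Suc p" using z' by (simp add: 2(2) slice_cells_iff del: topspace_product_topology)
    have star: "in_star (complex_sset K) (total_dim qs) \<sigma> \<tau>"
      using 2(4) unfolding x star_cells_prism_iff by blast
    have y: "join_coords (incr qs i) t s \<in> standard_simplex (Suc (total_dim qs))"
      unfolding total_dim_incr[OF 2(3), symmetric]
      by (rule join_coords_in[OF _ t 2(6)]) (simp add: l)
    have b: "block_start qs i + j \<le> total_dim qs" using block_start_le[OF 2(3)] 2(5) by linarith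
    show ?thesis
      using star_class_degen[OF star b y] join_rec_degen[OF 2(3,5), of t s]
      by (simp add: 2(1,2) f_def x prismatic_star_def join_coords_eq total_dim_incr[OF 2(3)])
  qed
  have base: "f (Suc p) (simplical_face k t) ((qs, x), s) = f p t ((omit_nth k qs, base_face ?P qs k x), omit k s)"
    if l: "length qs = Suc (Suc p)" and k: "k \<le> Suc p" and x: "x \<in> star_cells K qs"
      and t: "t \<in> standard_simplex p" and s: "s \<in> topspace (prism_top qs)" for p t qs k x s
  proof -
    obtain \<sigma> \<tau> \<beta> where x': "x = (\<sigma>, \<tau>, \<beta>)" by (cases x rule: prod_cases3)
    have k': "k < length qs" "2 \<le> length qs" using l k by auto
    let ?n = "total_dim (omit_nth k qs)" and ?Q = "block_start qs k" and ?m = "Suc (qs ! k)"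
    have star: "in_star (complex_sset K) (?n + ?m) \<sigma> \<tau>"
      unfolding total_dim_omit_nth(1)[OF k'(2,1)] using x unfolding x' star_cells_prism_iff by blast
    have lo: "length (omit_nth k qs) = Suc p" using k' l by (simp add: length_omit_nth)
    have y: "join_coords (omit_nth k qs) t (omit k s) \<in> standard_simplex ?n"
      by (rule join_coords_in[OF lo t prism_top_omit[OF s k'(1)]])
    have "gap ?Q ?m (join_coords (omit_nth k qs) t (omit k s)) = join_coords qs (simplical_face k t) s"
      using join_rec_omit[OF k'(1), of t s] by (simp add: join_coords_eq)
    with star_class_iterated_face[OF star total_dim_omit_nth(2)[OF k'(2,1)] y]
    show ?thesis
      by (simp add: f_def x' prismatic_star_def Let_def total_dim_omit_nth(1)[OF k'(2,1), symmetric] del: upt_Suc)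
  qed
  have "qlift (\<lambda>(p, t, C). qlift (f p t) C) (star_point K p t ((qs, \<sigma>, \<tau>, \<beta>), s)) = f p t ((qs, \<sigma>, \<tau>, \<beta>), s)"
    by (rule qlift_preal_point[where f = f, OF assms]; (rule slice | rule base); assumption)
  then show ?thesis by (simp add: star_lambda_def f_def)
qed

lemma complex_lambda_point:
  assumes "t \<in> standard_simplex p" "((qs, \<sigma>, \<tau>, \<beta>), s) \<in> topspace (slice_cells (prismatic_star (complex_sset K)) p)"
  shows "complex_lambda K (star_point K p t ((qs, \<sigma>, \<tau>, \<beta>), s))
    = (barycentric \<beta> t, barycentric \<tau> (join_coords qs t s))"
proof -
  have *: "length qs = Suc p" "(\<sigma>, \<tau>, \<beta>) \<in> star_cells K qs" "s \<in> topspace (prism_top qs)"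
    using assms(2) unfolding slice_cells_iff by blast+
  have \<sigma>': "\<sigma> = repeat_vertices (complex_sset K) qs \<beta>" and star: "in_star (complex_sset K) (total_dim qs) \<sigma> \<tau>"
    and "\<beta> \<in> simplices (complex_sset K) (length qs - 1)"
    using *(2) unfolding star_cells_prism_iff by blast+
  then have \<beta>: "length \<beta> = length qs" using *(1) by (simp add: simplices_complex_iff)
  have \<sigma>: "\<sigma> = expand qs \<beta>" unfolding \<sigma>' by (rule repeat_vertices_eq[OF \<beta>])
  have "join_coords qs t s \<in> standard_simplex (total_dim qs)"
    by (rule join_coords_in[OF *(1) assms(1) *(3)])
  from sreal_star_to_complex_class[OF star this] show ?thesis
    unfolding complex_lambda_def using star_lambda_point[OF assms] barycentric_expand[OF \<beta> *(3)] \<sigma> by simp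
qed

text \<open>On a cell both components are barycentric combinations with continuous coefficients.
  They land in the star because the first one is also a combination of the vertices of
  \<open>\<sigma>\<close>, and \<open>\<sigma>\<close> and \<open>\<tau>\<close> span a common
  simplex.\<close>

lemma continuous_map_complex_lambda:
  assumes K: "abstract_complex K"
  shows "continuous_map (preal (prismatic_star (complex_sset K))) (complex_star_space K) (complex_lambda K)"
proof (rule continuous_map_from_preal)
  fix p qs and x :: "'a list \<times> 'a list \<times> 'a list"
  assume l: "length qs = Suc p" and x: "x \<in> star_cells K qs"
  obtain \<sigma> \<tau> \<beta> where x': "x = (\<sigma>, \<tau>, \<beta>)" by (cases x rule: prod_cases3)
  let ?X = "prod_topology (simplex_top p) (prism_top qs)"
  have star: "in_star (complex_sset K) (total_dim qs) \<sigma> \<tau>" and "\<beta> \<in> simplices (complex_sset K) (length qs - 1)"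
    and \<sigma>: "\<sigma> = repeat_vertices (complex_sset K) qs \<beta>"
    using x unfolding x' star_cells_prism_iff by blast+
  then have \<beta>: "\<beta> \<in> simplices (complex_sset K) p" using l by simp
  note st = in_star_complex[OF star]
  obtain \<rho> where \<rho>: "\<rho> \<in> K" "set \<sigma> \<union> set \<tau> \<subseteq> \<rho>" using st by blast
  have "set \<tau> \<noteq> {}" using st by auto
  then have sub: "set \<tau> \<in> K" using complex_face[OF K \<rho>(1), of "set \<tau>"] \<rho>(2) by simp
  have \<beta>': "length \<beta> = Suc p" "set \<beta> \<in> K" using \<beta> by (auto simp: simplices_complex_iff)
  have in_cells: "((qs, x), s) \<in> topspace (slice_cells (prismatic_star (complex_sset K)) p)"
    if "s \<in> topspace (prism_top qs)" for s
    using that l x by (simp add: slice_cells_iff del: topspace_product_topology)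
  have J: "join_coords qs t s \<in> standard_simplex (total_dim qs)"
    if "t \<in> standard_simplex p" "s \<in> topspace (prism_top qs)" for t s
    by (rule join_coords_in[OF l that])
  have c1: "continuous_map ?X euclideanreal (\<lambda>z. fst z i)" for i
    using continuous_map_compose[OF continuous_map_fst continuous_map_simplex_coord] by (simp add: o_def)
  have c2: "continuous_map ?X euclideanreal (\<lambda>z. snd z i j)" if "i < length qs" for i j
  proof -
    have "continuous_map (prism_top qs) (simplex_top (qs ! i)) (\<lambda>s. s i)"
      using that by (intro continuous_map_product_projection) simp
    from continuous_map_compose[OF continuous_map_compose[OF continuous_map_snd this] continuous_map_simplex_coord]
    show ?thesis by (simp add: o_def)
  qed
  have c3: "continuous_map ?X euclideanreal (\<lambda>z. join_coords qs (fst z) (snd z) k)" for k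
  proof -
    have "continuous_map ?X euclideanreal (\<lambda>z. if c then fst z i * snd z i j else 0)" if "i < length qs" for i j c
      by (cases c) (simp_all add: continuous_map_real_mult[OF c1 c2[OF that]])
    then show ?thesis unfolding join_coords_def by (intro continuous_map_sum) auto
  qed
  have bary: "barycentric \<beta> t \<in> topspace (complex_space K)" "barycentric \<tau> (join_coords qs t s) \<in> topspace (complex_space K)"
    "\<exists>\<rho>\<in>K. supp (barycentric \<beta> t) \<union> supp (barycentric \<tau> (join_coords qs t s)) \<subseteq> \<rho>"
    if t: "t \<in> standard_simplex p" and s: "s \<in> topspace (prism_top qs)" for t s
  proof -
    show "barycentric \<beta> t \<in> topspace (complex_space K)" by (rule barycentric_in[OF K \<beta>' t])
    show "barycentric \<tau> (join_coords qs t s) \<in> topspace (complex_space K)"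
      by (rule barycentric_in[OF K _ sub J[OF t s]]) (use st in simp)
    have "barycentric \<beta> t = barycentric \<sigma> (join_coords qs t s)"
      using barycentric_expand[of \<beta> qs s t] s \<beta>'(1) l \<sigma> by (simp add: repeat_vertices_eq)
    then have "supp (barycentric \<beta> t) \<subseteq> set \<sigma>" using supp_barycentric by metis
    then have "supp (barycentric \<beta> t) \<union> supp (barycentric \<tau> (join_coords qs t s)) \<subseteq> \<rho>"
      using \<rho>(2) supp_barycentric[of \<tau> "join_coords qs t s"] by blast
    then show "\<exists>\<rho>\<in>K. supp (barycentric \<beta> t) \<union> supp (barycentric \<tau> (join_coords qs t s)) \<subseteq> \<rho>"
      using \<rho>(1) by blast
  qed
  have "continuous_map ?X (complex_star_space K)
      (\<lambda>z. (barycentric \<beta> (fst z), barycentric \<tau> (join_coords qs (fst z) (snd z))))"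
    unfolding complex_star_space_def continuous_map_in_subtopology continuous_map_pairwise continuous_map_into_complex_space
    using bary c1 c3 by (auto simp: o_def supp_def intro!: continuous_map_barycentric_coord)
  then show "continuous_map ?X (complex_star_space K) (\<lambda>(t, s). complex_lambda K (star_point K p t ((qs, x), s)))"
  proof (rule continuous_map_eq)
    fix z assume z: "z \<in> topspace ?X"
    obtain t s where ts: "z = (t, s)" by (cases z)
    have t: "t \<in> standard_simplex p" and s: "s \<in> topspace (prism_top qs)" using z by (auto simp: ts)
    show "(barycentric \<beta> (fst z), barycentric \<tau> (join_coords qs (fst z) (snd z))) =
        (case z of (t, s) \<Rightarrow> complex_lambda K (star_point K p t ((qs, x), s)))"
      using complex_lambda_point[OF t in_cells[OF s, unfolded x']] by (simp add: ts x')
  qed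
qed

section \<open>The prismatic classifying space\<close>

definition pegs :: "nat list \<Rightarrow> ((nat \<Rightarrow> real) \<times> (nat \<Rightarrow> nat \<Rightarrow> real)) set" where
  "pegs qs = topspace (peg_top qs)"

lemma pegs_iff: "(t, s) \<in> pegs qs \<longleftrightarrow> t \<in> standard_simplex (length qs - 1) \<and> s \<in> topspace (prism_top qs)"
  unfolding pegs_def topspace_prod_topology topspace_standard_simplex by (rule mem_Sigma_iff)

definition peg_mul :: "('g, 'm) monoid_scheme \<Rightarrow> nat list \<Rightarrow> 'g peg \<Rightarrow> ((nat \<Rightarrow> real) \<Rightarrow> 'g) \<Rightarrow> 'g peg" where
  "peg_mul G qs a g = restrict (\<lambda>(t, s). rmul G (length qs - 1) (a (t, s)) (g t)) (pegs qs)"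

lemma peg_mul_at: "(t, s) \<in> pegs qs \<Longrightarrow> peg_mul G qs a g (t, s) = rmul G (length qs - 1) (a (t, s)) (g t)"
  by (simp add: peg_mul_def)

lemma restrict_pegs_eqI:
  "(\<And>t s. (t, s) \<in> pegs qs \<Longrightarrow> f (t, s) = g (t, s)) \<Longrightarrow> restrict f (pegs qs) = restrict g (pegs qs)"
  by (rule restrict_ext) auto

lemma insert_at_omit: "insert_at k y (omit k s) = s(k := y)"
  by (auto simp: insert_at_def omit_def fun_eq_iff)

lemma peg_face_at:
  "(t, s) \<in> pegs (qs[i := qs ! i - 1]) \<Longrightarrow> peg_face qs i j a (t, s) = a (t, s(i := simplical_face j (s i)))"
  unfolding peg_face_def pegs_def[symmetric] by (simp only: restrict_apply' prod.case)

lemma peg_face_incr_at: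
  "(t, s) \<in> pegs qs \<Longrightarrow> i < length qs \<Longrightarrow>
    peg_face (incr qs i) i j a (t, s) = a (t, s(i := simplical_face j (s i)))"
  using peg_face_at[of t s "incr qs i" i j a] by simp

lemma peg_degen_at:
  "(t, s) \<in> pegs (incr qs i) \<Longrightarrow> peg_degen qs i j a (t, s) = a (t, s(i := codegen j (s i)))"
  unfolding peg_degen_def pegs_def[symmetric] by (simp only: restrict_apply' prod.case)

lemma peg_base_face_at:
  "(t, s) \<in> pegs (omit_nth k qs) \<Longrightarrow>
    peg_base_face qs k a (t, s) = omit k (a (simplical_face k t, insert_at k (\<lambda>i. if i = 0 then 1 else 0) s))"
  unfolding peg_base_face_def pegs_def[symmetric] by (simp only: restrict_apply' prod.case)

lemma pegs_face:
  assumes "(t, s) \<in> pegs qs" "i < length qs" "j \<le> Suc (qs ! i)"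
  shows "(t, s(i := simplical_face j (s i))) \<in> pegs (incr qs i)"
proof -
  have s: "s \<in> topspace (prism_top qs)" using assms(1) unfolding pegs_iff by blast
  from prism_top_update[OF s assms(2) simplical_face_in[OF prism_top_at[OF s assms(2)] assms(3)]]
  show ?thesis using assms(1) by (simp add: pegs_iff del: topspace_product_topology)
qed

lemma pegs_degen:
  assumes "(t, s) \<in> pegs (incr qs i)" "i < length qs" "j \<le> qs ! i"
  shows "(t, s(i := codegen j (s i))) \<in> pegs qs"
proof -
  have s: "s \<in> topspace (prism_top (incr qs i))" using assms(1) unfolding pegs_iff by blast
  have "s i \<in> standard_simplex (Suc (qs ! i))" using prism_top_at[OF s, of i] assms(2) by simp
  from prism_top_update[OF s _ codegen_in[OF this assms(3)], of i]
  show ?thesis using assms(1,2) by (simp add: pegs_iff del: topspace_product_topology)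
qed

lemma prism_top_insert:
  assumes "s \<in> topspace (prism_top (omit_nth k qs))" "k < length qs" "y \<in> standard_simplex (qs ! k)"
  shows "insert_at k y s \<in> topspace (prism_top qs)"
proof -
  have l: "length (omit_nth k qs) = length qs - 1" using assms(2) by (rule length_omit_nth)
  have e: "s i = undefined" if "i \<ge> length qs - 1" for i
    using assms(1) that l by (simp add: PiE_iff extensional_def)
  have "insert_at k y s i \<in> standard_simplex (qs ! i)" if "i < length qs" for i
  proof (cases i k rule: linorder_cases)
    case less
    then show ?thesis
      using prism_top_at[OF assms(1), of i] nth_omit_nth[OF assms(2), of i] assms(2) l
      by (simp add: insert_at_def skip_def)
  next
    case equal
    then show ?thesis using assms(3) by (simp add: insert_at_def)
  next
    case greater
    then obtain m where m: "i = Suc m" by (metis not_less0 not0_implies_Suc)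
    then show ?thesis
      using greater prism_top_at[OF assms(1), of m] nth_omit_nth[OF assms(2), of m] that l
      by (simp add: insert_at_def skip_def)
  qed
  moreover have "insert_at k y s i = undefined" if "i \<ge> length qs" for i
    using e[of "i - 1"] that assms(2) by (simp add: insert_at_def)
  ultimately show ?thesis by (simp add: PiE_iff extensional_def)
qed

lemma vertex_in: "(\<lambda>i. if i = 0 then 1 else 0) \<in> standard_simplex n"
  by simp

lemma pegs_base:
  assumes "(t, s) \<in> pegs (omit_nth k qs)" "2 \<le> length qs" "k < length qs"
  shows "(simplical_face k t, insert_at k (\<lambda>i. if i = 0 then 1 else 0) s) \<in> pegs qs"
proof -
  obtain p where p: "length qs = Suc (Suc p)" using assms(2) by (metis Suc_le_D add_2_eq_Suc' numeral_2_eq_2 Suc_le_mono)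
  have "t \<in> standard_simplex p" and s: "s \<in> topspace (prism_top (omit_nth k qs))"
    using assms(1,3) p unfolding pegs_iff by (simp_all add: length_omit_nth del: topspace_product_topology)
  then show ?thesis
    using simplical_face_in[of t p k] prism_top_insert[OF s assms(3) vertex_in] assms(3) p
    by (simp add: pegs_iff del: topspace_product_topology)
qed

text \<open>Only the condition on values is recorded. It is inherited under all operators and
  suffices to let functions on the base simplex act and to compute the operators on orbits, so
  continuity and independence need not be carried through every face.\<close>

definition peg_valued :: "('g, 'm) monoid_scheme \<Rightarrow> nat list \<Rightarrow> 'g peg \<Rightarrow> bool" where
  "peg_valued G qs a \<longleftrightarrow> (\<forall>x\<in>pegs qs. a x \<in> steps G (length qs - 1))"

context top_group
begin

lemma steps_length: "qs \<noteq> [] \<Longrightarrow> topspace (product_topology (\<lambda>_. T) {..<length qs}) = steps G (length qs - 1)"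
  by (cases qs) (simp_all add: steps_def topspace_T lessThan_Suc_atMost)

lemma peg_orbit_eq:
  assumes "qs \<noteq> []"
  shows "peg_orbit G T qs a = peg_mul G qs a ` {g. continuous_map (simplex_top (length qs - 1)) T g}"
proof -
  have "{..<length qs} = {..length qs - 1}" using assms by (cases qs) (auto simp: lessThan_Suc_atMost)
  then have "(\<lambda>(t, s). \<lambda>j\<in>{..<length qs}. a (t, s) j \<otimes> g t) = (\<lambda>(t, s). rmul G (length qs - 1) (a (t, s)) (g t))" for g
    by (simp add: rmul_def)
  then show ?thesis unfolding peg_orbit_def peg_mul_def pegs_def by auto
qed

lemma PEG_valued:
  assumes "qs \<noteq> []" "a \<in> PEG T qs" shows "peg_valued G qs a"
proof -
  have "continuous_map (peg_top qs) (product_topology (\<lambda>_. T) {..<length qs}) a"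
    using assms(2) unfolding PEG_def by blast
  then have "a \<in> pegs qs \<rightarrow> steps G (length qs - 1)"
    unfolding pegs_def steps_length[OF assms(1), symmetric] continuous_map_def by blast
  then show ?thesis unfolding peg_valued_def by blast
qed

lemma simplex_fun: "continuous_map (simplex_top p) T g \<Longrightarrow> t \<in> standard_simplex p \<Longrightarrow> g t \<in> carrier G"
  using continuous_map_carrier by fastforce

lemma peg_mul_mul:
  assumes "peg_valued G qs a" "continuous_map (simplex_top (length qs - 1)) T g" "continuous_map (simplex_top (length qs - 1)) T h"
  shows "peg_mul G qs (peg_mul G qs a g) h = peg_mul G qs a (\<lambda>t. g t \<otimes> h t)"
  unfolding peg_mul_def[of G qs _ h] peg_mul_def[of G qs _ "\<lambda>t. g t \<otimes> h t"]
proof (rule restrict_pegs_eqI)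
  fix t s assume ts: "(t, s) \<in> pegs qs"
  then have "t \<in> standard_simplex (length qs - 1)" by (simp add: pegs_iff del: topspace_product_topology)
  moreover have "a (t, s) \<in> steps G (length qs - 1)" using assms(1) ts by (auto simp: peg_valued_def)
  ultimately show "(case (t, s) of (t, s) \<Rightarrow> rmul G (length qs - 1) (peg_mul G qs a g (t, s)) (h t))
      = (case (t, s) of (t, s) \<Rightarrow> rmul G (length qs - 1) (a (t, s)) (g t \<otimes> h t))"
    using ts assms(2,3) by (simp add: peg_mul_at rmul_rmul simplex_fun)
qed

text \<open>Functions into the group form a group under pointwise multiplication, so acting by
  \<open>g\<close> permutes the orbit: the translate by \<open>inv g t \<otimes> h t\<close> undoes
  it.\<close>

lemma peg_orbit_mul:
  assumes qs: "qs \<noteq> []" and a: "peg_valued G qs a" and g: "continuous_map (simplex_top (length qs - 1)) T g"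
  shows "peg_orbit G T qs (peg_mul G qs a g) = peg_orbit G T qs a"
  unfolding peg_orbit_eq[OF qs]
proof (intro equalityI image_subsetI)
  fix h assume "h \<in> {g. continuous_map (simplex_top (length qs - 1)) T g}"
  then have h: "continuous_map (simplex_top (length qs - 1)) T h" by simp
  show "peg_mul G qs (peg_mul G qs a g) h \<in> peg_mul G qs a ` {g. continuous_map (simplex_top (length qs - 1)) T g}"
    unfolding peg_mul_mul[OF a g h] using continuous_map_mult[OF g h] by (intro imageI) simp
  have gh: "continuous_map (simplex_top (length qs - 1)) T (\<lambda>t. inv g t \<otimes> h t)"
    by (intro continuous_map_mult continuous_map_inverse g h)
  have "peg_mul G qs (peg_mul G qs a g) (\<lambda>t. inv g t \<otimes> h t) = peg_mul G qs a h"
    unfolding peg_mul_mul[OF a g gh] unfolding peg_mul_def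
  proof (rule restrict_pegs_eqI)
    fix t s assume "(t, s) \<in> pegs qs"
    then have "t \<in> standard_simplex (length qs - 1)" by (simp add: pegs_iff del: topspace_product_topology)
    then have "g t \<otimes> (inv g t \<otimes> h t) = h t"
      using simplex_fun[OF g] simplex_fun[OF h] by (simp flip: m_assoc)
    then show "(case (t, s) of (t, s) \<Rightarrow> rmul G (length qs - 1) (a (t, s)) (g t \<otimes> (inv g t \<otimes> h t)))
       = (case (t, s) of (t, s) \<Rightarrow> rmul G (length qs - 1) (a (t, s)) (h t))" by simp
  qed
  then show "peg_mul G qs a h \<in> peg_mul G qs (peg_mul G qs a g) ` {g. continuous_map (simplex_top (length qs - 1)) T g}"
    using gh by (metis (mono_tags, lifting) imageI mem_Collect_eq)
qed

lemma continuous_one: "continuous_map X T (\<lambda>_. \<one>)"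
  by (simp add: topspace_T)

lemma qlift_peg_orbit:
  assumes "qs \<noteq> []" "peg_valued G qs a"
    and "\<And>g. continuous_map (simplex_top (length qs - 1)) T g \<Longrightarrow> f (peg_mul G qs a g) = c"
  shows "qlift f (peg_orbit G T qs a) = c"
proof -
  have "qlift f (peg_orbit G T qs a) = f (peg_mul G qs a (\<lambda>_. \<one>))"
  proof (rule qlift_const)
    show "peg_mul G qs a (\<lambda>_. \<one>) \<in> peg_orbit G T qs a"
      unfolding peg_orbit_eq[OF assms(1)] using continuous_one by blast
    show "f y = f (peg_mul G qs a (\<lambda>_. \<one>))" if "y \<in> peg_orbit G T qs a" for y
      using that assms(3) assms(3)[OF continuous_one] unfolding peg_orbit_eq[OF assms(1)] by auto
  qed
  then show ?thesis using assms(3)[OF continuous_one] by simp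
qed

lemma peg_valued_face:
  assumes "peg_valued G (incr qs i) a" "i < length qs" "j \<le> Suc (qs ! i)"
  shows "peg_valued G qs (peg_face (incr qs i) i j a)"
  unfolding peg_valued_def
proof
  fix x assume x: "x \<in> pegs qs"
  obtain t s where ts: "x = (t, s)" by (cases x)
  have "a (t, s(i := simplical_face j (s i))) \<in> steps G (length (incr qs i) - 1)"
    using assms(1) pegs_face[OF x[unfolded ts] assms(2,3)] by (auto simp: peg_valued_def)
  then show "peg_face (incr qs i) i j a x \<in> steps G (length qs - 1)"
    using peg_face_incr_at[of t s qs i j a] x assms(2) by (simp add: ts)
qed

lemma peg_valued_degen:
  assumes "peg_valued G qs a" "i < length qs" "j \<le> qs ! i"
  shows "peg_valued G (incr qs i) (peg_degen qs i j a)"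
  unfolding peg_valued_def
proof
  fix x assume x: "x \<in> pegs (incr qs i)"
  obtain t s where ts: "x = (t, s)" by (cases x)
  have "a (t, s(i := codegen j (s i))) \<in> steps G (length qs - 1)"
    using assms(1) pegs_degen[OF x[unfolded ts] assms(2,3)] by (auto simp: peg_valued_def)
  then show "peg_degen qs i j a x \<in> steps G (length (incr qs i) - 1)"
    using peg_degen_at[of t s qs i j a] x by (simp add: ts)
qed

lemma peg_valued_base:
  assumes "peg_valued G qs a" "2 \<le> length qs" "k < length qs"
  shows "peg_valued G (omit_nth k qs) (peg_base_face qs k a)"
  unfolding peg_valued_def
proof
  fix x assume x: "x \<in> pegs (omit_nth k qs)"
  obtain t s where ts: "x = (t, s)" by (cases x)
  obtain p where p: "length qs = Suc (Suc p)" using assms(2) by (metis Suc_le_D add_2_eq_Suc' numeral_2_eq_2 Suc_le_mono)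
  have "a (simplical_face k t, insert_at k (\<lambda>i. if i = 0 then 1 else 0) s) \<in> steps G (Suc p)"
    using assms(1) pegs_base[OF x[unfolded ts] assms(2,3)] p by (auto simp: peg_valued_def)
  then show "peg_base_face qs k a x \<in> steps G (length (omit_nth k qs) - 1)"
    using peg_base_face_at[of t s k qs a] x omit_steps[of _ p k] assms(3) p by (simp add: ts length_omit_nth)
qed

lemma cells_PBG: "cells (PBG G T) qs = peg_orbit G T qs ` PEG T qs"
  by (simp add: PBG_def)

lemma prism_face_PBG:
  assumes a: "peg_valued G (incr qs i) a" and i: "i < length qs" "j \<le> Suc (qs ! i)"
  shows "prism_face (PBG G T) (incr qs i) i j (peg_orbit G T (incr qs i) a)
    = peg_orbit G T qs (peg_face (incr qs i) i j a)"
proof -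
  have ne: "incr qs i \<noteq> []" "qs \<noteq> []" using i(1) by auto
  have eq: "(incr qs i)[i := incr qs i ! i - 1] = qs" using i(1) by simp
  have "peg_orbit G T qs (peg_face (incr qs i) i j (peg_mul G (incr qs i) a g)) = peg_orbit G T qs (peg_face (incr qs i) i j a)"
    if g: "continuous_map (simplex_top (length (incr qs i) - 1)) T g" for g
  proof -
    have "peg_face (incr qs i) i j (peg_mul G (incr qs i) a g) = peg_mul G qs (peg_face (incr qs i) i j a) g"
      unfolding peg_mul_def[of G qs]
      unfolding peg_face_def[of "incr qs i" i j "peg_mul G (incr qs i) a g"] eq pegs_def[symmetric]
    proof (rule restrict_pegs_eqI)
      fix t s assume ts: "(t, s) \<in> pegs qs"
      show "(case (t, s) of (t, s) \<Rightarrow> peg_mul G (incr qs i) a g (t, s(i := simplical_face j (s i))))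
        = (case (t, s) of (t, s) \<Rightarrow> rmul G (length qs - 1) (peg_face (incr qs i) i j a (t, s)) (g t))"
        using peg_mul_at[OF pegs_face[OF ts i], of G a g] peg_face_incr_at[OF ts i(1), of j a] by simp
    qed
    then show ?thesis using peg_orbit_mul[OF ne(2) peg_valued_face[OF a i]] g by simp
  qed
  then show ?thesis
    unfolding PBG_def prismatic.simps eq by (rule qlift_peg_orbit[OF ne(1) a])
qed

lemma prism_degen_PBG:
  assumes a: "peg_valued G qs a" and i: "i < length qs" "j \<le> qs ! i"
  shows "prism_degen (PBG G T) qs i j (peg_orbit G T qs a) = peg_orbit G T (incr qs i) (peg_degen qs i j a)"
proof -
  have ne: "incr qs i \<noteq> []" "qs \<noteq> []" using i(1) by auto
  have "peg_orbit G T (incr qs i) (peg_degen qs i j (peg_mul G qs a g)) = peg_orbit G T (incr qs i) (peg_degen qs i j a)"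
    if g: "continuous_map (simplex_top (length qs - 1)) T g" for g
  proof -
    have "peg_degen qs i j (peg_mul G qs a g) = peg_mul G (incr qs i) (peg_degen qs i j a) g"
      unfolding peg_mul_def[of G "incr qs i"]
      unfolding peg_degen_def[of qs i j "peg_mul G qs a g"] pegs_def[symmetric]
    proof (rule restrict_pegs_eqI)
      fix t s assume ts: "(t, s) \<in> pegs (incr qs i)"
      show "(case (t, s) of (t, s) \<Rightarrow> peg_mul G qs a g (t, s(i := codegen j (s i))))
        = (case (t, s) of (t, s) \<Rightarrow> rmul G (length (incr qs i) - 1) (peg_degen qs i j a (t, s)) (g t))"
        using peg_mul_at[OF pegs_degen[OF ts i], of G a g] peg_degen_at[OF ts, of j a] by simp
    qed
    then show ?thesis using peg_orbit_mul[OF ne(1) peg_valued_degen[OF a i]] g by simp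
  qed
  then show ?thesis
    unfolding PBG_def prismatic.simps by (rule qlift_peg_orbit[OF ne(2) a])
qed

lemma continuous_map_simplical_face:
  assumes "k \<le> Suc p" shows "continuous_map (simplex_top p) (simplex_top (Suc p)) (simplical_face k)"
  unfolding continuous_map_into_simplex
proof (intro conjI allI)
  show "continuous_map (simplex_top p) euclideanreal (\<lambda>t. simplical_face k t i)" for i
    unfolding simplical_face_def by (cases i k rule: linorder_cases) (auto intro: continuous_map_simplex_coord)
qed (use simplical_face_in assms in auto)

text \<open>Restriction along the coface turns the action of \<open>g\<close> into that of its
  restriction to the face. All components are multiplied by the same value, so dropping one of them
  does not interfere.\<close>

lemma base_face_PBG:
  assumes a: "peg_valued G qs a" and k: "2 \<le> length qs" "k < length qs"
  shows "base_face (PBG G T) qs k (peg_orbit G T qs a) = peg_orbit G T (omit_nth k qs) (peg_base_face qs k a)"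
proof -
  obtain p where p: "length qs = Suc (Suc p)" using k(1) by (metis Suc_le_D add_2_eq_Suc' numeral_2_eq_2 Suc_le_mono)
  have l: "length (omit_nth k qs) = Suc p" using k p by (simp add: length_omit_nth)
  have ne: "omit_nth k qs \<noteq> []" "qs \<noteq> []" using l p by auto
  have "peg_orbit G T (omit_nth k qs) (peg_base_face qs k (peg_mul G qs a g)) = peg_orbit G T (omit_nth k qs) (peg_base_face qs k a)"
    if g: "continuous_map (simplex_top (length qs - 1)) T g" for g
  proof -
    let ?g = "\<lambda>t. g (simplical_face k t)"
    have g': "continuous_map (simplex_top (length (omit_nth k qs) - 1)) T ?g"
      using continuous_map_compose[OF continuous_map_simplical_face[of k p], of T g] g k p l by (simp add: o_def)
    have "peg_base_face qs k (peg_mul G qs a g) = peg_mul G (omit_nth k qs) (peg_base_face qs k a) ?g"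
      unfolding peg_mul_def[of G "omit_nth k qs"]
      unfolding peg_base_face_def[of qs k "peg_mul G qs a g"] pegs_def[symmetric]
    proof (rule restrict_pegs_eqI)
      fix t s assume ts: "(t, s) \<in> pegs (omit_nth k qs)"
      show "(case (t, s) of (t, s) \<Rightarrow> omit k (peg_mul G qs a g (simplical_face k t, insert_at k (\<lambda>i. if i = 0 then 1 else 0) s)))
        = (case (t, s) of (t, s) \<Rightarrow> rmul G (length (omit_nth k qs) - 1) (peg_base_face qs k a (t, s)) (g (simplical_face k t)))"
        using peg_mul_at[OF pegs_base[OF ts k], of G a g] peg_base_face_at[OF ts, of a] k p l by (simp add: omit_rmul)
    qed
    then show ?thesis using peg_orbit_mul[OF ne(1) peg_valued_base[OF a k] g'] by simp
  qed
  then show ?thesis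
    unfolding PBG_def prismatic.simps by (rule qlift_peg_orbit[OF ne(2) a])
qed

section \<open>The evaluation map\<close>

definition ev_class :: "nat \<Rightarrow> (nat \<Rightarrow> real) \<Rightarrow> (nat \<Rightarrow> 'g) \<Rightarrow> 'g EG_point set set" where
  "ev_class p t b = BG_class G T (EG_class G T (p, t, b))"

lemma ev_class_rmul:
  assumes "t \<in> standard_simplex p" "b \<in> steps G p" "g \<in> carrier G"
  shows "ev_class p t (rmul G p b g) = ev_class p t b"
proof -
  have "BG_class G T (EG_class G T (p, t, b)) = BG_class G T (EG_class G T (p, t, rmul G p b g))"
    using assms BG_class_eq_iff[OF EG_class_in[OF assms(1,2)] EG_class_in[OF assms(1) rmul_steps[OF assms(2,3)]]]
      EG_act_class[OF assms] by metis
  then show ?thesis by (simp add: ev_class_def)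
qed

lemma qlift_ev_class:
  assumes "length qs = Suc p" "peg_valued G qs a" "(t, s) \<in> pegs qs"
  shows "qlift (\<lambda>a. ev_class p t (a (t, s))) (peg_orbit G T qs a) = ev_class p t (a (t, s))"
proof (rule qlift_peg_orbit[OF _ assms(2)])
  show "qs \<noteq> []" using assms(1) by auto
  fix g assume g: "continuous_map (simplex_top (length qs - 1)) T g"
  have "t \<in> standard_simplex p" using assms(1,3) by (simp add: pegs_iff del: topspace_product_topology)
  moreover have "a (t, s) \<in> steps G p" using assms by (auto simp: peg_valued_def)
  ultimately show "ev_class p t (peg_mul G qs a g (t, s)) = ev_class p t (a (t, s))"
    using g assms(1,3) by (simp add: peg_mul_at ev_class_rmul simplex_fun)
qed

text \<open>Evaluation forgets right multiplication by passing to \<open>BG\<close>, and prism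
  operators only reparametrise \<open>s\<close>. For base faces the face relation of
  \<open>EG\<close> drops exactly the component that may still depend on the deleted factor.\<close>

lemma ev_point:
  assumes t: "t \<in> standard_simplex p" and l: "length qs = Suc p" and s: "s \<in> topspace (prism_top qs)" and a: "a \<in> PEG T qs"
  shows "ev G T (preal_point (PBG G T) p t ((qs, peg_orbit G T qs a), s)) = ev_class p t (a (t, s))"
proof -
  let ?P = "PBG G T"
  define f where "f = (\<lambda>p t ((qs :: nat list, A), s :: nat \<Rightarrow> nat \<Rightarrow> real). qlift (\<lambda>a. ev_class p t (a (t, s))) A)"
  have f': "f p t ((qs, peg_orbit G T qs a), s) = ev_class p t (a (t, s))"
    if "length qs = Suc p" "peg_valued G qs a" "(t, s) \<in> pegs qs" for p t qs s a
    unfolding f_def prod.case by (rule qlift_ev_class[OF that])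
  have f: "f p t ((qs, peg_orbit G T qs a), s) = ev_class p t (a (t, s))"
    if "length qs = Suc p" "peg_valued G qs a" "t \<in> standard_simplex p" "s \<in> topspace (prism_top qs)" for p t qs s a
    by (rule f'[OF that(1,2)]) (use that in \<open>simp add: pegs_iff del: topspace_product_topology\<close>)
  have slice: "f p t z = f p t z'"
    if t: "t \<in> standard_simplex p" and z: "z \<in> topspace (slice_cells ?P p)" and z': "z' \<in> topspace (slice_cells ?P p)"
      and r: "slice_rel ?P z z'" for p t z z'
    using r
  proof cases
    case (1 i qs x j s)
    obtain a where a: "a \<in> PEG T (incr qs i)" "x = peg_orbit G T (incr qs i) a"
      using 1(4) unfolding cells_PBG by blast
    have l: "length qs = Suc p" using z unfolding 1(1) slice_cells_iff by blast
    have "incr qs i \<noteq> []" using l by auto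
    note v = PEG_valued[OF this a(1)]
    have ts: "(t, s) \<in> pegs qs" using t 1(6) l by (simp add: pegs_iff del: topspace_product_topology)
    note ts' = pegs_face[OF ts 1(3,5)]
    have "f p t z = ev_class p t (peg_face (incr qs i) i j a (t, s))"
      unfolding 1(1) a(2) prism_face_PBG[OF v 1(3,5)] by (rule f[OF l peg_valued_face[OF v 1(3,5)] t 1(6)])
    also have "peg_face (incr qs i) i j a (t, s) = a (t, s(i := simplical_face j (s i)))"
      by (rule peg_face_incr_at[OF ts 1(3)])
    also have "ev_class p t \<dots> = f p t z'"
      unfolding 1(2) a(2) by (rule f'[symmetric, OF _ v ts']) (simp add: l)
    finally show ?thesis .
  next
    case (2 i qs x j s)
    obtain a where a: "a \<in> PEG T qs" "x = peg_orbit G T qs a"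
      using 2(4) unfolding cells_PBG by blast
    have l: "length qs = Suc p" using z' unfolding 2(2) slice_cells_iff by blast
    have "qs \<noteq> []" using l by auto
    note v = PEG_valued[OF this a(1)]
    have ts: "(t, s) \<in> pegs (incr qs i)" using t 2(6) l by (simp add: pegs_iff del: topspace_product_topology)
    note ts' = pegs_degen[OF ts 2(3,5)]
    have "f p t z = ev_class p t (peg_degen qs i j a (t, s))"
      unfolding 2(1) a(2) prism_degen_PBG[OF v 2(3,5)] by (rule f[OF _ peg_valued_degen[OF v 2(3,5)] t 2(6)]) (simp add: l)
    also have "peg_degen qs i j a (t, s) = a (t, s(i := codegen j (s i)))"
      by (rule peg_degen_at[OF ts])
    also have "ev_class p t \<dots> = f p t z'"
      unfolding 2(2) a(2) by (rule f'[symmetric, OF l v ts'])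
    finally show ?thesis .
  qed
  have base: "f (Suc p) (simplical_face k t) ((qs, x), s) = f p t ((omit_nth k qs, base_face ?P qs k x), omit k s)"
    if l: "length qs = Suc (Suc p)" and k: "k \<le> Suc p" and x: "x \<in> cells ?P qs"
      and t: "t \<in> standard_simplex p" and s: "s \<in> topspace (prism_top qs)" for p t qs k x s
  proof -
    obtain a where a: "a \<in> PEG T qs" "x = peg_orbit G T qs a" using x unfolding cells_PBG by blast
    have "qs \<noteq> []" using l by auto
    note v = PEG_valued[OF this a(1)]
    have k': "2 \<le> length qs" "k < length qs" using l k by auto
    have lo: "length (omit_nth k qs) = Suc p" using k' l by (simp add: length_omit_nth)
    note os = prism_top_omit[OF s k'(2)]
    have ts: "(t, omit k s) \<in> pegs (omit_nth k qs)" using t os lo by (simp add: pegs_iff del: topspace_product_topology)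
    \<comment> \<open>The point \<open>s\<close> with its \<open>k\<close>-th entry replaced by the
      default vertex that the base face of a peg inserts.\<close>
    let ?s = "s(k := \<lambda>i. if i = 0 then 1 else (0::real))"
    have s': "?s \<in> topspace (prism_top qs)"
      using prism_top_insert[OF os k'(2) vertex_in] by (simp only: insert_at_omit)
    note e = simplical_face_in[OF t k]
    have st: "a (simplical_face k t, s) \<in> steps G (Suc p)" "a (simplical_face k t, ?s) \<in> steps G (Suc p)"
      using v e s s' l by (auto simp: peg_valued_def pegs_iff simp del: topspace_product_topology)
    \<comment> \<open>Independence on the \<open>k\<close>-th face covers all components except the
      \<open>k\<close>-th one, which \<open>omit k\<close> removes.\<close>
    have indep: "a (simplical_face k t, s) j = a (simplical_face k t, ?s) j" if "j \<noteq> k" "j < length qs" for j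
    proof -
      have "\<forall>i<length qs. \<forall>j<length qs. j \<noteq> i \<longrightarrow>
        (\<forall>t\<in>standard_simplex (length qs - 2). \<forall>s\<in>topspace (prism_top qs). \<forall>s'\<in>topspace (prism_top qs).
           (\<forall>l. l \<noteq> i \<longrightarrow> s l = s' l) \<longrightarrow> a (simplical_face i t, s) j = a (simplical_face i t, s') j)"
        using a(1) unfolding PEG_def by blast
      note this[rule_format, OF k'(2) that(2,1) _ s s']
      then show ?thesis using t l by simp
    qed
    have eq: "omit k (a (simplical_face k t, s)) = omit k (a (simplical_face k t, ?s))"
    proof (rule steps_eqI[of _ p])
      fix j assume "j \<le> p"
      then show "omit k (a (simplical_face k t, s)) j = omit k (a (simplical_face k t, ?s)) j"
        using l unfolding omit_skip by (intro indep) (auto simp: skip_def)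
    qed (use omit_steps st k in auto)
    have "f (Suc p) (simplical_face k t) ((qs, x), s) = ev_class (Suc p) (simplical_face k t) (a (simplical_face k t, s))"
      unfolding a(2) by (rule f[OF l v e s])
    also have "\<dots> = ev_class p t (omit k (a (simplical_face k t, ?s)))"
      unfolding ev_class_def EG_class_face[OF t k st(1)] eq ..
    also have "omit k (a (simplical_face k t, ?s)) = peg_base_face qs k a (t, omit k s)"
      unfolding peg_base_face_at[OF ts] insert_at_omit ..
    also have "ev_class p t \<dots> = f p t ((omit_nth k qs, base_face ?P qs k x), omit k s)"
      unfolding a(2) base_face_PBG[OF v k'] by (rule f[symmetric, OF lo peg_valued_base[OF v k'] t os])
    finally show ?thesis .
  qed
  have z: "((qs, peg_orbit G T qs a), s) \<in> topspace (slice_cells ?P p)"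
    using l s a unfolding slice_cells_iff cells_PBG by blast
  have "qlift (\<lambda>(p, t, C). qlift (f p t) C) (preal_point ?P p t ((qs, peg_orbit G T qs a), s))
      = f p t ((qs, peg_orbit G T qs a), s)"
    by (rule qlift_preal_point[where f = f, OF t z]; (rule slice | rule base); assumption)
  moreover have "qs \<noteq> []" using l by auto
  ultimately show ?thesis
    using f[OF l PEG_valued[OF _ a] t s] by (simp add: ev_def f_def ev_class_def)
qed

end

section \<open>Realization of prismatic maps\<close>

text \<open>A prismatic map sends each pair of related representatives to a related pair, first
  inside a slice and then across base faces. For the latter, the face of the cell is only known to
  be a point of the source realization through the membership assumption of the lifting
  rule.\<close>

lemma preal_map_point:
  assumes \<Phi>: "prismatic_map P P' \<Phi>" and t: "t \<in> standard_simplex p" and z: "((qs, x), s) \<in> topspace (slice_cells P p)"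
  shows "preal_map P' \<Phi> (preal_point P p t ((qs, x), s)) = preal_point P' p t ((qs, \<Phi> qs x), s)"
proof -
  note \<Phi>' = \<Phi>[unfolded prismatic_map_def]
  have cell: "\<Phi> qs x \<in> cells P' qs" if "qs \<noteq> []" "x \<in> cells P qs" for qs x
    by (rule \<Phi>'[THEN conjunct1, rule_format, OF that])
  have face: "\<Phi> qs (prism_face P (incr qs i) i j x) = prism_face P' (incr qs i) i j (\<Phi> (incr qs i) x)"
    if "i < length qs" "x \<in> cells P (incr qs i)" "j \<le> Suc (qs ! i)" for qs i j x
    by (rule \<Phi>'[THEN conjunct2, THEN conjunct1, rule_format, OF that])
  have degen: "\<Phi> (incr qs i) (prism_degen P qs i j x) = prism_degen P' qs i j (\<Phi> qs x)"
    if "i < length qs" "x \<in> cells P qs" "j \<le> qs ! i" for qs i j x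
    by (rule \<Phi>'[THEN conjunct2, THEN conjunct2, THEN conjunct1, rule_format, OF that])
  have base: "\<Phi> (omit_nth k qs) (base_face P qs k x) = base_face P' qs k (\<Phi> qs x)"
    if "2 \<le> length qs" "k < length qs" "x \<in> cells P qs" for qs k x
    by (rule \<Phi>'[THEN conjunct2, THEN conjunct2, THEN conjunct2, rule_format, OF conjI[OF that(1,2)] that(3)])
  let ?h = "\<lambda>((qs, x), s). ((qs, \<Phi> qs x), s)"
  have h_in: "?h z \<in> topspace (slice_cells P' p)" if "z \<in> topspace (slice_cells P p)" for z p
  proof -
    obtain qs x s where qxs: "z = ((qs, x), s)" by (metis surj_pair)
    have "length qs = Suc p" "x \<in> cells P qs" "s \<in> topspace (prism_top qs)"
      using that unfolding qxs slice_cells_iff by blast+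
    then show ?thesis unfolding qxs prod.case slice_cells_iff using cell[of qs x] by fastforce
  qed
  have slice: "slice_map P' \<Phi> p (slice_class P p z) = slice_class P' p (?h z)" if z: "z \<in> topspace (slice_cells P p)" for z p
  proof -
    have "slice_class P' p (?h z) = slice_class P' p (?h z')"
      if z: "z \<in> topspace (slice_cells P p)" "z' \<in> topspace (slice_cells P p)" and r: "slice_rel P z z'" for z z'
      unfolding slice_class_def
    proof (rule qclass_eqI)
      show "slice_rel P' (?h z) (?h z')"
        using r
      proof cases
        case (1 i qs x j s)
        have "incr qs i \<noteq> []" using 1(3) by auto
        from slice_rel.intros(1)[OF 1(3) cell[OF this 1(4)] 1(5,6)]
        show ?thesis unfolding 1(1,2) prod.case face[OF 1(3-5)] .
      next
        case (2 i qs x j s)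
        have "qs \<noteq> []" using 2(3) by auto
        from slice_rel.intros(2)[OF 2(3) cell[OF this 2(4)] 2(5,6)]
        show ?thesis unfolding 2(1,2) prod.case degen[OF 2(3-5)] .
      qed
    qed (rule h_in[OF z(1)], rule h_in[OF z(2)])
    from qlift_slice_class[where f = "\<lambda>z. slice_class P' p (?h z)", OF z this]
    show ?thesis unfolding slice_map_def by (simp add: case_prod_beta')
  qed
  have "preal_map P' \<Phi> (preal_point P p t ((qs, x), s)) = (\<lambda>p t z. preal_point P' p t (?h z)) p t ((qs, x), s)"
    unfolding preal_map_def
  proof (rule qlift_preal_point_gen[OF t z])
    show "(\<lambda>(p, t, C). preal_class P' (p, t, slice_map P' \<Phi> p C)) (p, t, slice_class P p z) = preal_point P' p t (?h z)"
      if "z \<in> topspace (slice_cells P p)" for p t z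
      unfolding prod.case slice[OF that] preal_point_def ..
    fix p t qs k x s
    assume a: "length qs = Suc (Suc p)" "k \<le> Suc p" "x \<in> cells P qs" "t \<in> standard_simplex p" "s \<in> topspace (prism_top qs)"
      and o: "((omit_nth k qs, base_face P qs k x), omit k s) \<in> topspace (slice_cells P p)"
    have ne: "qs \<noteq> []" "2 \<le> length qs" "k < length qs" using a(1,2) by auto
    have z: "((qs, x), s) \<in> topspace (slice_cells P (Suc p))" using a unfolding slice_cells_iff by blast
    show "preal_point P' (Suc p) (simplical_face k t) (?h ((qs, x), s)) = preal_point P' p t (?h ((omit_nth k qs, base_face P qs k x), omit k s))"
      unfolding preal_point_def preal_class_def
    proof (rule qclass_eqI)
      show "(Suc p, simplical_face k t, slice_class P' (Suc p) (?h ((qs, x), s))) \<in> topspace (preal_cells P')"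
        unfolding preal_cells_iff topspace_slice using simplical_face_in[OF a(4,2)] h_in[OF z] by blast
      show "(p, t, slice_class P' p (?h ((omit_nth k qs, base_face P qs k x), omit k s))) \<in> topspace (preal_cells P')"
        unfolding preal_cells_iff topspace_slice using a(4) h_in[OF o] by blast
      show "preal_rel P' (Suc p, simplical_face k t, slice_class P' (Suc p) (?h ((qs, x), s)))
         (p, t, slice_class P' p (?h ((omit_nth k qs, base_face P qs k x), omit k s)))"
        unfolding prod.case base[OF ne(2,3) a(3)]
        by (rule preal_rel.intros[OF a(1,2) cell[OF ne(1) a(3)] a(4,5)])
    qed
  qed
  then show ?thesis by simp
qed

section \<open>The classifying map on the prismatic star\<close>

context transitions
begin

text \<open>The coefficients do not depend on the prism coordinates at all, so both the
  triangularity and the independence conditions of \<open>PEG\<close> hold for them.\<close>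

definition coef_peg :: "nat list \<Rightarrow> 'a list \<Rightarrow> 'g peg" where
  "coef_peg qs \<beta> = restrict (\<lambda>(t, s). coefs (length qs - 1) \<beta> t) (pegs qs)"

definition star_orbit :: "nat list \<Rightarrow> 'a list \<times> 'a list \<times> 'a list \<Rightarrow> 'g peg set" where
  "star_orbit = (\<lambda>qs (\<sigma>, \<tau>, \<beta>). peg_orbit G T qs (coef_peg qs \<beta>))"

lemma coef_peg_at: "(t, s) \<in> pegs qs \<Longrightarrow> coef_peg qs \<beta> (t, s) = coefs (length qs - 1) \<beta> t"
  by (simp add: coef_peg_def)

lemma coef_peg_PEG:
  assumes qs: "qs \<noteq> []" and \<beta>: "\<beta> \<in> S (length qs - 1)"
  shows "coef_peg qs \<beta> \<in> PEG T qs"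
proof -
  let ?p = "length qs - 1"
  have len: "{..<length qs} = {..?p}" using qs by (cases qs) (auto simp: lessThan_Suc_atMost)
  have "continuous_map (simplex_top ?p) (product_topology (\<lambda>_. T) {..?p}) (coefs ?p \<beta>)"
    unfolding continuous_map_componentwise
    using continuous_map_coef[OF \<beta>] by (auto simp: coefs_def)
  from continuous_map_compose[OF continuous_map_fst this]
  have "continuous_map (peg_top qs) (product_topology (\<lambda>_. T) {..<length qs}) (\<lambda>x. coefs ?p \<beta> (fst x))"
    unfolding len by (simp add: o_def)
  then have cont: "continuous_map (peg_top qs) (product_topology (\<lambda>_. T) {..<length qs}) (coef_peg qs \<beta>)"
    by (rule continuous_map_eq) (simp add: coef_peg_def pegs_def split: prod.splits)
  have indep: "coef_peg qs \<beta> (t, s) = coef_peg qs \<beta> (t, s')"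
    if "t \<in> standard_simplex ?p" "s \<in> topspace (prism_top qs)" "s' \<in> topspace (prism_top qs)" for t s s'
    using that by (simp add: coef_peg_at pegs_iff del: topspace_product_topology)
  have face: "simplical_face i t \<in> standard_simplex ?p"
    if "i < length qs" "j < length qs" "j \<noteq> i" "t \<in> standard_simplex (length qs - 2)" for i j t
  proof -
    have "?p = Suc (length qs - 2)" using that(1-3) by linarith
    then show ?thesis using simplical_face_in[OF that(4), of i] that(1) by simp
  qed
  show ?thesis
    unfolding PEG_def
  proof (intro CollectI conjI ballI allI impI)
    show "coef_peg qs \<beta> \<in> extensional (topspace (peg_top qs))"
      unfolding coef_peg_def pegs_def by (rule restrict_extensional)
    show "continuous_map (peg_top qs) (product_topology (\<lambda>_. T) {..<length qs}) (coef_peg qs \<beta>)" by (rule cont)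
    show "coef_peg qs \<beta> (t, s) j = coef_peg qs \<beta> (t, s') j"
      if "t \<in> standard_simplex ?p" "s \<in> topspace (prism_top qs)" "s' \<in> topspace (prism_top qs)" for t s s' j
      by (rule fun_cong[OF indep[OF that]])
    show "coef_peg qs \<beta> (simplical_face i t, s) j = coef_peg qs \<beta> (simplical_face i t, s') j"
      if "i < length qs" "j < length qs" "j \<noteq> i" "t \<in> standard_simplex (length qs - 2)"
        "s \<in> topspace (prism_top qs)" "s' \<in> topspace (prism_top qs)" for i j t s s'
      by (rule fun_cong[OF indep[OF face[OF that(1-4)] that(5,6)]])
  qed
qed

lemma peg_face_coef:
  assumes "i < length qs" "j \<le> Suc (qs ! i)"
  shows "peg_face (incr qs i) i j (coef_peg (incr qs i) \<beta>) = coef_peg qs \<beta>"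
proof -
  have eq: "(incr qs i)[i := incr qs i ! i - 1] = qs" using assms(1) by simp
  show ?thesis
    unfolding peg_face_def coef_peg_def[of qs] eq pegs_def[symmetric]
  proof (rule restrict_pegs_eqI)
    fix t s assume ts: "(t, s) \<in> pegs qs"
    show "(case (t, s) of (t, s) \<Rightarrow> coef_peg (incr qs i) \<beta> (t, s(i := simplical_face j (s i))))
       = (case (t, s) of (t, s) \<Rightarrow> coefs (length qs - 1) \<beta> t)"
      using coef_peg_at[OF pegs_face[OF ts assms], of \<beta>] by simp
  qed
qed

lemma peg_degen_coef:
  assumes "i < length qs" "j \<le> qs ! i"
  shows "peg_degen qs i j (coef_peg qs \<beta>) = coef_peg (incr qs i) \<beta>"
  unfolding peg_degen_def coef_peg_def[of "incr qs i"] pegs_def[symmetric]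
proof (rule restrict_pegs_eqI)
  fix t s assume ts: "(t, s) \<in> pegs (incr qs i)"
  show "(case (t, s) of (t, s) \<Rightarrow> coef_peg qs \<beta> (t, s(i := codegen j (s i))))
     = (case (t, s) of (t, s) \<Rightarrow> coefs (length (incr qs i) - 1) \<beta> t)"
    using coef_peg_at[OF pegs_degen[OF ts assms], of \<beta>] by simp
qed

text \<open>The two pegs differ by right multiplication with \<open>w\<close>, so only their orbits
  agree in general. This is why the prismatic map takes values in the classifying space and not in
  its total space.\<close>

lemma peg_base_face_coef:
  assumes k: "2 \<le> length qs" "k < length qs" and \<beta>: "\<beta> \<in> S (length qs - 1)"
  shows "peg_orbit G T (omit_nth k qs) (peg_base_face qs k (coef_peg qs \<beta>))
    = peg_orbit G T (omit_nth k qs) (coef_peg (omit_nth k qs) (omit_nth k \<beta>))"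
proof -
  obtain p where p: "length qs = Suc (Suc p)" using k(1) by (metis Suc_le_D add_2_eq_Suc' numeral_2_eq_2 Suc_le_mono)
  have l: "length (omit_nth k qs) = Suc p" using k p by (simp add: length_omit_nth)
  have ne: "qs \<noteq> []" "omit_nth k qs \<noteq> []" using p l by auto
  have \<beta>': "\<beta> \<in> S (Suc p)" using \<beta> p by simp
  \<comment> \<open>The factor from \<open>coef_face\<close>: nontrivial for the last vertex only,
    where frames change by the transition function.\<close>
  define w where "w = (\<lambda>t. if k = Suc p then v \<beta> t else \<one>)"
  have w: "continuous_map (simplex_top (length (omit_nth k qs) - 1)) T w"
    using v_continuous[OF \<beta>'] l continuous_one unfolding w_def by (cases "k = Suc p") simp_all
  have "peg_mul G (omit_nth k qs) (peg_base_face qs k (coef_peg qs \<beta>)) w = coef_peg (omit_nth k qs) (omit_nth k \<beta>)"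
    unfolding peg_mul_def coef_peg_def[of "omit_nth k qs"]
  proof (rule restrict_pegs_eqI)
    fix t s assume ts: "(t, s) \<in> pegs (omit_nth k qs)"
    then have t: "t \<in> standard_simplex p" unfolding pegs_iff l by simp
    have kp: "k \<le> Suc p" using k p by simp
    have wc: "w t \<in> carrier G" using simplex_fun[OF w] t l by simp
    have st: "coefs p (omit_nth k \<beta>) t \<in> steps G p" by (rule coefs_steps[OF S_face[OF \<beta>' kp] t])
    have "peg_base_face qs k (coef_peg qs \<beta>) (t, s) = omit k (coefs (Suc p) \<beta> (simplical_face k t))"
      unfolding peg_base_face_at[OF ts] coef_peg_at[OF pegs_base[OF ts k]] using p by simp
    moreover have "rmul G p (omit k (coefs (Suc p) \<beta> (simplical_face k t))) (w t) = coefs p (omit_nth k \<beta>) t"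
      using coefs_face[OF \<beta>' kp t one_closed] wc kp rmul_one[OF st]
      by (simp add: omit_rmul flip: w_def[THEN fun_cong])
    ultimately show "(case (t, s) of (t, s) \<Rightarrow> rmul G (length (omit_nth k qs) - 1) (peg_base_face qs k (coef_peg qs \<beta>) (t, s)) (w t))
       = (case (t, s) of (t, s) \<Rightarrow> coefs (length (omit_nth k qs) - 1) (omit_nth k \<beta>) t)"
      using l by simp
  qed
  then show ?thesis
    using peg_orbit_mul[OF ne(2) peg_valued_base[OF PEG_valued[OF ne(1) coef_peg_PEG[OF ne(1) \<beta>]] k] w] by simp
qed

lemma prismatic_map_star_orbit: "prismatic_map (prismatic_star (complex_sset K)) (PBG G T) star_orbit"
  unfolding prismatic_map_def
proof (intro conjI allI impI ballI)
  fix qs :: "nat list" and x assume qs: "qs \<noteq> []" and x: "x \<in> star_cells K qs"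
  obtain \<sigma> \<tau> \<beta> where x': "x = (\<sigma>, \<tau>, \<beta>)" by (cases x rule: prod_cases3)
  have "\<beta> \<in> S (length qs - 1)" using x unfolding x' star_cells_prism_iff by blast
  then show "star_orbit qs x \<in> cells (PBG G T) qs"
    using coef_peg_PEG[OF qs] unfolding cells_PBG x' star_orbit_def by simp
next
  fix qs :: "nat list" and i x j
  assume i: "i < length qs" and x: "x \<in> star_cells K (incr qs i)" and j: "j \<le> Suc (qs ! i)"
  obtain \<sigma> \<tau> \<beta> where x': "x = (\<sigma>, \<tau>, \<beta>)" by (cases x rule: prod_cases3)
  have \<beta>: "\<beta> \<in> S (length (incr qs i) - 1)" using x unfolding x' star_cells_prism_iff by blast
  have ne: "incr qs i \<noteq> []" using i by auto
  show "star_orbit qs (prism_face (prismatic_star (complex_sset K)) (incr qs i) i j x)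
      = prism_face (PBG G T) (incr qs i) i j (star_orbit (incr qs i) x)"
    using prism_face_PBG[OF PEG_valued[OF ne coef_peg_PEG[OF ne \<beta>]] i j] peg_face_coef[OF i j, of \<beta>]
    by (simp add: x' star_orbit_def prismatic_star_def)
next
  fix qs :: "nat list" and i x j
  assume i: "i < length qs" and x: "x \<in> star_cells K qs" and j: "j \<le> qs ! i"
  obtain \<sigma> \<tau> \<beta> where x': "x = (\<sigma>, \<tau>, \<beta>)" by (cases x rule: prod_cases3)
  have \<beta>: "\<beta> \<in> S (length qs - 1)" using x unfolding x' star_cells_prism_iff by blast
  have ne: "qs \<noteq> []" using i by auto
  show "star_orbit (incr qs i) (prism_degen (prismatic_star (complex_sset K)) qs i j x)
      = prism_degen (PBG G T) qs i j (star_orbit qs x)"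
    using prism_degen_PBG[OF PEG_valued[OF ne coef_peg_PEG[OF ne \<beta>]] i j] peg_degen_coef[OF i j, of \<beta>]
    by (simp add: x' star_orbit_def prismatic_star_def)
next
  fix qs :: "nat list" and k x
  assume k: "2 \<le> length qs \<and> k < length qs" and x: "x \<in> star_cells K qs"
  obtain \<sigma> \<tau> \<beta> where x': "x = (\<sigma>, \<tau>, \<beta>)" by (cases x rule: prod_cases3)
  have \<beta>: "\<beta> \<in> S (length qs - 1)" using x unfolding x' star_cells_prism_iff by blast
  have ne: "qs \<noteq> []" using k by auto
  show "star_orbit (omit_nth k qs) (base_face (prismatic_star (complex_sset K)) qs k x)
      = base_face (PBG G T) qs k (star_orbit qs x)"
    using base_face_PBG[OF PEG_valued[OF ne coef_peg_PEG[OF ne \<beta>]], of k] peg_base_face_coef[OF _ _ \<beta>, of k] k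
    by (simp add: x' star_orbit_def prismatic_star_def Let_def)
qed

abbreviation star_real :: "('a list \<times> 'a list \<times> 'a list) preal_point set topology" where
  "star_real \<equiv> preal (prismatic_star (complex_sset K))"

definition star_map :: "('a list \<times> 'a list \<times> 'a list) preal_point set \<Rightarrow> 'g EG_point set set" where
  "star_map = ev G T \<circ> preal_map (PBG G T) star_orbit"

text \<open>At a cell point the evaluation yields the class of the coefficients of
  \<open>\<beta>\<close> at \<open>t\<close>, which is the image of the frame with unit group
  coordinate. That frame lies over the barycentric point of \<open>\<beta>\<close> at
  \<open>t\<close>, the first component of \<open>complex_lambda\<close>.\<close>

lemma star_map_eq:
  assumes "X \<in> topspace star_real"
  shows "star_map X = class_map (fst (complex_lambda K X))"
proof -
  obtain p t qs x s where X: "X = star_point K p t ((qs, x), s)" and t: "t \<in> standard_simplex p"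
    and z: "((qs, x), s) \<in> topspace (slice_cells (prismatic_star (complex_sset K)) p)"
    using assms by (rule preal_cases)
  obtain \<sigma> \<tau> \<beta> where x: "x = (\<sigma>, \<tau>, \<beta>)" by (cases x rule: prod_cases3)
  have l: "length qs = Suc p" and cell: "x \<in> star_cells K qs" and s: "s \<in> topspace (prism_top qs)"
    using z unfolding slice_cells_iff by blast+
  have "\<beta> \<in> S (length qs - 1)" using cell unfolding x star_cells_prism_iff by blast
  moreover have "qs \<noteq> []" using l by auto
  ultimately have PEG: "coef_peg qs \<beta> \<in> PEG T qs" and \<beta>: "\<beta> \<in> S p" using coef_peg_PEG l by auto
  have "star_map X = ev G T (preal_point (PBG G T) p t ((qs, peg_orbit G T qs (coef_peg qs \<beta>)), s))"
    unfolding star_map_def o_def X preal_map_point[OF prismatic_map_star_orbit t z] by (simp add: x star_orbit_def)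
  also have "\<dots> = ev_class p t (coef_peg qs \<beta> (t, s))"
    by (rule ev_point[OF t l s PEG])
  also have "coef_peg qs \<beta> (t, s) = coefs p \<beta> t"
    using coef_peg_at[of t s qs \<beta>] t s l by (simp add: pegs_iff del: topspace_product_topology)
  also have "ev_class p t (coefs p \<beta> t) = class_map (barycentric \<beta> t)"
    using class_map_proj[OF fclass_in[OF \<beta> t one_closed]] proj_F[OF \<beta> t one_closed]
      frame_map_fclass[OF \<beta> t one_closed] rmul_one[OF coefs_steps[OF \<beta> t]]
    by (simp add: ev_class_def)
  finally show ?thesis
    using complex_lambda_point[OF t z[unfolded x]] by (simp add: X x)
qed

section \<open>Classification\<close>

lemma act_closed_EG: "act_closed G (EG_bundle G T)"
  unfolding act_closed_def
proof (intro ballI conjI)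
  fix e g assume e: "e \<in> topspace (tot_space (EG_bundle G T))" and g: "g \<in> carrier G"
  then have e': "e \<in> topspace EG" by (simp add: EG_bundle_def)
  then show "act (EG_bundle G T) e g \<in> topspace (tot_space (EG_bundle G T))"
    using g EG_act_in by (simp add: EG_bundle_def)
  show "proj (EG_bundle G T) (act (EG_bundle G T) e g) = proj (EG_bundle G T) e"
    using BG_class_eq_iff[OF e' EG_act_in[OF e' g]] g by (auto simp: EG_bundle_def)
qed

lemma pullback_F_star_proj:
  assumes "pr \<in> {fst, snd}"
  shows "bundle_isomorphic G (pullback_bundle (complex_star_space K) fst F) (pullback_bundle (complex_star_space K) pr F)"
  using assms pullback_F_homotopic[OF compact_complex_star[OF complex] homotopic_star_proj[OF complex]]
  by (auto intro: bundle_isomorphic_refl)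

text \<open>Stated for a map \<open>m\<close> from any space, so that it serves both the prismatic
  realization and the star itself. The exchange of \<open>fst\<close> for \<open>pr\<close> takes
  place on the compact star before pulling back along \<open>m\<close>, because homotopy invariance
  is available over compact spaces.\<close>

lemma classifying_map_star:
  assumes m: "continuous_map Z (complex_star_space K) m" and pr: "pr \<in> {fst, snd}"
    and f: "\<And>z. z \<in> topspace Z \<Longrightarrow> f z = class_map (fst (m z))"
  shows "classifying_map G T Z (pullback_bundle Z m (pullback_bundle (complex_star_space K) pr F)) f"
proof -
  let ?Y = "complex_star_space K"
  have fm: "continuous_map Z Ksp (fst \<circ> m)"
    by (rule continuous_map_compose[OF m continuous_map_star_proj(1)[OF complex]])
  have "continuous_map Z (BG_space G T) (class_map \<circ> (fst \<circ> m))"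
    by (rule continuous_map_compose[OF fm continuous_map_class_map])
  then have "continuous_map Z (BG_space G T) f"
    by (rule continuous_map_eq) (simp add: f)
  moreover have "bundle_isomorphic G (pullback_bundle Z f (EG_bundle G T))
      (pullback_bundle Z (class_map \<circ> (fst \<circ> m)) (EG_bundle G T))"
    by (rule pullback_bundle_cong) (simp add: f)
  moreover have "bundle_isomorphic G (pullback_bundle Z (class_map \<circ> (fst \<circ> m)) (EG_bundle G T))
      (pullback_bundle Z (fst \<circ> m) (pullback_bundle Ksp class_map (EG_bundle G T)))"
    by (rule bundle_isomorphic_sym[OF _ pullback_bundle_comp[OF fm]])
      (intro act_closed_pullback act_closed_EG)
  moreover have "bundle_isomorphic G (pullback_bundle Z (fst \<circ> m) (pullback_bundle Ksp class_map (EG_bundle G T)))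
      (pullback_bundle Z (fst \<circ> m) F)"
    by (rule pullback_bundle_isomorphic[OF fm bundle_isomorphic_sym[OF act_closed_F F_isomorphic_pullback]])
  moreover have "bundle_isomorphic G (pullback_bundle Z (fst \<circ> m) F) (pullback_bundle Z m (pullback_bundle ?Y fst F))"
    by (rule bundle_isomorphic_sym[OF _ pullback_bundle_comp[OF m]]) (intro act_closed_pullback act_closed_F)
  moreover have "bundle_isomorphic G (pullback_bundle Z m (pullback_bundle ?Y fst F))
      (pullback_bundle Z m (pullback_bundle ?Y pr F))"
    by (rule pullback_bundle_isomorphic[OF m pullback_F_star_proj[OF pr]])
  ultimately show ?thesis
    unfolding classifying_map_def by (meson bundle_isomorphic_trans)
qed

lemma classifying_star_map:
  assumes "pr \<in> {fst, snd}"
  shows "classifying_map G T star_real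
    (pullback_bundle star_real (complex_lambda K) (pullback_bundle (complex_star_space K) pr F)) star_map"
  by (rule classifying_map_star[OF continuous_map_complex_lambda[OF complex] assms star_map_eq])

text \<open>Composition with \<open>\<kappa>\<close> classifies the pullback along
  \<open>complex_lambda K \<circ> \<kappa>\<close>. This self-map of the compact star is homotopic
  to the identity, so the pullback is isomorphic to the original bundle.\<close>

lemma classifying_homotopy_inverse:
  assumes pr: "pr \<in> {fst, snd}" and \<kappa>: "homotopy_inverse star_real (complex_star_space K) (complex_lambda K) \<kappa>"
  shows "classifying_map G T (complex_star_space K) (pullback_bundle (complex_star_space K) pr F) (star_map \<circ> \<kappa>)"
proof -
  let ?Y = "complex_star_space K" and ?m = "complex_lambda K \<circ> \<kappa>"
  have \<kappa>c: "continuous_map ?Y star_real \<kappa>" and hom: "homotopic_with (\<lambda>_. True) ?Y ?Y ?m id"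
    using \<kappa> by (auto simp: homotopy_inverse_def)
  have mc: "continuous_map ?Y ?Y ?m"
    by (rule continuous_map_compose[OF \<kappa>c continuous_map_complex_lambda[OF complex]])
  have prc: "continuous_map ?Y Ksp pr" using pr continuous_map_star_proj[OF complex] by auto
  have cl: "classifying_map G T ?Y (pullback_bundle ?Y ?m (pullback_bundle ?Y pr F)) (star_map \<circ> \<kappa>)"
  proof (rule classifying_map_star[OF mc pr])
    fix y assume "y \<in> topspace ?Y"
    then have "\<kappa> y \<in> topspace star_real" using \<kappa>c by (auto simp: continuous_map_def)
    then show "(star_map \<circ> \<kappa>) y = class_map (fst (?m y))" by (simp add: star_map_eq)
  qed
  have "homotopic_with (\<lambda>_. True) ?Y Ksp (pr \<circ> ?m) (pr \<circ> id)"
    by (rule homotopic_with_compose_continuous_map_left[OF hom prc]) simp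
  from pullback_F_homotopic[OF compact_complex_star[OF complex] this]
  have "bundle_isomorphic G (pullback_bundle ?Y (pr \<circ> ?m) F) (pullback_bundle ?Y pr F)" by simp
  then have "bundle_isomorphic G (pullback_bundle ?Y ?m (pullback_bundle ?Y pr F)) (pullback_bundle ?Y pr F)"
    using bundle_isomorphic_trans[OF pullback_bundle_comp[OF mc]] by blast
  then show ?thesis
    using cl bundle_isomorphic_trans unfolding classifying_map_def by blast
qed

end

subsection \<open>Naturality\<close>

text \<open>The coefficients are products of values of \<open>v\<close> on front faces of
  \<open>\<beta>\<close> at points determined by \<open>t\<close> and \<open>j\<close>, and
  \<open>map\<close> commutes with taking front faces.\<close>

lemma coef_natural:
  assumes "transitions G T K v" and \<beta>: "\<beta> \<in> simplices (complex_sset K) p" and t: "t \<in> standard_simplex p"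
    and eq: "\<And>p \<sigma> t. \<sigma> \<in> simplices (complex_sset K) (Suc p) \<Longrightarrow> t \<in> standard_simplex p \<Longrightarrow> v \<sigma> t = w (map h \<sigma>) t"
  shows "coef G v \<beta> t j = coef G w (map h \<beta>) t j"
proof -
  interpret transitions G T K v by (rule assms(1))
  have "k \<le> p \<Longrightarrow> coef_upto G v \<beta> t j k = coef_upto G w (map h \<beta>) t j k" for k
  proof (induction k)
    case (Suc k)
    have "factor G v \<beta> t j (Suc k) = factor G w (map h \<beta>) t j (Suc k)"
      using eq[OF S_take[OF \<beta> Suc.prems] front_in[OF t, of j k]] by (auto simp: factor_def take_map)
    then show ?case using Suc by simp
  qed simp
  then show ?thesis using \<beta> by (simp add: coef_def simplices_complex_iff)
qed

lemma lie_group_top_group: "lie_group G T n \<A> \<Longrightarrow> top_group G T"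
  by (auto simp: lie_group_def top_group_def top_group_axioms_def)

lemma star_orbit_natural:
  assumes K: "transitions G T K v" and L: "transitions G T L w"
    and eq: "\<And>p \<sigma> t. \<sigma> \<in> simplices (complex_sset K) (Suc p) \<Longrightarrow> t \<in> standard_simplex p \<Longrightarrow> v \<sigma> t = w (map h \<sigma>) t"
    and qs: "qs \<noteq> []" and cell: "(\<sigma>, \<tau>, \<beta>) \<in> star_cells K qs"
  shows "transitions.star_orbit G T v qs (\<sigma>, \<tau>, \<beta>)
    = transitions.star_orbit G T w qs (map h \<sigma>, map h \<tau>, map h \<beta>)"
proof -
  interpret K: transitions G T K v by (rule K)
  interpret L: transitions G T L w by (rule L)
  have \<beta>: "\<beta> \<in> simplices (complex_sset K) (length qs - 1)" using cell unfolding star_cells_prism_iff by blast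
  have "K.coef_peg qs \<beta> = L.coef_peg qs (map h \<beta>)"
    unfolding K.coef_peg_def L.coef_peg_def
  proof (rule restrict_pegs_eqI)
    fix t s assume "(t, s) \<in> pegs qs"
    then have t: "t \<in> standard_simplex (length qs - 1)" unfolding pegs_iff by blast
    have "coef G v \<beta> t = coef G w (map h \<beta>) t"
      by (rule ext, rule coef_natural[OF K \<beta> t]) (rule eq)
    then show "(case (t, s) of (t, s) \<Rightarrow> K.coefs (length qs - 1) \<beta> t)
       = (case (t, s) of (t, s) \<Rightarrow> L.coefs (length qs - 1) (map h \<beta>) t)"
      by (simp add: K.coefs_def L.coefs_def)
  qed
  then show ?thesis unfolding K.star_orbit_def L.star_orbit_def by simp
qed

theorem corollary8p2:
  fixes G :: "('g, 'm) monoid_scheme" and T :: "'g topology"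
    and n :: nat and \<A> :: "('g set \<times> ('g \<Rightarrow> nat \<Rightarrow> real)) set"
  assumes "lie_group G T n \<A>"
  shows "\<exists>\<Phi> :: 'a::linorder set set \<Rightarrow> ('a list \<Rightarrow> (nat \<Rightarrow> real) \<Rightarrow> 'g) \<Rightarrow>
            nat list \<Rightarrow> 'a list \<times> 'a list \<times> 'a list \<Rightarrow> 'g peg set.
    (\<forall>K v. abstract_complex K \<and> compatible_transitions G T (complex_sset K) v \<longrightarrow>
       prismatic_map (prismatic_star (complex_sset K)) (PBG G T) (\<Phi> K v) \<and>
       (\<forall>pr\<in>{fst, snd}.
          let X = preal (prismatic_star (complex_sset K));
              Y = complex_star_space K;
              f = ev G T \<circ> preal_map (PBG G T) (\<Phi> K v);
              F = pullback_bundle Y pr (complex_bundle G T K v)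
          in classifying_map G T X (pullback_bundle X (complex_lambda K) F) f \<and>
             (\<forall>\<kappa>. homotopy_inverse X Y (complex_lambda K) \<kappa> \<longrightarrow>
                classifying_map G T Y F (f \<circ> \<kappa>)))) \<and>
    (\<forall>K L v w h. abstract_complex K \<and> abstract_complex L \<and>
       compatible_transitions G T (complex_sset K) v \<and>
       compatible_transitions G T (complex_sset L) w \<and>
       simplicial_map K L h \<and>
       (\<forall>p. \<forall>\<sigma>\<in>simplices (complex_sset K) (Suc p). \<forall>t\<in>standard_simplex p.
          v \<sigma> t = w (map h \<sigma>) t) \<longrightarrow>
       (\<forall>qs. qs \<noteq> [] \<longrightarrow> (\<forall>(\<sigma>, \<tau>, \<beta>)\<in>cells (prismatic_star (complex_sset K)) qs.
          \<Phi> K v qs (\<sigma>, \<tau>, \<beta>) = \<Phi> L w qs (map h \<sigma>, map h \<tau>, map h \<beta>))))"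
proof -
  interpret top_group G T by (rule lie_group_top_group[OF assms])
  have tr: "transitions G T K v"
    if "abstract_complex K" "compatible_transitions G T (complex_sset K) v"
    for K :: "'a set set" and v
    using that by unfold_locales
  show ?thesis
  \<comment> \<open>The construction refers to the complex only through the vertex sequences it is
    applied to, so the witness ignores \<open>K\<close>.\<close>
  proof (intro exI[of _ "\<lambda>K v. transitions.star_orbit G T v"] conjI allI impI)
    fix K :: "'a set set" and v
    assume "abstract_complex K \<and> compatible_transitions G T (complex_sset K) v"
    then interpret transitions G T K v using tr by blast
    show "prismatic_map (prismatic_star (complex_sset K)) (PBG G T) star_orbit"
      by (rule prismatic_map_star_orbit)
    show "\<forall>pr\<in>{fst, snd}.
          let X = preal (prismatic_star (complex_sset K));
              Y = complex_star_space K;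
              f = ev G T \<circ> preal_map (PBG G T) star_orbit;
              F = pullback_bundle Y pr (complex_bundle G T K v)
          in classifying_map G T X (pullback_bundle X (complex_lambda K) F) f \<and>
             (\<forall>\<kappa>. homotopy_inverse X Y (complex_lambda K) \<kappa> \<longrightarrow>
                classifying_map G T Y F (f \<circ> \<kappa>))"
      unfolding Let_def
      using classifying_star_map classifying_homotopy_inverse unfolding star_map_def by blast
  next
    fix K L :: "'a set set" and v w h and qs :: "nat list"
    assume a: "abstract_complex K \<and> abstract_complex L \<and>
       compatible_transitions G T (complex_sset K) v \<and>
       compatible_transitions G T (complex_sset L) w \<and>
       simplicial_map K L h \<and>
       (\<forall>p. \<forall>\<sigma>\<in>simplices (complex_sset K) (Suc p). \<forall>t\<in>standard_simplex p.
          v \<sigma> t = w (map h \<sigma>) t)" and qs: "qs \<noteq> []"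
    have K: "transitions G T K v" and L: "transitions G T L w"
      using a tr by blast+
    have eq: "v \<sigma> t = w (map h \<sigma>) t"
      if "\<sigma> \<in> simplices (complex_sset K) (Suc p)" "t \<in> standard_simplex p" for p \<sigma> t
      using a that by blast
    show "\<forall>(\<sigma>, \<tau>, \<beta>)\<in>cells (prismatic_star (complex_sset K)) qs.
        transitions.star_orbit G T v qs (\<sigma>, \<tau>, \<beta>)
          = transitions.star_orbit G T w qs (map h \<sigma>, map h \<tau>, map h \<beta>)"
    proof (intro ballI, clarify)
      fix \<sigma> \<tau> \<beta> assume "(\<sigma>, \<tau>, \<beta>) \<in> cells (prismatic_star (complex_sset K)) qs"
      from star_orbit_natural[OF K L _ qs this] eq
      show "transitions.star_orbit G T v qs (\<sigma>, \<tau>, \<beta>)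
          = transitions.star_orbit G T w qs (map h \<sigma>, map h \<tau>, map h \<beta>)" by blast
    qed
  qed
qed

end
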